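(* Let $1\le p<\infty$, let $\mathcal B$ be a $2m\times 2m$ real matrix, and let $(A,D(A))$ be the operator on $\mathbf X_p=(L^p(0,1))^{2m}$ given by $$A\binom{\upsilon}{\varpi}=\binom{-\upsilon'}{\varpi'},\qquad D(A)=\Bigl\{\tbinom{\upsilon}{\varpi}\in (W^{1,p}(0,1))^{2m}:\ \tbinom{\upsilon(0)}{\varpi(1)}=\mathcal B\tbinom{\upsilon(1)}{\varpi(0)}\Bigr\}.$$ For $t\ge 0$ and $\binom{\upsilon}{\varpi}\in\mathbf X_p$ define $$T(t)\binom{\upsilon}{\varpi}(x)=\binom{(\mathcal B^n)^{11}\upsilon(n-t+x)+(\mathcal B^n)^{12}\varpi(1-n+t-x)}{(\mathcal B^n)^{21}\upsilon(1-t+n-x)+(\mathcal B^n)^{22}\varpi(t-n+x)},$$ where in the first row $n\in\mathbb N_0$ is such that $n-1+x<t<n+x$, and in the second row $n\in\mathbb N_0$ is such that $n-x<t<n+1-x$. Then the family $(T(t))_{t\ge0}$ is a $C_0$-semigroup on $\mathbf X_p$ whose generator is $(A,D(A))$; that is, $T(t)=G(t)$ for all $t\ge0$, where $(G(t))_{t\ge0}$ denotes the $C_0$-semigroup generated by $(A,D(A))$.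
   Context: Fix integers $m_+,m_-\ge0$ with $m_++m_-=2m\ge1$. Elements of $\mathbf X_p$ are written $\binom{\upsilon}{\varpi}$ with $\upsilon$ having $m_+$ components and $\varpi$ having $m_-$ components. Any $2m\times2m$ matrix $M$ is written in block form $M=\begin{pmatrix} M^{11} & M^{12} \\ M^{21} & M^{22} \end{pmatrix}$ with blocks of sizes $m_+\times m_+$, $m_+\times m_-$, $m_-\times m_+$, $m_-\times m_-$; thus $(\mathcal B^n)^{ab}$ denotes the $(a,b)$ block of the power $\mathcal B^n$, with $\mathcal B^0=I$. For given $t\ge0$, the integers $n$ in the two rows (generally different and depending on $x$) are uniquely determined for a.e. $x\in(0,1)$, and the formula is understood for a.e. $x$. It is known that $(A,D(A))$ generates a $C_0$-semigroup on $\mathbf X_p$ for every matrix $\mathcal B$ and every $1\le p<\infty$. *)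

theory Defs
  imports "HOL-Analysis.Analysis"
begin

definition unit_interval :: "real measure" where
  "unit_interval = restrict_space lborel {0<..<1}"

definition l0_rel :: "(real \<Rightarrow> real) \<Rightarrow> (real \<Rightarrow> real) \<Rightarrow> bool" where
  "l0_rel f g \<longleftrightarrow> f \<in> borel_measurable unit_interval \<and> g \<in> borel_measurable unit_interval
     \<and> (AE x in unit_interval. f x = g x)"

text \<open>Classes of measurable functions on the open unit interval modulo equality almost everywhere.
  The exponent \<open>p\<close> is a term, so the \<open>L\<^sup>p\<close> spaces are subsets of this vector space.\<close>

quotient_type l0 = "real \<Rightarrow> real" / partial: l0_rel
proof (rule part_equivpI)
  show "\<exists>f. l0_rel f f"
    by (rule exI[of _ "\<lambda>_. 0"]) (simp add: l0_rel_def)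
  show "symp l0_rel"
    by (auto simp: symp_def l0_rel_def)
  show "transp l0_rel"
    unfolding transp_def l0_rel_def by (auto elim: AE_mp)
qed

instantiation l0 :: real_vector
begin

lift_definition zero_l0 :: l0 is "\<lambda>_. 0"
  by (simp add: l0_rel_def)

lift_definition plus_l0 :: "l0 \<Rightarrow> l0 \<Rightarrow> l0" is "\<lambda>f g x. f x + g x"
  by (auto simp: l0_rel_def elim: AE_mp)

lift_definition minus_l0 :: "l0 \<Rightarrow> l0 \<Rightarrow> l0" is "\<lambda>f g x. f x - g x"
  by (auto simp: l0_rel_def elim: AE_mp)

lift_definition uminus_l0 :: "l0 \<Rightarrow> l0" is "\<lambda>f x. - f x"
  by (auto simp: l0_rel_def elim: AE_mp)

lift_definition scaleR_l0 :: "real \<Rightarrow> l0 \<Rightarrow> l0" is "\<lambda>c f x. c * f x"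
  by (auto simp: l0_rel_def elim: AE_mp)

instance
  by standard (transfer; auto simp: l0_rel_def algebra_simps)+

end

lift_definition in_Lp :: "real \<Rightarrow> l0 \<Rightarrow> bool" is
  "\<lambda>p f. integrable unit_interval (\<lambda>x. \<bar>f x\<bar> powr p)"
proof -
  fix p :: real and f g assume "l0_rel f g"
  then show "integrable unit_interval (\<lambda>x. \<bar>f x\<bar> powr p)
           = integrable unit_interval (\<lambda>x. \<bar>g x\<bar> powr p)"
    unfolding l0_rel_def by (intro integrable_cong_AE) (auto elim: AE_mp)
qed

definition Lp :: "real \<Rightarrow> l0 set" where
  "Lp p = {f. in_Lp p f}"

lift_definition Lp_norm :: "real \<Rightarrow> l0 \<Rightarrow> real" is
  "\<lambda>p f. (LINT x|unit_interval. \<bar>f x\<bar> powr p) powr (1 / p)"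
proof -
  fix p :: real and f g assume "l0_rel f g"
  then have "(LINT x|unit_interval. \<bar>f x\<bar> powr p) = (LINT x|unit_interval. \<bar>g x\<bar> powr p)"
    unfolding l0_rel_def by (intro integral_cong_AE) (auto elim: AE_mp)
  then show "(LINT x|unit_interval. \<bar>f x\<bar> powr p) powr (1 / p)
           = (LINT x|unit_interval. \<bar>g x\<bar> powr p) powr (1 / p)"
    by simp
qed

definition loc_integrable :: "(real \<Rightarrow> real) \<Rightarrow> bool" where
  "loc_integrable f \<longleftrightarrow> (\<forall>a b. 0 < a \<and> b < 1 \<longrightarrow> set_integrable unit_interval {a..b} f)"

text \<open>Test functions of class \<open>C\<^sup>1\<close> with compact support in the open unit interval, as in Brezis'
  definition of one-dimensional Sobolev spaces.\<close>

definition test_function :: "(real \<Rightarrow> real) \<Rightarrow> bool" where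
  "test_function \<phi> \<longleftrightarrow> \<phi> C1_differentiable_on UNIV
     \<and> (\<exists>a b. 0 < a \<and> b < 1 \<and> (\<forall>x. x \<notin> {a..b} \<longrightarrow> \<phi> x = 0))"

definition weak_derivative_fun :: "(real \<Rightarrow> real) \<Rightarrow> (real \<Rightarrow> real) \<Rightarrow> bool" where
  "weak_derivative_fun f g \<longleftrightarrow> loc_integrable f \<and> loc_integrable g \<and>
     (\<forall>\<phi>. test_function \<phi> \<longrightarrow>
        (LINT x|unit_interval. f x * deriv \<phi> x) = - (LINT x|unit_interval. g x * \<phi> x))"

definition has_weak_deriv :: "l0 \<Rightarrow> l0 \<Rightarrow> bool" where
  "has_weak_deriv f g \<longleftrightarrow> weak_derivative_fun (rep_l0 f) (rep_l0 g)"

definition weak_deriv :: "l0 \<Rightarrow> l0" where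
  "weak_deriv f = (THE g. has_weak_deriv f g)"

definition W1p :: "real \<Rightarrow> l0 set" where
  "W1p p = {f \<in> Lp p. \<exists>g \<in> Lp p. has_weak_deriv f g}"

text \<open>An element of \<open>W\<^sup>1\<^sup>,\<^sup>p(0,1)\<close> has exactly one representative that extends continuously to the
  closed interval; its values at the end points are the ones meant in boundary conditions.\<close>

definition point_value :: "l0 \<Rightarrow> real \<Rightarrow> real" where
  "point_value f a = (THE c. \<exists>v. continuous_on {0..1} v
      \<and> (AE x in unit_interval. rep_l0 f x = v x) \<and> v a = c)"

text \<open>The underlying normed space is a subset \<open>X\<close> of a real vector space with a norm \<open>N\<close>.\<close>

definition bounded_operator_on :: "'a::real_vector set \<Rightarrow> ('a \<Rightarrow> real) \<Rightarrow> ('a \<Rightarrow> 'a) \<Rightarrow> bool" where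
  "bounded_operator_on X N S \<longleftrightarrow>
     (\<forall>f\<in>X. S f \<in> X) \<and>
     (\<forall>f\<in>X. \<forall>g\<in>X. S (f + g) = S f + S g) \<and>
     (\<forall>c. \<forall>f\<in>X. S (c *\<^sub>R f) = c *\<^sub>R S f) \<and>
     (\<exists>C. \<forall>f\<in>X. N (S f) \<le> C * N f)"

definition C0_semigroup ::
  "'a::real_vector set \<Rightarrow> ('a \<Rightarrow> real) \<Rightarrow> (real \<Rightarrow> 'a \<Rightarrow> 'a) \<Rightarrow> bool" where
  "C0_semigroup X N T \<longleftrightarrow>
     (\<forall>t\<ge>0. bounded_operator_on X N (T t)) \<and>
     (\<forall>f\<in>X. T 0 f = f) \<and>
     (\<forall>s\<ge>0. \<forall>t\<ge>0. \<forall>f\<in>X. T (s + t) f = T s (T t f)) \<and>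
     (\<forall>f\<in>X. \<forall>s\<ge>0. ((\<lambda>t. N (T t f - T s f)) \<longlongrightarrow> 0) (at s within {0..}))"

text \<open>The generator, given by its graph; unbounded operators are compared through their graphs, so
  that equality includes equality of the domains.\<close>

definition generator ::
  "'a::real_vector set \<Rightarrow> ('a \<Rightarrow> real) \<Rightarrow> (real \<Rightarrow> 'a \<Rightarrow> 'a) \<Rightarrow> ('a \<times> 'a) set" where
  "generator X N T = {(f, g). f \<in> X \<and> g \<in> X \<and>
     ((\<lambda>h. N ((1 / h) *\<^sub>R (T h f - f) - g)) \<longlongrightarrow> 0) (at_right 0)}"

definition op_graph :: "'a set \<Rightarrow> ('a \<Rightarrow> 'b) \<Rightarrow> ('a \<times> 'b) set" where
  "op_graph D A = {(f, A f) | f. f \<in> D}"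

text \<open>Vectors are indexed by a finite type \<open>'n\<close>; the set \<open>P\<close> holds the \<open>m\<^sub>+\<close> indices of the upper
  components \<open>\<upsilon>\<close> and \<open>- P\<close> the \<open>m\<^sub>-\<close> indices of the lower components \<open>\<varpi>\<close>, so either may be
  empty. The norm on the product is the sum norm; all the usual product norms are equivalent.\<close>

definition Xp :: "real \<Rightarrow> (l0 ^ 'n) set" where
  "Xp p = {f. \<forall>i. f $ i \<in> Lp p}"

definition Xp_norm :: "real \<Rightarrow> l0 ^ 'n \<Rightarrow> real" where
  "Xp_norm p f = (\<Sum>i\<in>UNIV. Lp_norm p (f $ i))"

definition outflow_values :: "'n set \<Rightarrow> l0 ^ 'n \<Rightarrow> real ^ 'n" where
  "outflow_values P f = (\<chi> i. if i \<in> P then point_value (f $ i) 1 else point_value (f $ i) 0)"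

definition inflow_values :: "'n set \<Rightarrow> l0 ^ 'n \<Rightarrow> real ^ 'n" where
  "inflow_values P f = (\<chi> i. if i \<in> P then point_value (f $ i) 0 else point_value (f $ i) 1)"

definition dom_A :: "real \<Rightarrow> real ^ 'n ^ 'n \<Rightarrow> 'n set \<Rightarrow> (l0 ^ 'n) set" where
  "dom_A p B P = {f. (\<forall>i. f $ i \<in> W1p p) \<and> inflow_values P f = B *v outflow_values P f}"

definition op_A :: "'n set \<Rightarrow> l0 ^ 'n \<Rightarrow> l0 ^ 'n" where
  "op_A P f = (\<chi> i. if i \<in> P then - weak_deriv (f $ i) else weak_deriv (f $ i))"

text \<open>The operation \<open>^\<close> on type \<open>real ^ 'n ^ 'n\<close> is the entrywise power, hence a separate power.\<close>

primrec matrix_power :: "real ^ 'n ^ 'n \<Rightarrow> nat \<Rightarrow> real ^ 'n ^ 'n" where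
  "matrix_power B 0 = mat 1"
| "matrix_power B (Suc n) = B ** matrix_power B n"

text \<open>The block with rows \<open>R\<close> and columns \<open>C\<close>, padded with zeros to full size.\<close>

definition block :: "'n set \<Rightarrow> 'n set \<Rightarrow> real ^ 'n ^ 'n \<Rightarrow> real ^ 'n ^ 'n" where
  "block R C M = (\<chi> i j. if i \<in> R \<and> j \<in> C then M $ i $ j else 0)"

definition upper_index :: "real \<Rightarrow> real \<Rightarrow> nat" where
  "upper_index t x = (THE n. real n - 1 + x < t \<and> t < real n + x)"

definition lower_index :: "real \<Rightarrow> real \<Rightarrow> nat" where
  "lower_index t x = (THE n. real n - x < t \<and> t < real n + 1 - x)"

definition T_fun ::
  "real ^ 'n ^ 'n \<Rightarrow> 'n set \<Rightarrow> real \<Rightarrow> (real \<Rightarrow> real ^ 'n) \<Rightarrow> real \<Rightarrow> real ^ 'n" where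
  "T_fun B P t u x =
     (let n = upper_index t x; M = matrix_power B n
      in block P P M *v u (real n - t + x) + block P (- P) M *v u (1 - real n + t - x))
   + (let n = lower_index t x; M = matrix_power B n
      in block (- P) P M *v u (1 - t + real n - x) + block (- P) (- P) M *v u (t - real n + x))"

text \<open>The resulting class does not depend on the chosen representatives; the points \<open>x\<close> where
  the index \<open>n\<close> is undefined are finite in number for each \<open>t\<close>.\<close>

definition T_op :: "real ^ 'n ^ 'n \<Rightarrow> 'n set \<Rightarrow> real \<Rightarrow> l0 ^ 'n \<Rightarrow> l0 ^ 'n" where
  "T_op B P t f = (\<chi> i. abs_l0 (\<lambda>x. T_fun B P t (\<lambda>y. \<chi> j. rep_l0 (f $ j) y) x $ i))"

end

theory Submission
  imports Defs
begin

text \<open>Replacing the lower components \<open>\<varpi>(x)\<close> by \<open>\<varpi>(1 - x)\<close> turns the flow into transport to the right in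
  every component, with inflow at \<open>0\<close> equal to \<open>\<B>\<close> applied to the outflow at \<open>1\<close>. Extend the state \<open>u\<close> from
  \<open>(0, 1)\<close> to \<open>(-\<infinity>, 1)\<close> by \<open>E u (z) = \<B>\<^sup>n u(z + n)\<close>, where \<open>n\<close> is such that \<open>0 < z + n < 1\<close>. The formula for \<open>T(t)\<close>
  then reads \<open>T(t)u (y) = E u (y - t)\<close>, and \<open>E (T(t)u) (z) = E u (z - t)\<close>, so strong continuity
  is continuity of translations in \<open>L\<^sup>p\<close>. The boundary condition
  says exactly that \<open>E u\<close> is continuous across \<open>0\<close>; hence both \<open>g = A f\<close> and \<open>g\<close> being the generator
  applied to \<open>f\<close> amount to \<open>E f (z) = c - \<integral> E g\<close> on \<open>(-1, 1)\<close>, the latter by Lebesgue differentiation and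
  \<open>L\<^sup>p\<close> convergence of averages. Uniqueness holds because \<open>s \<mapsto> T(t - s) G(s) f\<close> has
  zero right derivative for \<open>f\<close> in the common, dense domain.\<close>

section \<open>Uniqueness of the semigroup with a given generator\<close>

text \<open>The matrix may be singular, so there is in general no group: states are extended only to
  the left, where nonnegative powers suffice. No resolvent and no Hille-Yosida estimate enters.
  Instead both inclusions between the generator and A are proved directly, by trading derivatives
  for primitives; a primitive can be integrated across 0, where the boundary condition sits. Almost
  all limits are taken with the extended nonnegative integral of a p-th power, since it needs no
  integrability side conditions and a triangle inequality with the crude factor 2^p is enough for
  convergence to 0. The genuine norm inequality is required only by the abstract uniqueness
  argument. Since powers of the matrix may grow, the extension need not be p-integrable on the whole
  half line; every estimate is made on a bounded window, long enough for the times in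
  question.\<close>

lemma eventually_at_right_0_less: "0 < e \<Longrightarrow> \<forall>\<^sub>F h in at_right (0::real). 0 < h \<and> h < e"
  unfolding eventually_at_right_field by (intro exI[of _ e]) auto

text \<open>The points with \<phi> s \<le> e s form a compact set containing 0. Its largest element
  must be t, because the one-sided estimate would push any smaller one further to the right. Then e
  tends to 0.\<close>

lemma growth_zero_of_right_derivative:
  fixes \<phi> :: "real \<Rightarrow> real"
  assumes t: "0 \<le> t" and cont: "continuous_on {0..t} \<phi>" and z: "\<phi> 0 = 0"
    and right: "\<And>s e. \<lbrakk>0 \<le> s; s < t; 0 < e\<rbrakk> \<Longrightarrow> eventually (\<lambda>h. \<phi> (s + h) \<le> \<phi> s + e * h) (at_right 0)"
  shows "\<phi> t \<le> 0"
proof -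
  have "\<phi> t \<le> e * t" if e: "0 < e" for e
  proof -
    define S where "S = {s \<in> {0..t}. \<phi> s - e * s \<le> 0}"
    have "closed S"
      unfolding S_def by (intro continuous_on_closed_Collect_le continuous_intros cont)
    moreover have "S \<subseteq> {0..t}" by (auto simp: S_def)
    ultimately have "compact S"
      by (metis Int_absorb1 compact_Icc compact_Int_closed)
    moreover have "0 \<in> S" using t z by (auto simp: S_def)
    ultimately obtain u where u: "u \<in> S" "\<And>s. s \<in> S \<Longrightarrow> s \<le> u"
      using compact_attains_sup[of S] by auto
    have "u = t"
    proof (rule ccontr)
      assume "u \<noteq> t"
      then have ut: "0 \<le> u" "u < t" using u(1) by (auto simp: S_def)
      have "eventually (\<lambda>h. 0 < h \<and> h < t - u) (at_right 0)"
        using ut by (intro eventually_at_right_0_less) auto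
      then have "eventually (\<lambda>h. \<phi> (u + h) \<le> \<phi> u + e * h \<and> 0 < h \<and> h < t - u) (at_right 0)"
        using right[OF ut e] by eventually_elim auto
      then obtain h where h: "\<phi> (u + h) \<le> \<phi> u + e * h" "0 < h" "h < t - u"
        using eventually_happens'[OF trivial_limit_at_right_real] by blast
      then have "u + h \<in> S" using u(1) by (auto simp: S_def algebra_simps)
      with u(2) h show False by force
    qed
    with u show ?thesis by (auto simp: S_def)
  qed
  note * = this
  have "\<phi> t \<le> 0 + e" if "0 < e" for e
    using *[of "e / t"] *[of e] that t by (cases "t = 0") auto
  then show ?thesis by (rule field_le_epsilon)
qed

text \<open>Completeness of X is not assumed, so neither the uniform boundedness principle nor the
  usual averaging proof of density is available; \<open>bound\<close> and \<open>dense\<close> are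
  hypotheses instead. The bound controls T(t - s) for all s at once, and density carries the
  equality from the domain to X.\<close>

lemma C0_semigroup_unique:
  fixes X :: "'a::real_vector set" and N :: "'a \<Rightarrow> real"
  assumes X: "subspace X"
    and N_add: "\<And>f g. \<lbrakk>f \<in> X; g \<in> X\<rbrakk> \<Longrightarrow> N (f + g) \<le> N f + N g"
    and N_scale: "\<And>c f. f \<in> X \<Longrightarrow> N (c *\<^sub>R f) = \<bar>c\<bar> * N f"
    and N_zero: "\<And>f. \<lbrakk>f \<in> X; N f = 0\<rbrakk> \<Longrightarrow> f = 0"
    and T: "C0_semigroup X N T" and G: "C0_semigroup X N G"
    and gen: "generator X N T = generator X N G"
    and bound: "\<And>t. 0 \<le> t \<Longrightarrow> \<exists>C. \<forall>s\<in>{0..t}. \<forall>f\<in>X. N (T s f) \<le> C * N f"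
    and dense: "\<And>f e. \<lbrakk>f \<in> X; 0 < e\<rbrakk> \<Longrightarrow> \<exists>g\<in>Domain (generator X N T). N (f - g) < e"
    and t: "0 \<le> t" and f: "f \<in> X"
  shows "T t f = G t f"
proof -
  note [simp, intro] = subspace_add[OF X] subspace_diff[OF X] subspace_scale[OF X]
  have N_diff: "N (f - g) \<le> N f + N g" if "f \<in> X" "g \<in> X" for f g
    using N_add[of f "(-1) *\<^sub>R g"] N_scale[of g "-1"] subspace_scale[OF X that(2), of "-1"] that by auto
  have N_sym: "N (f - g) = N (g - f)" if "f \<in> X" "g \<in> X" for f g
    using N_scale[of "f - g" "-1"] that by auto
  have N0: "N 0 = 0" using N_scale[of 0 0] subspace_0[OF X] by simp
  have N_nonneg: "0 \<le> N f" if "f \<in> X" for f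
    using N_diff[OF that that] N0 by simp
  have N_tri: "N (f - g) \<le> N (f - k) + N (k - g)" if "f \<in> X" "g \<in> X" "k \<in> X" for f g k
    using N_add[of "f - k" "k - g"] that by auto
  have N_rev: "\<bar>N f - N g\<bar> \<le> N (f - g)" if "f \<in> X" "g \<in> X" for f g
    using N_add[of "f - g" g] N_add[of "g - f" f] N_sym[OF that] that by auto
  have bdd: "bounded_operator_on X N (S t)" if "C0_semigroup X N S" "0 \<le> t" for S t
    using that by (auto simp: C0_semigroup_def)
  have in_X: "S t f \<in> X" if "C0_semigroup X N S" "0 \<le> t" "f \<in> X" for S t f
    using bdd[OF that(1,2)] that(3) by (auto simp: bounded_operator_on_def)
  have diff: "S t (f - g) = S t f - S t g" if "C0_semigroup X N S" "0 \<le> t" "f \<in> X" "g \<in> X" for S t f g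
  proof -
    have "S t (f + (-1) *\<^sub>R g) = S t f + (-1) *\<^sub>R S t g"
      using bdd[OF that(1,2)] that(3,4) subspace_scale[OF X that(4)]
      unfolding bounded_operator_on_def by metis
    then show ?thesis by simp
  qed
  have op_bound: "\<exists>C\<ge>0. \<forall>f\<in>X. N (S t f) \<le> C * N f" if S: "C0_semigroup X N S" "0 \<le> t" for S t
  proof -
    obtain C where "\<forall>f\<in>X. N (S t f) \<le> C * N f"
      using bdd[OF S] by (auto simp: bounded_operator_on_def)
    then have "\<forall>f\<in>X. N (S t f) \<le> \<bar>C\<bar> * N f"
      by (meson N_nonneg abs_ge_self mult_right_mono order_trans)
    then show ?thesis by (intro exI[of _ "\<bar>C\<bar>"]) auto
  qed
  have sg: "S (s + t) f = S s (S t f)" if "C0_semigroup X N S" "0 \<le> s" "0 \<le> t" "f \<in> X" for S s t f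
    using that by (auto simp: C0_semigroup_def)
  have S0: "S 0 f = f" if "C0_semigroup X N S" "f \<in> X" for S f
    using that by (auto simp: C0_semigroup_def)
  have lim: "((\<lambda>t. N (S t f - S s f)) \<longlongrightarrow> 0) (at s within {0..})"
    if "C0_semigroup X N S" "f \<in> X" "0 \<le> s" for S f s
    using that by (auto simp: C0_semigroup_def)
  have main: "T t f = G t f" if fg: "(f, g) \<in> generator X N T" for f g
  proof -
    from fg have f: "f \<in> X" by (auto simp: generator_def)
    obtain C0 where C0: "\<forall>s\<in>{0..t}. \<forall>f\<in>X. N (T s f) \<le> C0 * N f" using bound[OF t] by auto
    define C where "C = \<bar>C0\<bar>"
    have C: "N (T s f) \<le> C * N f" if "0 \<le> s" "s \<le> t" "f \<in> X" for s f
      using C0 that unfolding C_def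
      by (meson N_nonneg abs_ge_self atLeastAtMost_iff mult_right_mono order_trans)
    have C_nonneg: "0 \<le> C" by (simp add: C_def)
    \<comment> \<open>G(s) preserves the domain because it commutes with G(h): it can be pulled out
      of the difference quotient, and its operator bound D preserves the limit.\<close>
    have domain: "\<exists>k. (G s f, k) \<in> generator X N G" if s: "0 \<le> s" for s
    proof -
      obtain D where D: "0 \<le> D" "\<forall>f\<in>X. N (G s f) \<le> D * N f" using op_bound[OF G s] by auto
      have g: "g \<in> X" using fg by (auto simp: generator_def)
      have lim0: "((\<lambda>h. N ((1 / h) *\<^sub>R (G h f - f) - g)) \<longlongrightarrow> 0) (at_right 0)"
        using fg gen by (auto simp: generator_def)
      have "((\<lambda>h. N ((1 / h) *\<^sub>R (G h (G s f) - G s f) - G s g)) \<longlongrightarrow> 0) (at_right 0)"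
      proof (rule tendsto_sandwich[OF _ _ tendsto_const tendsto_mult_right_zero[OF lim0, of D]])
        have eq: "(1 / h) *\<^sub>R (G h (G s f) - G s f) - G s g = G s ((1 / h) *\<^sub>R (G h f - f) - g)
            \<and> (1 / h) *\<^sub>R (G h f - f) - g \<in> X" if "0 < h" for h
        proof -
          have h: "G h (G s f) = G s (G h f)"
            using sg[OF G, of h s f] sg[OF G, of s h f] that s f by (simp add: add.commute)
          have X1: "G h f - f \<in> X" using in_X[OF G _ f, of h] that f by auto
          have "G s ((1 / h) *\<^sub>R (G h f - f) - g) = G s ((1 / h) *\<^sub>R (G h f - f)) - G s g"
            using X1 g by (intro diff[OF G s]) auto
          also have "G s ((1 / h) *\<^sub>R (G h f - f)) = (1 / h) *\<^sub>R G s (G h f - f)"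
            using bdd[OF G s] X1 by (auto simp: bounded_operator_on_def)
          also have "G s (G h f - f) = G s (G h f) - G s f"
            using in_X[OF G _ f, of h] that f by (intro diff[OF G s]) auto
          finally show ?thesis using h X1 g by auto
        qed
        show "\<forall>\<^sub>F h in at_right 0. N ((1 / h) *\<^sub>R (G h (G s f) - G s f) - G s g)
            \<le> D * N ((1 / h) *\<^sub>R (G h f - f) - g)"
          using eventually_at_right_less[of 0] by eventually_elim (use eq D in auto)
        show "\<forall>\<^sub>F h in at_right 0. 0 \<le> N ((1 / h) *\<^sub>R (G h (G s f) - G s f) - G s g)"
          using eventually_at_right_less[of 0]
          by eventually_elim (use eq N_nonneg in_X[OF G s] in auto)
      qed
      then show ?thesis using in_X[OF G s] f g by (auto simp: generator_def)
    qed
    define w where "w s = T (t - s) (G s f)" for s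
    have w_X: "w s \<in> X" if "0 \<le> s" "s \<le> t" for s
      unfolding w_def using that by (auto intro!: in_X[OF T] in_X[OF G] f)
    \<comment> \<open>Factoring T(t - r) = T(t - s) T(s - r) reduces an increment of w to comparing
      G and T over the short time s - r, up to the uniform factor C.\<close>
    have w_step: "N (w s - w r) \<le> C * N (G s f - T (s - r) (G r f))" if "0 \<le> r" "r \<le> s" "s \<le> t" for r s
    proof -
      have "T (t - r) (G r f) = T (t - s) (T (s - r) (G r f))"
        using sg[OF T, of "t - s" "s - r" "G r f"] that in_X[OF G _ f] by auto
      then have "w s - w r = T (t - s) (G s f - T (s - r) (G r f))"
        unfolding w_def using that in_X[OF G _ f] in_X[OF T] by (subst diff[OF T]) auto
      then show ?thesis using that by (auto intro!: C in_X[OF T] in_X[OF G] f)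
    qed
    \<comment> \<open>In both orders of r and s the short-time operator is made to act on the fixed
      vector G(s)f, so continuity of T at 0 on one vector is enough. The two cases produce the
      factors C and 1; 2 + C covers both.\<close>
    have w_cont: "N (w s - w r) \<le> (C * (2 + C)) * N (G r f - G s f) + C * N (G s f - T \<bar>r - s\<bar> (G s f))"
      if "0 \<le> r" "0 \<le> s" "s \<le> t" "r \<le> t" for r s
    proof -
      have X': "G r f \<in> X" "G s f \<in> X" "T \<bar>r - s\<bar> (G r f) \<in> X" "T \<bar>r - s\<bar> (G s f) \<in> X"
        using that by (auto intro!: in_X[OF T] in_X[OF G] f)
      have *: "N (T \<bar>r - s\<bar> (G r f) - T \<bar>r - s\<bar> (G s f)) \<le> C * N (G r f - G s f)"
        using C[of "\<bar>r - s\<bar>" "G r f - G s f"] X' that by (subst diff[OF T, symmetric]) auto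
      have "N (w s - w r) \<le> C * ((2 + C) * N (G r f - G s f) + N (G s f - T \<bar>r - s\<bar> (G s f)))"
      proof (cases "r \<le> s")
        case True
        have "N (G s f - T \<bar>r - s\<bar> (G r f))
            \<le> N (G s f - T \<bar>r - s\<bar> (G s f)) + N (T \<bar>r - s\<bar> (G s f) - T \<bar>r - s\<bar> (G r f))"
          using X' by (intro N_tri)
        then have "N (G s f - T \<bar>r - s\<bar> (G r f)) \<le> (2 + C) * N (G r f - G s f) + N (G s f - T \<bar>r - s\<bar> (G s f))"
          using * N_sym[OF X'(3,4)] N_nonneg[of "G r f - G s f"] X' by (auto simp: algebra_simps)
        with w_step[of r s] that True C_nonneg show ?thesis
          by (auto intro: order_trans mult_left_mono)
      next
        case False
        have "N (G r f - T \<bar>r - s\<bar> (G s f)) \<le> N (G r f - G s f) + N (G s f - T \<bar>r - s\<bar> (G s f))"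
          using X' by (intro N_tri)
        then have "N (G r f - T \<bar>r - s\<bar> (G s f)) \<le> (2 + C) * N (G r f - G s f) + N (G s f - T \<bar>r - s\<bar> (G s f))"
          using N_nonneg[of "G r f - G s f"] C_nonneg X' by (auto simp: algebra_simps add_increasing)
        with w_step[of s r] that False C_nonneg N_sym[of "w r" "w s"] w_X show ?thesis
          by (auto intro: order_trans mult_left_mono)
      qed
      then show ?thesis by (simp add: algebra_simps)
    qed
    define \<phi> where "\<phi> s = N (w s - w 0)" for s
    have \<phi>_diff: "\<bar>\<phi> r - \<phi> s\<bar> \<le> N (w r - w s)" if "0 \<le> r" "0 \<le> s" "r \<le> t" "s \<le> t" for r s
      unfolding \<phi>_def using N_rev[of "w r - w 0" "w s - w 0"] w_X that t by auto
    have "\<phi> t \<le> 0"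
    proof (rule growth_zero_of_right_derivative[OF t])
      show "\<phi> 0 = 0" by (simp add: \<phi>_def N0)
      show "continuous_on {0..t} \<phi>"
        unfolding continuous_on_def
      proof
        fix s assume s: "s \<in> {0..t}"
        have l1: "((\<lambda>r. N (G r f - G s f)) \<longlongrightarrow> 0) (at s within {0..t})"
          using lim[OF G f, of s] s by (auto elim: tendsto_within_subset)
        have "((\<lambda>h. N (T h (G s f) - T 0 (G s f))) \<longlongrightarrow> 0) (at 0 within {0..})"
          using lim[OF T, of "G s f" 0] in_X[OF G _ f] s by auto
        moreover have "filterlim (\<lambda>r. \<bar>r - s\<bar>) (at 0 within {0..}) (at s within {0..t})"
          unfolding filterlim_at by (auto simp: eventually_at_filter intro!: tendsto_eq_intros)
        ultimately have "((\<lambda>r. N (T \<bar>r - s\<bar> (G s f) - T 0 (G s f))) \<longlongrightarrow> 0) (at s within {0..t})"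
          by (rule filterlim_compose)
        then have l2: "((\<lambda>r. N (G s f - T \<bar>r - s\<bar> (G s f))) \<longlongrightarrow> 0) (at s within {0..t})"
          using s f by (subst N_sym) (auto simp: S0[OF T] in_X[OF T] in_X[OF G])
        have "((\<lambda>r. (C * (2 + C)) * N (G r f - G s f) + C * N (G s f - T \<bar>r - s\<bar> (G s f))) \<longlongrightarrow> 0)
          (at s within {0..t})"
          using tendsto_add[OF tendsto_mult_right_zero[OF l1] tendsto_mult_right_zero[OF l2]] by simp
        then have "((\<lambda>r. \<phi> r - \<phi> s) \<longlongrightarrow> 0) (at s within {0..t})"
        proof (rule Lim_null_comparison[rotated])
          show "\<forall>\<^sub>F r in at s within {0..t}. norm (\<phi> r - \<phi> s)
              \<le> C * (2 + C) * N (G r f - G s f) + C * N (G s f - T \<bar>r - s\<bar> (G s f))"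
            unfolding eventually_at_filter
          proof (intro always_eventually allI impI)
            fix r assume "r \<in> {0..t}"
            then show "norm (\<phi> r - \<phi> s)
                \<le> C * (2 + C) * N (G r f - G s f) + C * N (G s f - T \<bar>r - s\<bar> (G s f))"
              using \<phi>_diff[of r s] w_cont[of r s] N_sym[of "w r" "w s"] w_X s by auto
          qed
        qed
        then show "(\<phi> \<longlongrightarrow> \<phi> s) (at s within {0..t})"
          by (simp add: LIM_zero_iff)
      qed
      fix s e assume s: "0 \<le> s" "s < t" and e: "0 < (e::real)"
      obtain k where k: "(G s f, k) \<in> generator X N G" using domain[OF s(1)] by auto
      then have kX: "G s f \<in> X" "k \<in> X" by (auto simp: generator_def)
      have "((\<lambda>h. N ((1 / h) *\<^sub>R (G h (G s f) - G s f) - k)) \<longlongrightarrow> 0) (at_right 0)"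
        "((\<lambda>h. N ((1 / h) *\<^sub>R (T h (G s f) - G s f) - k)) \<longlongrightarrow> 0) (at_right 0)"
        using k gen by (auto simp: generator_def)
      from tendsto_mult_right_zero[OF tendsto_add_zero[OF this], of C]
      have ev: "\<forall>\<^sub>F h in at_right 0. C * (N ((1 / h) *\<^sub>R (G h (G s f) - G s f) - k) +
          N ((1 / h) *\<^sub>R (T h (G s f) - G s f) - k)) < e"
        using e by (rule order_tendstoD)
      have "eventually (\<lambda>h. h < t - s) (at_right (0::real))"
        using s by (intro order_tendstoD(2)[of _ 0]) auto
      then show "\<forall>\<^sub>F h in at_right 0. \<phi> (s + h) \<le> \<phi> s + e * h"
        using eventually_at_right_less[of 0] ev
      proof eventually_elim
        case (elim h)
        have Xs: "G h (G s f) \<in> X" "T h (G s f) \<in> X"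
          using elim s f by (auto intro!: in_X[OF T] in_X[OF G])
        let ?a = "(1 / h) *\<^sub>R (G h (G s f) - G s f) - k" and ?b = "(1 / h) *\<^sub>R (T h (G s f) - G s f) - k"
        have "N (w (s + h) - w s) \<le> C * N (G (s + h) f - T h (G s f))"
          using w_step[of s "s + h"] elim s by auto
        \<comment> \<open>Since the generators agree, both difference quotients at G(s)f converge to
          the same k, so the difference is o(h).\<close>
        also have "G (s + h) f - T h (G s f) = h *\<^sub>R (?a - ?b)"
          using sg[OF G, of h s f] elim s f by (simp add: add.commute scaleR_diff_right)
        also have "N \<dots> = h * N (?a - ?b)"
          using elim Xs kX by (subst N_scale) auto
        also have "C * \<dots> \<le> C * (h * (N ?a + N ?b))"
          using elim Xs kX C_nonneg by (intro mult_left_mono N_diff) auto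
        also have "\<dots> = h * (C * (N ?a + N ?b))" by simp
        also have "\<dots> \<le> h * e" using elim by (intro mult_left_mono) auto
        finally show ?case
          using \<phi>_diff[of "s + h" s] elim s by (auto simp: algebra_simps)
      qed
    qed
    then have "N (w t - w 0) = 0"
      using N_nonneg[of "w t - w 0"] w_X t by (auto simp: \<phi>_def)
    then have "w t = w 0"
      using N_zero[of "w t - w 0"] w_X t by auto
    then show ?thesis
      using f t by (simp add: w_def S0[OF T] S0[OF G] in_X[OF G])
  qed
  have "N (T t f - G t f) \<le> 0 + e" if e: "0 < e" for e
  proof -
    obtain C D where C: "0 \<le> C" "\<forall>f\<in>X. N (T t f) \<le> C * N f" and D: "0 \<le> D" "\<forall>f\<in>X. N (G t f) \<le> D * N f"
      using op_bound[OF T t] op_bound[OF G t] by auto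
    \<comment> \<open>The extra 1 keeps the denominator positive when both operator bounds
      vanish.\<close>
    obtain g k where g: "(g, k) \<in> generator X N T" "N (f - g) < e / (C + D + 1)"
      using dense[OF f, of "e / (C + D + 1)"] e C D by auto
    then have gX: "g \<in> X" by (auto simp: generator_def)
    have "T t f - G t f = T t (f - g) - G t (f - g)"
      using main[OF g(1)] by (simp add: diff[OF T t f gX] diff[OF G t f gX])
    also have "N \<dots> \<le> N (T t (f - g)) + N (G t (f - g))"
      using f gX t by (intro N_diff in_X[OF T] in_X[OF G]) auto
    also have "\<dots> \<le> C * N (f - g) + D * N (f - g)"
      using C D f gX by (intro add_mono) auto
    also have "\<dots> \<le> (C + D + 1) * N (f - g)"
      using N_nonneg[of "f - g"] f gX by (auto simp: algebra_simps)
    also have "\<dots> \<le> e" using g(2) C D by (auto simp: field_simps)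
    finally show ?thesis by simp
  qed
  then have "N (T t f - G t f) \<le> 0" by (rule field_le_epsilon)
  then have "N (T t f - G t f) = 0"
    using N_nonneg[of "T t f - G t f"] f t in_X[OF T] in_X[OF G] by fastforce
  then show ?thesis
    using N_zero[of "T t f - G t f"] f t in_X[OF T] in_X[OF G] by auto
qed

section \<open>Integrals of powers on the real line\<close>

text \<open>The p-th power of the L^p norm on the line, with values in \<open>ennreal\<close> so
  that it makes sense without any integrability assumption.\<close>

definition energy :: "real \<Rightarrow> (real \<Rightarrow> real) \<Rightarrow> ennreal" where
  "energy p F = (\<integral>\<^sup>+x. ennreal (\<bar>F x\<bar> powr p) \<partial>lborel)"

text \<open>Convexity of the p-th power; x = 0 is done by hand because the convexity fact lives on
  the open half line. Jensen's and Minkowski's inequalities below both come from this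
  tangent.\<close>

lemma powr_above_tangent:
  fixes x c p :: real
  assumes p: "1 \<le> p" and x: "0 \<le> x" and c: "0 < c"
  shows "c powr p + p * c powr (p - 1) * (x - c) \<le> x powr p"
proof (cases "x = 0")
  case True
  have "c powr p = c powr (p - 1) * c"
    using c by (simp add: powr_diff)
  then have "c powr p + p * c powr (p - 1) * (x - c) = (1 - p) * c powr p"
    using True by (simp add: algebra_simps)
  then show ?thesis using True p c by (simp add: mult_nonpos_nonneg)
next
  case False
  have "x powr p - c powr p \<ge> p * c powr (p - 1) * (x - c)"
  proof (rule convex_on_imp_above_tangent[where A = "{0<..}"])
    show "convex_on {0<..} (\<lambda>x. x powr p)" using p by (rule powr_convex)
    show "((\<lambda>x. x powr p) has_field_derivative p * c powr (p - 1)) (at c within {0<..})"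
      using c by (auto intro!: derivative_eq_intros)
  qed (use c x False in \<open>auto simp: interior_open\<close>)
  then show ?thesis by simp
qed

text \<open>A cheap substitute for the triangle inequality: the sum is at most twice the larger
  term.\<close>

lemma abs_add_powr_le:
  fixes a b p :: real
  assumes "0 \<le> p"
  shows "\<bar>a + b\<bar> powr p \<le> 2 powr p * (\<bar>a\<bar> powr p + \<bar>b\<bar> powr p)"
proof -
  have "\<bar>a + b\<bar> powr p \<le> (2 * max \<bar>a\<bar> \<bar>b\<bar>) powr p"
    using assms by (intro powr_mono2) auto
  also have "\<dots> = 2 powr p * max \<bar>a\<bar> \<bar>b\<bar> powr p"
    by (simp add: powr_mult)
  also have "max \<bar>a\<bar> \<bar>b\<bar> powr p \<le> \<bar>a\<bar> powr p + \<bar>b\<bar> powr p"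
    by (auto simp: max_def)
  finally show ?thesis by simp
qed

lemma energy_cong_AE: "AE x in lborel. F x = G x \<Longrightarrow> energy p F = energy p G"
  unfolding energy_def by (intro nn_integral_cong_AE) auto

lemma energy_mono_AE: "0 \<le> p \<Longrightarrow> AE x in lborel. \<bar>F x\<bar> \<le> \<bar>G x\<bar> \<Longrightarrow> energy p F \<le> energy p G"
  unfolding energy_def
  by (intro nn_integral_mono_AE) (auto elim!: eventually_mono intro!: ennreal_leI powr_mono2)

lemma energy_minus_commute: "energy p (\<lambda>x. F x - G x) = energy p (\<lambda>x. G x - F x)"
  unfolding energy_def by (simp add: abs_minus_commute)

lemma energy_cmult:
  assumes [measurable]: "F \<in> borel_measurable borel"
  shows "energy p (\<lambda>x. c * F x) = ennreal (\<bar>c\<bar> powr p) * energy p F"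
  unfolding energy_def by (simp add: abs_mult powr_mult ennreal_mult nn_integral_cmult)

lemma energy_add:
  assumes [measurable]: "F \<in> borel_measurable borel" "G \<in> borel_measurable borel" and p: "0 \<le> p"
  shows "energy p (\<lambda>x. F x + G x) \<le> ennreal (2 powr p) * (energy p F + energy p G)"
proof -
  have "energy p (\<lambda>x. F x + G x)
      \<le> (\<integral>\<^sup>+x. ennreal (2 powr p) * (ennreal (\<bar>F x\<bar> powr p) + ennreal (\<bar>G x\<bar> powr p)) \<partial>lborel)"
    unfolding energy_def
    by (intro nn_integral_mono)
      (simp add: ennreal_plus[symmetric] ennreal_mult[symmetric] abs_add_powr_le p del: ennreal_plus)
  also have "\<dots> = ennreal (2 powr p) * (energy p F + energy p G)"
    unfolding energy_def by (simp add: nn_integral_cmult nn_integral_add)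
  finally show ?thesis .
qed

lemma energy_triangle:
  assumes [measurable]: "F \<in> borel_measurable borel" "G \<in> borel_measurable borel" "K \<in> borel_measurable borel"
    and p: "0 \<le> p"
  shows "energy p (\<lambda>x. F x - G x) \<le> ennreal (2 powr p) * (energy p (\<lambda>x. F x - K x) + energy p (\<lambda>x. K x - G x))"
  using energy_add[of "\<lambda>x. F x - K x" "\<lambda>x. K x - G x" p] p by simp

lemma energy_affine:
  assumes [measurable]: "F \<in> borel_measurable borel" and c: "\<bar>c\<bar> = 1"
  shows "energy p (\<lambda>x. F (t + c * x)) = energy p F"
  unfolding energy_def
  using nn_integral_real_affine[of "\<lambda>x. ennreal (\<bar>F x\<bar> powr p)" c t] c by auto

text \<open>Suited to approximation arguments: a fixed error e from the approximation plus a
  remainder, which may depend on e, that vanishes in the limit.\<close>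

lemma tendsto_0_ennreal_approx:
  fixes f :: "'a \<Rightarrow> ennreal"
  assumes "\<And>e::real. 0 < e \<Longrightarrow> \<exists>h. (h \<longlongrightarrow> 0) F \<and> eventually (\<lambda>x. f x \<le> ennreal e + h x) F"
  shows "(f \<longlongrightarrow> 0) F"
proof (rule order_tendstoI)
  fix a :: ennreal assume "0 < a"
  then obtain b where b: "0 < b" "b < a" using dense by auto
  then obtain r where r: "b = ennreal r" "0 < r"
    by (cases b) (auto simp: ennreal_zero_less_top)
  from assms[of "r / 2"] r obtain h where h: "(h \<longlongrightarrow> 0) F" "eventually (\<lambda>x. f x \<le> ennreal (r / 2) + h x) F"
    by auto
  have "eventually (\<lambda>x. h x < ennreal (r / 2)) F"
    using h(1) r by (intro order_tendstoD) auto
  with h(2) show "eventually (\<lambda>x. f x < a) F"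
  proof eventually_elim
    case (elim x)
    have "f x \<le> ennreal (r / 2) + ennreal (r / 2)"
      using elim by (meson add_left_mono less_imp_le order_trans)
    also have "\<dots> = b" using r by (simp add: ennreal_plus[symmetric] del: ennreal_plus)
    finally show ?case using b by simp
  qed
qed simp

lemma energy_dominated_tendsto_0:
  assumes [measurable]: "\<And>n. F n \<in> borel_measurable borel" "G \<in> borel_measurable borel"
    and p: "0 < p" and G: "energy p G < \<infinity>"
    and le: "\<And>n. AE x in lborel. \<bar>F n x\<bar> \<le> \<bar>G x\<bar>"
    and lim: "AE x in lborel. (\<lambda>n. F n x) \<longlonglongrightarrow> 0"
  shows "(\<lambda>n. energy p (F n)) \<longlonglongrightarrow> 0"
proof -
  have "(\<lambda>n. \<integral>\<^sup>+x. ennreal (\<bar>F n x\<bar> powr p) \<partial>lborel) \<longlonglongrightarrow> (\<integral>\<^sup>+x. 0 \<partial>(lborel::real measure))"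
  proof (rule nn_integral_dominated_convergence[where w = "\<lambda>x. ennreal (\<bar>G x\<bar> powr p)"])
    show "AE x in lborel. ennreal (\<bar>F n x\<bar> powr p) \<le> ennreal (\<bar>G x\<bar> powr p)" for n
      using le[of n] by eventually_elim (use p in \<open>auto intro!: ennreal_leI powr_mono2\<close>)
    show "AE x in lborel. (\<lambda>n. ennreal (\<bar>F n x\<bar> powr p)) \<longlonglongrightarrow> 0"
      using lim
    proof eventually_elim
      case (elim x)
      have "(\<lambda>n. \<bar>F n x\<bar> powr p) \<longlonglongrightarrow> 0"
        using tendsto_rabs_zero[OF elim] p by (intro tendsto_zero_powrI[where b = p]) auto
      then show ?case using tendsto_ennrealI by fastforce
    qed
  qed (use G in \<open>auto simp: energy_def\<close>)
  then show ?thesis by (simp add: energy_def)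
qed

section \<open>Approximation by continuous functions and continuity of translations in L^p\<close>

lemma energy_indicator: "energy p (\<lambda>x. c * indicator {a..b} x) = ennreal (\<bar>c\<bar> powr p) * ennreal (b - a)"
  if "0 < p"
proof -
  have "energy p (\<lambda>x. c * indicator {a..b} x) = (\<integral>\<^sup>+x. ennreal (\<bar>c\<bar> powr p) * indicator {a..b} x \<partial>lborel)"
    unfolding energy_def by (intro nn_integral_cong) (auto simp: indicator_def that)
  then show ?thesis
    by (cases "a \<le> b") (simp_all add: nn_integral_cmult ennreal_neg)
qed

text \<open>Truncating F in argument and value makes it bounded with bounded support. Measurability
  then gives continuous functions converging almost everywhere, and after repairing their size and
  support dominated convergence turns this into L^p convergence.\<close>

lemma energy_approx_continuous:
  assumes p: "0 < p" and F[measurable]: "F \<in> borel_measurable borel" and fin: "energy p F < \<infinity>" and e: "0 < (e::ennreal)"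
  obtains g M R where "continuous_on UNIV g" "\<And>x. \<bar>g x\<bar> \<le> M" "\<And>x. R < \<bar>x\<bar> \<Longrightarrow> g x = 0"
    "energy p (\<lambda>x. F x - g x) < e"
proof -
  define c where "c = ennreal (2 powr p)"
  define cut where "cut k x = (if \<bar>x\<bar> \<le> real k \<and> \<bar>F x\<bar> \<le> real k then F x else 0)" for k x
  have [measurable]: "cut k \<in> borel_measurable borel" for k
    unfolding cut_def by measurable
  have l1: "(\<lambda>k. energy p (\<lambda>x. F x - cut k x)) \<longlonglongrightarrow> 0"
  proof (rule energy_dominated_tendsto_0[OF _ F p fin])
    show "AE x in lborel. \<bar>F x - cut k x\<bar> \<le> \<bar>F x\<bar>" for k by (auto simp: cut_def)
    have "(\<lambda>k. F x - cut k x) \<longlonglongrightarrow> 0" for x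
    proof (rule tendsto_eventually)
      obtain k0 :: nat where "max \<bar>x\<bar> \<bar>F x\<bar> \<le> k0" using real_arch_simple by blast
      then show "eventually (\<lambda>k. F x - cut k x = 0) sequentially"
        by (auto simp: cut_def eventually_sequentially intro!: exI[of _ k0])
    qed
    then show "AE x in lborel. (\<lambda>k. F x - cut k x) \<longlonglongrightarrow> 0" by simp
  qed measurable
  have "((\<lambda>k. c * energy p (\<lambda>x. F x - cut k x)) \<longlongrightarrow> c * 0) sequentially"
    unfolding c_def by (intro ennreal_tendsto_cmult l1) auto
  then have "eventually (\<lambda>k. c * energy p (\<lambda>x. F x - cut k x) < e) sequentially"
    using e by (intro order_tendstoD) auto
  then obtain k where k: "c * energy p (\<lambda>x. F x - cut k x) < e"
    using eventually_happens'[OF sequentially_bot] by blast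
  have "cut k measurable_on UNIV"
    by (intro lebesgue_measurable_imp_measurable_on) (auto simp: measurable_completion)
  then obtain N g where N: "negligible N" and g: "\<And>n. continuous_on UNIV (g n)"
    and lim: "\<And>x. x \<notin> N \<Longrightarrow> (\<lambda>n. g n x) \<longlonglongrightarrow> cut k x"
    unfolding measurable_on_def by auto
  \<comment> \<open>The approximants g n may be unbounded and of unbounded support. Clamping to
    [-k, k] and multiplying by a cutoff that is 1 on [-k, k] and 0 beyond k + 1 keeps their limit,
    because \<open>cut k\<close> already satisfies both restrictions.\<close>
  define h where "h n x = max (- real k) (min (real k) (g n x)) * max 0 (min 1 (real k + 1 - \<bar>x\<bar>))" for n x
  have h: "continuous_on UNIV (h n)" for n
    unfolding h_def by (intro continuous_intros g)
  have [measurable]: "h n \<in> borel_measurable borel" for n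
    by (intro borel_measurable_continuous_onI h)
  have h_le: "\<bar>h n x\<bar> \<le> real k" and h_zero: "real k + 1 < \<bar>x\<bar> \<Longrightarrow> h n x = 0" for n x
  proof -
    have "\<bar>h n x\<bar> \<le> real k * 1"
      unfolding h_def abs_mult by (intro mult_mono) (auto simp: max_def min_def)
    then show "\<bar>h n x\<bar> \<le> real k" by simp
    show "real k + 1 < \<bar>x\<bar> \<Longrightarrow> h n x = 0" by (simp add: h_def)
  qed
  have cut_le: "\<bar>cut k x\<bar> \<le> real k" and cut_zero: "real k < \<bar>x\<bar> \<Longrightarrow> cut k x = 0" for x
    by (auto simp: cut_def)
  have l2: "(\<lambda>n. energy p (\<lambda>x. cut k x - h n x)) \<longlonglongrightarrow> 0"
  proof (rule energy_dominated_tendsto_0[where G = "\<lambda>x. (2 * real k) * indicator {-(real k + 1)..real k + 1} x"])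
    show "energy p (\<lambda>x. (2 * real k) * indicator {-(real k + 1)..real k + 1} x) < \<infinity>"
      by (simp add: energy_indicator[OF p] ennreal_mult_less_top)
    show "AE x in lborel. \<bar>cut k x - h n x\<bar> \<le> \<bar>(2 * real k) * indicator {-(real k + 1)..real k + 1} x\<bar>" for n
    proof (intro AE_I2)
      fix x show "\<bar>cut k x - h n x\<bar> \<le> \<bar>(2 * real k) * indicator {-(real k + 1)..real k + 1} x\<bar>"
        using h_le[of n x] cut_le[of x] cut_zero[of x] h_zero[of x n]
        by (cases "\<bar>x\<bar> \<le> real k + 1") (auto simp: indicator_def)
    qed
    have "(\<lambda>n. cut k x - h n x) \<longlonglongrightarrow> 0" if "x \<notin> N" for x
    proof -
      have "(\<lambda>n. cut k x - h n x) \<longlonglongrightarrow> cut k x -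
          max (- real k) (min (real k) (cut k x)) * max 0 (min 1 (real k + 1 - \<bar>x\<bar>))"
        unfolding h_def by (intro tendsto_intros lim that)
      also have "max (- real k) (min (real k) (cut k x)) = cut k x"
        using cut_le[of x] by auto
      also have "cut k x - cut k x * max 0 (min 1 (real k + 1 - \<bar>x\<bar>)) = 0"
        using cut_zero[of x] by (cases "\<bar>x\<bar> \<le> real k") auto
      finally show ?thesis .
    qed
    moreover have "AE x in lebesgue. x \<notin> N"
      using N by (auto simp: negligible_iff_null_sets intro: AE_not_in)
    ultimately have "AE x in lebesgue. (\<lambda>n. cut k x - h n x) \<longlonglongrightarrow> 0"
      by (auto elim: eventually_mono)
    then show "AE x in lborel. (\<lambda>n. cut k x - h n x) \<longlonglongrightarrow> 0"
      by (simp add: AE_completion_iff)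
  qed (use p in measurable)
  have "((\<lambda>n. c * (energy p (\<lambda>x. F x - cut k x) + energy p (\<lambda>x. cut k x - h n x)))
      \<longlongrightarrow> c * (energy p (\<lambda>x. F x - cut k x) + 0)) sequentially"
    unfolding c_def by (intro ennreal_tendsto_cmult tendsto_add tendsto_const l2) auto
  then have "eventually (\<lambda>n. c * (energy p (\<lambda>x. F x - cut k x) + energy p (\<lambda>x. cut k x - h n x)) < e) sequentially"
    using k by (intro order_tendstoD) auto
  then obtain n where n: "c * (energy p (\<lambda>x. F x - cut k x) + energy p (\<lambda>x. cut k x - h n x)) < e"
    using eventually_happens'[OF sequentially_bot] by blast
  have h_close: "energy p (\<lambda>x. F x - h n x) < e"
    using energy_triangle[of F "h n" "cut k" p] n p unfolding c_def by auto
  show thesis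
    by (rule that[OF h h_le h_zero h_close])
qed

lemma energy_translation_tendsto_0:
  assumes p: "0 < p" and F[measurable]: "F \<in> borel_measurable borel" and fin: "energy p F < \<infinity>"
  shows "((\<lambda>s. energy p (\<lambda>z. F (z + s) - F z)) \<longlongrightarrow> 0) (at 0)"
proof (rule tendsto_0_ennreal_approx)
  fix e :: real assume e: "0 < e"
  define c where "c = 2 powr p"
  have c: "0 < c" by (simp add: c_def)
  \<comment> \<open>F(z + s) is compared with F(z) through g(z + s) and then g(z). Two triangle
    inequalities with factor c multiply the approximation error by c + c * c in total.\<close>
  have pos: "0 < ennreal (e / (c + c * c))"
    using e add_pos_pos[OF c mult_pos_pos[OF c c]] by simp
  obtain g M R where g: "continuous_on UNIV g" and M: "\<And>x. \<bar>g x\<bar> \<le> M" and R: "\<And>x. R < \<bar>x\<bar> \<Longrightarrow> g x = 0"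
    and d: "energy p (\<lambda>x. F x - g x) < ennreal (e / (c + c * c))"
    by (rule energy_approx_continuous[OF p F fin pos]) (rule that)
  have [measurable]: "g \<in> borel_measurable borel" by (intro borel_measurable_continuous_onI g)
  let ?d = "energy p (\<lambda>x. F x - g x)" and ?g = "\<lambda>s. energy p (\<lambda>z. g (z + s) - g z)"
    and ?f = "\<lambda>s. energy p (\<lambda>z. F (z + s) - F z)"
  have l: "(?g \<longlongrightarrow> 0) (at 0)"
    unfolding tendsto_at_iff_sequentially comp_def
  proof (intro allI impI)
    fix X :: "nat \<Rightarrow> real" assume X: "\<forall>i. X i \<in> UNIV - {0}" "X \<longlonglongrightarrow> 0"
    then have "\<forall>\<^sub>F i in sequentially. \<bar>X i\<bar> < 1"
      by (intro order_tendstoD[OF tendsto_rabs_zero]) auto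
    then obtain m where m: "\<And>i. m \<le> i \<Longrightarrow> \<bar>X i\<bar> < 1" by (auto simp: eventually_sequentially)
    \<comment> \<open>Dropping the first m terms keeps all shifts below 1, so that one bounded
      interval carries every difference and a single majorant works.\<close>
    have "(\<lambda>i. energy p (\<lambda>z. g (z + X (i + m)) - g z)) \<longlonglongrightarrow> 0"
    proof (rule energy_dominated_tendsto_0[where G = "\<lambda>x. (2 * M) * indicator {-(R + 1)..R + 1} x"])
      show "energy p (\<lambda>x. (2 * M) * indicator {-(R + 1)..R + 1} x) < \<infinity>"
        by (simp add: energy_indicator[OF p] ennreal_mult_less_top)
      show "AE x in lborel. \<bar>g (x + X (i + m)) - g x\<bar> \<le> \<bar>(2 * M) * indicator {-(R + 1)..R + 1} x\<bar>" for i
      proof (intro AE_I2)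
        fix x show "\<bar>g (x + X (i + m)) - g x\<bar> \<le> \<bar>(2 * M) * indicator {-(R + 1)..R + 1} x\<bar>"
          using M[of x] M[of "x + X (i + m)"] R[of x] R[of "x + X (i + m)"] m[of "i + m"]
          by (cases "\<bar>x\<bar> \<le> R + 1") (auto simp: indicator_def)
      qed
      have "(\<lambda>i. g (x + X (i + m)) - g x) \<longlonglongrightarrow> 0" for x
      proof -
        have "(\<lambda>i. x + X (i + m)) \<longlonglongrightarrow> x + 0"
          using X(2) by (intro tendsto_intros LIMSEQ_ignore_initial_segment)
        moreover have "isCont g x" using g by (simp add: continuous_on_eq_continuous_at)
        ultimately have "(\<lambda>i. g (x + X (i + m))) \<longlonglongrightarrow> g x"
          by (auto intro: isCont_tendsto_compose)
        then show ?thesis by (simp add: LIM_zero)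
      qed
      then show "AE x in lborel. (\<lambda>i. g (x + X (i + m)) - g x) \<longlonglongrightarrow> 0" by simp
    qed (use p in measurable)
    then show "(\<lambda>i. energy p (\<lambda>z. g (z + X i) - g z)) \<longlonglongrightarrow> 0"
      by (rule LIMSEQ_offset)
  qed
  have "?f s \<le> ennreal e + ennreal (c * c) * ?g s" for s
  proof -
    have eq: "energy p (\<lambda>z. F (z + s) - g (z + s)) = ?d"
      using energy_affine[of "\<lambda>x. F x - g x" 1 p s] by (simp add: add.commute)
    have 1: "?f s
        \<le> ennreal c * (?d + energy p (\<lambda>z. g (z + s) - F z))"
      using energy_triangle[of "\<lambda>z. F (z + s)" F "\<lambda>z. g (z + s)" p] p eq by (simp add: c_def)
    have 2: "energy p (\<lambda>z. g (z + s) - F z)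
        \<le> ennreal c * (?g s + ?d)"
      using energy_triangle[of "\<lambda>z. g (z + s)" F g p] p
      by (simp add: c_def energy_minus_commute[of p g F])
    have "?f s \<le> ennreal c * (?d +
        ennreal c * (?g s + ?d))"
      by (rule order_trans[OF 1]) (intro mult_left_mono add_left_mono 2, simp)
    also have "\<dots> = ennreal (c + c * c) * ?d + ennreal (c * c) * ?g s"
      using c by (simp add: ennreal_mult algebra_simps)
    also have "ennreal (c + c * c) * ?d \<le> ennreal (c + c * c) * ennreal (e / (c + c * c))"
      using d by (intro mult_left_mono) auto
    also have "\<dots> = ennreal ((c + c * c) * (e / (c + c * c)))"
      using c e by (subst ennreal_mult) auto
    also have "(c + c * c) * (e / (c + c * c)) = e"
      using add_pos_pos[OF c mult_pos_pos[OF c c]] by simp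
    finally show ?thesis by (simp add: add_right_mono)
  qed
  moreover have "((\<lambda>s. ennreal (c * c) * ?g s) \<longlongrightarrow> 0) (at 0)"
    using ennreal_tendsto_cmult[OF _ l, of "ennreal (c * c)"] by simp
  ultimately show "\<exists>h. (h \<longlongrightarrow> 0) (at 0) \<and>
      (\<forall>\<^sub>F s in at 0. ?f s \<le> ennreal e + h s)"
    by (intro exI[of _ "\<lambda>s. ennreal (c * c) * ?g s"] conjI always_eventually allI)
qed

section \<open>Jensen's inequality and averages over short intervals\<close>

lemma energy_imp_set_integrable:
  assumes p: "1 \<le> p" and F[measurable]: "F \<in> borel_measurable borel" and fin: "energy p F < \<infinity>"
  shows "set_integrable lborel {a..b} F"
  unfolding set_integrable_def integrable_iff_bounded
proof
  have "(\<integral>\<^sup>+x. ennreal (norm (indicator {a..b} x *\<^sub>R F x)) \<partial>lborel)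
      \<le> (\<integral>\<^sup>+x. indicator {a..b} x + ennreal (\<bar>F x\<bar> powr p) \<partial>lborel)"
  proof (intro nn_integral_mono)
    fix x :: real
    have "\<bar>F x\<bar> \<le> 1 + \<bar>F x\<bar> powr p"
    proof (cases "\<bar>F x\<bar> \<le> 1")
      case False
      then have "\<bar>F x\<bar> powr 1 \<le> \<bar>F x\<bar> powr p" using p by (intro powr_mono) auto
      then show ?thesis using False by auto
    qed (auto intro: add_increasing2)
    then have "ennreal \<bar>F x\<bar> \<le> 1 + ennreal (\<bar>F x\<bar> powr p)"
      by (metis ennreal_1 ennreal_leI ennreal_plus powr_ge_zero zero_le_one)
    then show "ennreal (norm (indicator {a..b} x *\<^sub>R F x)) \<le> indicator {a..b} x + ennreal (\<bar>F x\<bar> powr p)"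
      by (auto simp: indicator_def)
  qed
  also have "\<dots> = emeasure lborel {a..b} + energy p F"
    unfolding energy_def by (subst nn_integral_add) auto
  also have "\<dots> < \<infinity>" using fin by (simp add: emeasure_lborel_Icc_eq)
  finally show "(\<integral>\<^sup>+x. ennreal (norm (indicator {a..b} x *\<^sub>R F x)) \<partial>lborel) < \<infinity>" .
qed measurable

text \<open>Jensen's inequality: integrate the tangent inequality of the p-th power at the mean c of
  |u|; the linear part integrates to zero.\<close>

lemma average_powr_le:
  assumes p: "1 \<le> p" and ab: "a < b" and u[measurable]: "u \<in> borel_measurable borel"
    and int: "set_integrable lborel {a..b} u"
  shows "ennreal (\<bar>integral {a..b} u / (b - a)\<bar> powr p)
    \<le> ennreal (1 / (b - a)) * (\<integral>\<^sup>+x\<in>{a..b}. ennreal (\<bar>u x\<bar> powr p) \<partial>lborel)"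
proof -
  define J where "J = (\<integral>\<^sup>+x\<in>{a..b}. ennreal (\<bar>u x\<bar> powr p) \<partial>lborel)"
  define L where "L = (LINT x:{a..b}|lborel. \<bar>u x\<bar>)"
  define c where "c = L / (b - a)"
  have L: "0 \<le> L" unfolding L_def set_lebesgue_integral_def by (intro integral_nonneg_AE) auto
  have "\<bar>integral {a..b} u\<bar> \<le> L"
    using set_integral_norm_bound[OF int] set_borel_integral_eq_integral(2)[OF int] by (simp add: L_def)
  then have le: "\<bar>integral {a..b} u / (b - a)\<bar> powr p \<le> c powr p"
    using ab p by (intro powr_mono2) (auto simp: c_def divide_right_mono)
  \<comment> \<open>The tangent needs c > 0 and the subtraction needs a finite J; in the excluded
    cases the bound is trivial.\<close>
  have "ennreal (c powr p) \<le> ennreal (1 / (b - a)) * J"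
  proof (cases "c = 0 \<or> J = \<infinity>")
    case True
    then show ?thesis using ab by (auto simp: ennreal_mult_top)
  next
    case False
    then have c: "0 < c" using L ab by (auto simp: c_def)
    obtain j where j: "J = ennreal j" "0 \<le> j" using False by (cases J) auto
    define q where "q = p * c powr (p - 1)"
    have q: "0 \<le> q" using p by (simp add: q_def)
    have intL: "(\<integral>\<^sup>+x\<in>{a..b}. ennreal \<bar>u x\<bar> \<partial>lborel) = ennreal L"
    proof -
      have "(\<integral>\<^sup>+x. ennreal (indicator {a..b} x *\<^sub>R \<bar>u x\<bar>) \<partial>lborel) = ennreal L"
        unfolding L_def set_lebesgue_integral_def
        using set_integrable_abs[OF int] by (intro nn_integral_eq_integral) (auto simp: set_integrable_def)
      moreover have "(\<integral>\<^sup>+x\<in>{a..b}. ennreal \<bar>u x\<bar> \<partial>lborel) = (\<integral>\<^sup>+x. ennreal (indicator {a..b} x *\<^sub>R \<bar>u x\<bar>) \<partial>lborel)"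
        by (intro nn_integral_cong) (auto simp: indicator_def)
      ultimately show ?thesis by simp
    qed
    have "(\<integral>\<^sup>+x\<in>{a..b}. (ennreal (c powr p) + ennreal q * ennreal \<bar>u x\<bar>) \<partial>lborel)
       \<le> (\<integral>\<^sup>+x\<in>{a..b}. (ennreal (\<bar>u x\<bar> powr p) + ennreal (q * c)) \<partial>lborel)"
    proof (intro nn_integral_mono mult_right_mono)
      fix x
      \<comment> \<open>The tangent inequality is rearranged so that both sides have only
        nonnegative terms, since it is to be integrated in \<open>ennreal\<close>.\<close>
      have "c powr p + q * \<bar>u x\<bar> \<le> \<bar>u x\<bar> powr p + q * c"
        using powr_above_tangent[OF p, of "\<bar>u x\<bar>" c] c by (simp add: q_def algebra_simps)
      then have "ennreal (c powr p + q * \<bar>u x\<bar>) \<le> ennreal (\<bar>u x\<bar> powr p + q * c)" by (rule ennreal_leI)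
      then show "ennreal (c powr p) + ennreal q * ennreal \<bar>u x\<bar> \<le> ennreal (\<bar>u x\<bar> powr p) + ennreal (q * c)"
        using q c by (simp add: ennreal_mult)
    qed auto
    also have "(\<integral>\<^sup>+x\<in>{a..b}. (ennreal (c powr p) + ennreal q * ennreal \<bar>u x\<bar>) \<partial>lborel)
        = ennreal (c powr p) * ennreal (b - a) + ennreal q * ennreal L"
      using intL ab by (simp add: distrib_right nn_integral_add nn_integral_cmult mult.assoc)
    also have "(\<integral>\<^sup>+x\<in>{a..b}. (ennreal (\<bar>u x\<bar> powr p) + ennreal (q * c)) \<partial>lborel)
        = ennreal j + ennreal (q * c) * ennreal (b - a)"
      using ab j(1) by (simp add: distrib_right nn_integral_add nn_integral_cmult J_def)
    finally have "ennreal (c powr p * (b - a) + q * L) \<le> ennreal (j + q * c * (b - a))"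
      using ab q L c j by (simp add: ennreal_mult)
    then have "c powr p * (b - a) + q * L \<le> j + q * c * (b - a)"
      using ab q L c j by (subst (asm) ennreal_le_iff) auto
    moreover have "L = c * (b - a)" using ab by (simp add: c_def)
    ultimately have "c powr p * (b - a) \<le> j" by simp
    then have "c powr p \<le> 1 / (b - a) * j"
      using ab by (simp add: pos_le_divide_eq)
    then show ?thesis
      using ab j by (simp add: ennreal_mult[symmetric] ennreal_leI)
  qed
  with le show ?thesis unfolding J_def by (meson ennreal_leI order_trans)
qed

text \<open>The error of an average is the average of F(z + s) - F(z) over s in [-h, 0]. Jensen and
  Tonelli bound its energy by the mean of the translation energies, which are small for small
  s.\<close>

lemma energy_average_tendsto_0:
  assumes p: "1 \<le> p" and F[measurable]: "F \<in> borel_measurable borel" and fin: "energy p F < \<infinity>"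
  shows "((\<lambda>h. energy p (\<lambda>z. integral {z - h..z} F / h - F z)) \<longlongrightarrow> 0) (at_right 0)"
proof (rule tendsto_0_ennreal_approx)
  fix e :: real assume e: "0 < e"
  have "eventually (\<lambda>s. energy p (\<lambda>z. F (z + s) - F z) < ennreal e) (at 0)"
    using energy_translation_tendsto_0[OF _ F fin] p e by (intro order_tendstoD) auto
  then obtain d where d: "0 < d" "\<And>s. s \<noteq> 0 \<Longrightarrow> \<bar>s\<bar> < d \<Longrightarrow> energy p (\<lambda>z. F (z + s) - F z) < ennreal e"
    unfolding eventually_at by (auto simp: dist_real_def)
  have d': "energy p (\<lambda>z. F (z + s) - F z) \<le> ennreal e" if "\<bar>s\<bar> < d" for s
    using d(2)[of s] that by (cases "s = 0") (auto simp: energy_def less_imp_le)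
  have "energy p (\<lambda>z. integral {z - h..z} F / h - F z) \<le> ennreal e" if h: "0 < h" "h < d" for h
  proof -
    have int: "set_integrable lborel {a..b} F" for a b
      by (rule energy_imp_set_integrable[OF p F fin])
    have "ennreal (\<bar>integral {z - h..z} F / h - F z\<bar> powr p)
        \<le> ennreal (1 / h) * (\<integral>\<^sup>+s\<in>{-h..0}. ennreal (\<bar>F (z + s) - F z\<bar> powr p) \<partial>lborel)" for z
    proof -
      have int': "set_integrable lborel {z - h..z} (\<lambda>x. F x - F z)"
        by (intro set_integral_diff(1) int)
          (simp add: set_integrable_def integrable_real_indicator emeasure_lborel_Icc_eq)
      have "integral {z - h..z} (\<lambda>x. F x - F z) = integral {z - h..z} F - h * F z"
        using h set_borel_integral_eq_integral(1)[OF int] by (subst integral_diff) auto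
      then have "integral {z - h..z} F / h - F z = integral {z - h..z} (\<lambda>x. F x - F z) / (z - (z - h))"
        using h by (simp add: field_simps)
      also have "ennreal (\<bar>\<dots>\<bar> powr p)
          \<le> ennreal (1 / (z - (z - h))) * (\<integral>\<^sup>+x\<in>{z - h..z}. ennreal (\<bar>F x - F z\<bar> powr p) \<partial>lborel)"
        using h by (intro average_powr_le[OF p] int') auto
      also have "(\<integral>\<^sup>+x\<in>{z - h..z}. ennreal (\<bar>F x - F z\<bar> powr p) \<partial>lborel)
          = (\<integral>\<^sup>+s\<in>{-h..0}. ennreal (\<bar>F (z + s) - F z\<bar> powr p) \<partial>lborel)"
        by (subst nn_integral_real_affine[where c = 1 and t = z])
          (auto intro!: nn_integral_cong simp: indicator_def)
      finally show ?thesis by simp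
    qed
    then have "energy p (\<lambda>z. integral {z - h..z} F / h - F z)
        \<le> (\<integral>\<^sup>+z. ennreal (1 / h) * (\<integral>\<^sup>+s\<in>{-h..0}. ennreal (\<bar>F (z + s) - F z\<bar> powr p) \<partial>lborel) \<partial>lborel)"
      unfolding energy_def by (intro nn_integral_mono)
    also have "\<dots> = ennreal (1 / h) * (\<integral>\<^sup>+z. (\<integral>\<^sup>+s\<in>{-h..0}. ennreal (\<bar>F (z + s) - F z\<bar> powr p) \<partial>lborel) \<partial>lborel)"
      by (subst nn_integral_cmult) auto
    also have "(\<integral>\<^sup>+z. (\<integral>\<^sup>+s\<in>{-h..0}. ennreal (\<bar>F (z + s) - F z\<bar> powr p) \<partial>lborel) \<partial>lborel)
        = (\<integral>\<^sup>+s. (\<integral>\<^sup>+z. ennreal (\<bar>F (z + s) - F z\<bar> powr p) * indicator {-h..0} s \<partial>lborel) \<partial>lborel)"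
      by (rule lborel_pair.Fubini') measurable
    also have "\<dots> = (\<integral>\<^sup>+s. energy p (\<lambda>z. F (z + s) - F z) * indicator {-h..0} s \<partial>lborel)"
      unfolding energy_def by (intro nn_integral_cong nn_integral_multc) auto
    also have "\<dots> \<le> (\<integral>\<^sup>+s. ennreal e * indicator {-h..0} s \<partial>lborel)"
      using h d' by (intro nn_integral_mono) (auto simp: indicator_def)
    also have "\<dots> = ennreal e * ennreal h"
      using h by (simp add: nn_integral_cmult)
    also have "ennreal (1 / h) * (ennreal e * ennreal h) = ennreal e"
      using h e by (simp add: ennreal_mult[symmetric])
    finally show ?thesis by (simp add: mult_left_mono)
  qed
  moreover have "eventually (\<lambda>h. h < d) (at_right (0::real))"
    using d by (intro order_tendstoD(2)[of _ 0]) auto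
  ultimately show "\<exists>g. (g \<longlongrightarrow> 0) (at_right 0) \<and>
      (\<forall>\<^sub>F h in at_right 0. energy p (\<lambda>z. integral {z - h..z} F / h - F z) \<le> ennreal e + g h)"
    using eventually_at_right_less[of 0]
    by (intro exI[of _ "\<lambda>_. 0"]) (auto elim: eventually_elim2)
qed

text \<open>On a bounded interval Jensen plays the part of Hoelder's inequality. This is what allows
  the limit defining the generator to be integrated over [a, b].\<close>

lemma integral_tendsto_0_of_energy:
  assumes p: "1 \<le> p" and [measurable]: "\<And>h. D h \<in> borel_measurable borel"
    and int: "eventually (\<lambda>h. set_integrable lborel {a..b} (D h)) F"
    and lim: "((\<lambda>h. energy p (\<lambda>x. indicator {a..b} x * D h x)) \<longlongrightarrow> 0) F"
  shows "((\<lambda>h. integral {a..b} (D h)) \<longlongrightarrow> 0) F"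
proof (cases "a < b")
  case True
  have "((\<lambda>h. ennreal (\<bar>integral {a..b} (D h) / (b - a)\<bar> powr p)) \<longlongrightarrow> 0) F"
  proof (rule tendsto_sandwich[OF _ _ tendsto_const])
    show "((\<lambda>h. ennreal (1 / (b - a)) * energy p (\<lambda>x. indicator {a..b} x * D h x)) \<longlongrightarrow> 0) F"
      using ennreal_tendsto_cmult[OF _ lim, of "ennreal (1 / (b - a))"] by simp
    show "\<forall>\<^sub>F h in F. ennreal (\<bar>integral {a..b} (D h) / (b - a)\<bar> powr p)
        \<le> ennreal (1 / (b - a)) * energy p (\<lambda>x. indicator {a..b} x * D h x)"
      using int
    proof eventually_elim
      case (elim h)
      have "energy p (\<lambda>x. indicator {a..b} x * D h x) = (\<integral>\<^sup>+x\<in>{a..b}. ennreal (\<bar>D h x\<bar> powr p) \<partial>lborel)"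
        unfolding energy_def using p by (intro nn_integral_cong) (auto simp: indicator_def)
      then show ?case using average_powr_le[OF p True _ elim] by simp
    qed
  qed auto
  then have l: "((\<lambda>h. \<bar>integral {a..b} (D h) / (b - a)\<bar> powr p) \<longlongrightarrow> 0) F"
    using tendsto_ennrealD[of _ 0 F] by simp
  have "((\<lambda>h. (\<bar>integral {a..b} (D h) / (b - a)\<bar> powr p) powr (1 / p)) \<longlongrightarrow> 0) F"
    by (rule tendsto_zero_powrI[OF l tendsto_const]) (use p in auto)
  then have "((\<lambda>h. \<bar>integral {a..b} (D h) / (b - a)\<bar>) \<longlongrightarrow> 0) F"
    using p by (simp add: powr_powr)
  then have "((\<lambda>h. (b - a) * (integral {a..b} (D h) / (b - a))) \<longlongrightarrow> 0) F"
    by (intro tendsto_mult_right_zero) (simp only: tendsto_rabs_zero_iff)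
  then show ?thesis using True by simp
next
  case False
  then have "integral {a..b} (D h) = 0" for h
    by (cases "a = b") auto
  then show ?thesis by simp
qed

section \<open>Minkowski's inequality\<close>

definition Lp_seminorm :: "real \<Rightarrow> (real \<Rightarrow> real) \<Rightarrow> real" where
  "Lp_seminorm p F = enn2real (energy p F) powr (1 / p)"

lemma Lp_seminorm_powr:
  assumes "1 \<le> p" "energy p F < \<infinity>"
  shows "ennreal (Lp_seminorm p F powr p) = energy p F"
  using assms by (simp add: Lp_seminorm_def powr_powr)

lemma Lp_seminorm_le:
  assumes p: "1 \<le> p" and a: "0 \<le> a" and le: "energy p F \<le> ennreal (a powr p)"
  shows "Lp_seminorm p F \<le> a"
proof -
  have "enn2real (energy p F) \<le> a powr p"
    using le by (simp add: enn2real_leI)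
  then have "Lp_seminorm p F \<le> (a powr p) powr (1 / p)"
    unfolding Lp_seminorm_def using p by (intro powr_mono2) auto
  then show ?thesis using p a by (simp add: powr_powr)
qed

lemma Lp_seminorm_triangle:
  assumes p: "1 \<le> p" and [measurable]: "F \<in> borel_measurable borel" "G \<in> borel_measurable borel"
    and fin: "energy p F < \<infinity>" "energy p G < \<infinity>"
  shows "Lp_seminorm p (\<lambda>x. F x + G x) \<le> Lp_seminorm p F + Lp_seminorm p G"
proof (rule field_le_epsilon)
  fix e :: real assume e: "0 < e"
  \<comment> \<open>Adding e / 2 to each seminorm makes the weights a and b positive, so vanishing
    seminorms need no separate treatment.\<close>
  define a where "a = Lp_seminorm p F + e / 2"
  define b where "b = Lp_seminorm p G + e / 2"
  have nn: "0 \<le> Lp_seminorm p F" "0 \<le> Lp_seminorm p G" by (auto simp: Lp_seminorm_def)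
  then have ab: "0 < a" "0 < b" using e by (auto simp: a_def b_def)
  define s where "s = (a + b) powr (p - 1)"
  have pw: "\<bar>x + y\<bar> powr p \<le> s * a powr (1 - p) * \<bar>x\<bar> powr p + s * b powr (1 - p) * \<bar>y\<bar> powr p" for x y :: real
  proof (cases "\<bar>x\<bar> + \<bar>y\<bar> = 0")
    case False
    \<comment> \<open>This c is the mean of |x| / a and |y| / b with weights a and b, so the linear
      terms of the two tangents at c cancel.\<close>
    define c where "c = (\<bar>x\<bar> + \<bar>y\<bar>) / (a + b)"
    have c: "0 < c" using False ab by (auto simp: c_def intro!: divide_pos_pos)
    have ca: "c * (a + b) = \<bar>x\<bar> + \<bar>y\<bar>" using ab by (simp add: c_def)
    have "a * (c powr p + p * c powr (p - 1) * (\<bar>x\<bar> / a - c)) + b * (c powr p + p * c powr (p - 1) * (\<bar>y\<bar> / b - c))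
       \<le> a * (\<bar>x\<bar> / a) powr p + b * (\<bar>y\<bar> / b) powr p"
      using ab c by (intro add_mono mult_left_mono powr_above_tangent[OF p]) auto
    also have "a * (c powr p + p * c powr (p - 1) * (\<bar>x\<bar> / a - c)) + b * (c powr p + p * c powr (p - 1) * (\<bar>y\<bar> / b - c))
      = (a + b) * c powr p + p * c powr (p - 1) * (\<bar>x\<bar> + \<bar>y\<bar> - c * (a + b))"
      using ab by (simp add: field_simps)
    also have "\<dots> = (a + b) * c powr p" by (simp add: ca)
    finally have 1: "(a + b) * c powr p \<le> a * (\<bar>x\<bar> / a) powr p + b * (\<bar>y\<bar> / b) powr p" .
    have "\<bar>x + y\<bar> powr p \<le> (c * (a + b)) powr p"
      using p ca by (intro powr_mono2) auto
    also have "\<dots> = s * ((a + b) * c powr p)"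
      using ab c by (simp add: powr_mult s_def powr_diff)
    also have "\<dots> \<le> s * (a * (\<bar>x\<bar> / a) powr p + b * (\<bar>y\<bar> / b) powr p)"
      using 1 by (intro mult_left_mono) (auto simp: s_def)
    also have "\<dots> = s * a powr (1 - p) * \<bar>x\<bar> powr p + s * b powr (1 - p) * \<bar>y\<bar> powr p"
      using ab by (simp add: powr_divide powr_diff algebra_simps)
    finally show ?thesis .
  next
    case True
    then have "x = 0" "y = 0" by auto
    then show ?thesis by simp
  qed
  have "energy p (\<lambda>x. F x + G x) \<le>
      (\<integral>\<^sup>+x. ennreal (s * a powr (1 - p)) * ennreal (\<bar>F x\<bar> powr p)
        + ennreal (s * b powr (1 - p)) * ennreal (\<bar>G x\<bar> powr p) \<partial>lborel)"
    unfolding energy_def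
  proof (intro nn_integral_mono)
    fix x
    show "ennreal (\<bar>F x + G x\<bar> powr p) \<le> ennreal (s * a powr (1 - p)) * ennreal (\<bar>F x\<bar> powr p)
        + ennreal (s * b powr (1 - p)) * ennreal (\<bar>G x\<bar> powr p)"
      using ennreal_leI[OF pw[of "F x" "G x"]] by (simp add: ennreal_mult s_def)
  qed
  also have "\<dots> = ennreal (s * a powr (1 - p)) * energy p F + ennreal (s * b powr (1 - p)) * energy p G"
    unfolding energy_def by (simp add: nn_integral_add nn_integral_cmult)
  also have "\<dots> = ennreal (s * a powr (1 - p) * Lp_seminorm p F powr p + s * b powr (1 - p) * Lp_seminorm p G powr p)"
    using Lp_seminorm_powr[OF p fin(1)] Lp_seminorm_powr[OF p fin(2)] by (simp add: ennreal_mult s_def)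
  also have "\<dots> \<le> ennreal (s * a powr (1 - p) * a powr p + s * b powr (1 - p) * b powr p)"
    using p nn e by (intro ennreal_leI add_mono mult_left_mono powr_mono2) (auto simp: a_def b_def s_def)
  also have "s * a powr (1 - p) * a powr p + s * b powr (1 - p) * b powr p = s * (a + b)"
    using ab by (simp add: mult.assoc powr_add[symmetric] distrib_left)
  also have "\<dots> = (a + b) powr p"
    using ab by (simp add: s_def powr_diff)
  finally have "Lp_seminorm p (\<lambda>x. F x + G x) \<le> a + b"
    using ab by (intro Lp_seminorm_le[OF p]) auto
  then show "Lp_seminorm p (\<lambda>x. F x + G x) \<le> Lp_seminorm p F + Lp_seminorm p G + e"
    by (simp add: a_def b_def)
qed

section \<open>Classes of functions on the unit interval\<close>

text \<open>Extension by zero turns a class on the open interval into a Borel function on the line,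
  so that null sets, translations and integrals can all be handled with
  \<open>lborel\<close>.\<close>

definition zero_ext :: "l0 \<Rightarrow> real \<Rightarrow> real" where
  "zero_ext f x = (if 0 < x \<and> x < 1 then rep_l0 f x else 0)"

lemma AE_unit_interval: "(AE x in unit_interval. Q x) \<longleftrightarrow> (AE x in lborel. 0 < x \<and> x < 1 \<longrightarrow> Q x)"
  unfolding unit_interval_def by (subst AE_restrict_space_iff) auto

lemma borel_measurable_unit_interval_iff:
  fixes f :: "real \<Rightarrow> real"
  shows "f \<in> borel_measurable unit_interval \<longleftrightarrow> (\<lambda>x. if 0 < x \<and> x < 1 then f x else 0) \<in> borel_measurable borel"
  unfolding unit_interval_def
  by (subst measurable_restrict_space_iff[where c = 0]) auto

lemma borel_measurable_unit_intervalI: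
  "f \<in> borel_measurable borel \<Longrightarrow> f \<in> borel_measurable unit_interval" for f :: "real \<Rightarrow> real"
  unfolding unit_interval_def by (rule measurable_restrict_space1) simp

lemma l0_rel_rep: "l0_rel (rep_l0 f) (rep_l0 f)"
  by (rule Quotient_rep_reflp[OF Quotient_l0])

lemma abs_rep_l0: "abs_l0 (rep_l0 f) = f"
  by (rule Quotient_abs_rep[OF Quotient_l0])

lemma rep_l0_measurable: "rep_l0 f \<in> borel_measurable unit_interval"
  using l0_rel_rep[of f] by (simp add: l0_rel_def)

lemma zero_ext_measurable[measurable]: "zero_ext f \<in> borel_measurable borel"
  using rep_l0_measurable[of f] unfolding borel_measurable_unit_interval_iff zero_ext_def[abs_def] .

lemma zero_ext_outside: "\<not> (0 < x \<and> x < 1) \<Longrightarrow> zero_ext f x = 0"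
  by (auto simp: zero_ext_def)

lemma zero_ext_abs:
  assumes "h \<in> borel_measurable unit_interval"
  shows "AE x in lborel. 0 < x \<and> x < 1 \<longrightarrow> zero_ext (abs_l0 h) x = h x"
proof -
  have "l0_rel (rep_l0 (abs_l0 h)) h"
    using assms by (intro Quotient_rep_abs[OF Quotient_l0]) (simp add: l0_rel_def)
  then show ?thesis
    unfolding l0_rel_def AE_unit_interval by (auto simp: zero_ext_def elim!: eventually_mono)
qed

lemma abs_l0_cong:
  assumes "h \<in> borel_measurable unit_interval" "k \<in> borel_measurable unit_interval"
    and "AE x in lborel. 0 < x \<and> x < 1 \<longrightarrow> h x = k x"
  shows "abs_l0 h = abs_l0 k"
  using assms Quotient_rel[OF Quotient_l0, of h k] by (auto simp: l0_rel_def AE_unit_interval)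

lemma l0_eqI: "AE x in lborel. 0 < x \<and> x < 1 \<longrightarrow> zero_ext f x = zero_ext g x \<Longrightarrow> f = g"
  using abs_l0_cong[OF rep_l0_measurable rep_l0_measurable, of f g]
  by (auto simp: zero_ext_def abs_rep_l0 elim!: eventually_mono)

lemma zero_ext_abs_fun:
  assumes "h \<in> borel_measurable unit_interval" and "\<And>x. \<not> (0 < x \<and> x < 1) \<Longrightarrow> h' x = 0"
    and "\<And>x. 0 < x \<Longrightarrow> x < 1 \<Longrightarrow> h x = h' x"
  shows "AE x in lborel. zero_ext (abs_l0 h) x = h' x"
  using zero_ext_abs[OF assms(1)]
  by eventually_elim (use assms(2,3) zero_ext_outside in metis)

lemma zero_ext_plus: "AE x in lborel. zero_ext (f + g) x = zero_ext f x + zero_ext g x"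
  unfolding plus_l0_def map_fun_def comp_def id_def
  by (intro zero_ext_abs_fun borel_measurable_add rep_l0_measurable) (auto simp: zero_ext_def)

lemma zero_ext_diff: "AE x in lborel. zero_ext (f - g) x = zero_ext f x - zero_ext g x"
  unfolding minus_l0_def map_fun_def comp_def id_def
  by (intro zero_ext_abs_fun borel_measurable_diff rep_l0_measurable) (auto simp: zero_ext_def)

lemma zero_ext_uminus: "AE x in lborel. zero_ext (- f) x = - zero_ext f x"
  unfolding uminus_l0_def map_fun_def comp_def id_def
  by (intro zero_ext_abs_fun borel_measurable_uminus rep_l0_measurable) (auto simp: zero_ext_def)

lemma zero_ext_scaleR: "AE x in lborel. zero_ext (c *\<^sub>R f) x = c * zero_ext f x"
  unfolding scaleR_l0_def map_fun_def comp_def id_def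
  by (intro zero_ext_abs_fun borel_measurable_times borel_measurable_const rep_l0_measurable)
    (auto simp: zero_ext_def)

section \<open>The norm of a single class\<close>

lemma nn_integral_unit_interval:
  fixes p :: real
  assumes "1 \<le> p"
  shows "(\<integral>\<^sup>+x. ennreal (\<bar>rep_l0 f x\<bar> powr p) \<partial>unit_interval) = energy p (zero_ext f)"
  unfolding unit_interval_def energy_def
  by (subst nn_integral_restrict_space)
    (auto intro!: nn_integral_cong simp: zero_ext_def indicator_def)

lemma Lp_iff: "1 \<le> p \<Longrightarrow> f \<in> Lp p \<longleftrightarrow> energy p (zero_ext f) < \<infinity>"
proof -
  assume p: "1 \<le> p"
  have "in_Lp p f \<longleftrightarrow> integrable unit_interval (\<lambda>x. \<bar>rep_l0 f x\<bar> powr p)"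
    by (simp add: in_Lp_def)
  also have "\<dots> \<longleftrightarrow> energy p (zero_ext f) < \<infinity>"
    unfolding integrable_iff_bounded nn_integral_unit_interval[OF p, symmetric]
    using rep_l0_measurable[of f] by auto
  finally show ?thesis by (simp add: Lp_def)
qed

lemma Lp_norm_eq: "1 \<le> p \<Longrightarrow> Lp_norm p f = Lp_seminorm p (zero_ext f)"
proof -
  assume p: "1 \<le> p"
  have "Lp_norm p f = (LINT x|unit_interval. \<bar>rep_l0 f x\<bar> powr p) powr (1 / p)"
    by (simp add: Lp_norm_def)
  also have "(LINT x|unit_interval. \<bar>rep_l0 f x\<bar> powr p) = enn2real (energy p (zero_ext f))"
    unfolding nn_integral_unit_interval[OF p, symmetric]
    using rep_l0_measurable[of f] by (intro integral_eq_nn_integral) auto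
  finally show ?thesis by (simp add: Lp_seminorm_def)
qed

lemma zero_ext_zero: "AE x in lborel. zero_ext 0 x = 0"
  using zero_ext_scaleR[of 0 0] by simp

lemma energy_zero: "0 < p \<Longrightarrow> energy p (\<lambda>_. 0) = 0"
  by (simp add: energy_def)

lemma subspace_Lp: assumes p: "1 \<le> p" shows "subspace (Lp p)"
  unfolding subspace_def
proof (intro conjI ballI allI)
  show "0 \<in> Lp p"
    using energy_cong_AE[OF zero_ext_zero, of p] energy_zero[of p] p by (simp add: Lp_iff)
  fix f g assume f: "f \<in> Lp p"
  show "f + g \<in> Lp p" if g: "g \<in> Lp p"
  proof -
    have "energy p (zero_ext (f + g)) = energy p (\<lambda>x. zero_ext f x + zero_ext g x)"
      by (intro energy_cong_AE zero_ext_plus)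
    also have "\<dots> \<le> ennreal (2 powr p) * (energy p (zero_ext f) + energy p (zero_ext g))"
      using p by (intro energy_add) auto
    also have "\<dots> < \<infinity>"
      using f g p by (simp add: Lp_iff ennreal_mult_less_top)
    finally show ?thesis using p by (simp add: Lp_iff)
  qed
  show "c *\<^sub>R f \<in> Lp p" for c
    using f p energy_cong_AE[OF zero_ext_scaleR, of p c f]
    by (simp add: Lp_iff energy_cmult ennreal_mult_less_top)
qed

lemma Lp_norm_add:
  assumes p: "1 \<le> p" and "f \<in> Lp p" "g \<in> Lp p"
  shows "Lp_norm p (f + g) \<le> Lp_norm p f + Lp_norm p g"
  using Lp_seminorm_triangle[OF p, of "zero_ext f" "zero_ext g"] assms energy_cong_AE[OF zero_ext_plus, of p f g]
  by (simp add: Lp_norm_eq Lp_iff Lp_seminorm_def)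

lemma Lp_norm_scaleR:
  assumes p: "1 \<le> p"
  shows "Lp_norm p (c *\<^sub>R f) = \<bar>c\<bar> * Lp_norm p f"
  using p energy_cong_AE[OF zero_ext_scaleR, of p c f]
  by (simp add: Lp_norm_eq Lp_seminorm_def energy_cmult enn2real_mult powr_mult powr_powr)

lemma Lp_norm_zero_imp:
  assumes p: "1 \<le> p" and f: "f \<in> Lp p" and z: "Lp_norm p f = 0"
  shows "f = 0"
proof (rule l0_eqI)
  have "enn2real (energy p (zero_ext f)) = 0"
    using z p by (simp add: Lp_norm_eq Lp_seminorm_def)
  then have "energy p (zero_ext f) = 0"
    using f p by (auto simp: Lp_iff enn2real_eq_0_iff)
  then have "AE x in lborel. ennreal (\<bar>zero_ext f x\<bar> powr p) = 0"
    unfolding energy_def by (subst (asm) nn_integral_0_iff_AE) auto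
  then show "AE x in lborel. 0 < x \<and> x < 1 \<longrightarrow> zero_ext f x = zero_ext 0 x"
    using zero_ext_zero by eventually_elim auto
qed

lemma Lp_norm_nonneg: "1 \<le> p \<Longrightarrow> 0 \<le> Lp_norm p f"
  by (simp add: Lp_norm_eq Lp_seminorm_def)

section \<open>The product space and its energy\<close>

lemma subspace_Xp: "1 \<le> p \<Longrightarrow> subspace (Xp p)"
  using subspace_Lp[of p] by (auto simp: subspace_def Xp_def)

lemma Xp_norm_add:
  "\<lbrakk>1 \<le> p; f \<in> Xp p; g \<in> Xp p\<rbrakk> \<Longrightarrow> Xp_norm p (f + g) \<le> Xp_norm p f + Xp_norm p g"
  unfolding Xp_norm_def Xp_def
  by (auto simp: sum.distrib[symmetric] intro!: sum_mono Lp_norm_add)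

lemma Xp_norm_scaleR: "1 \<le> p \<Longrightarrow> Xp_norm p (c *\<^sub>R f) = \<bar>c\<bar> * Xp_norm p f"
  unfolding Xp_norm_def by (simp add: Lp_norm_scaleR sum_distrib_left)

lemma Xp_norm_zero_imp:
  assumes "1 \<le> p" "f \<in> Xp p" "Xp_norm p f = 0"
  shows "f = 0"
proof -
  have "Lp_norm p (f $ i) = 0" for i
    using assms(1,3) unfolding Xp_norm_def by (subst (asm) sum_nonneg_eq_0_iff) (auto simp: Lp_norm_nonneg)
  then show ?thesis using assms Lp_norm_zero_imp[of p] by (auto simp: vec_eq_iff Xp_def)
qed

text \<open>A replacement for the norm in limit arguments. The two estimates below, of the norm by
  the energy and conversely, make convergence to 0 in either sense interchangeable on the
  space.\<close>

definition Xp_energy :: "real \<Rightarrow> l0 ^ 'n \<Rightarrow> ennreal" where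
  "Xp_energy p f = (\<Sum>i\<in>UNIV. energy p (zero_ext (f $ i)))"

lemma Xp_iff: "1 \<le> p \<Longrightarrow> f \<in> Xp p \<longleftrightarrow> Xp_energy p f < \<infinity>"
  by (auto simp: Xp_def Lp_iff Xp_energy_def)

lemma Xp_norm_le_energy:
  fixes f :: "l0 ^ 'n"
  assumes p: "1 \<le> p" and K: "0 \<le> K" and le: "Xp_energy p f \<le> ennreal (K powr p)"
  shows "Xp_norm p f \<le> real CARD('n) * K"
proof -
  have "Lp_norm p (f $ i) \<le> K" for i
  proof -
    have "energy p (zero_ext (f $ i)) \<le> Xp_energy p f"
      unfolding Xp_energy_def by (intro member_le_sum) auto
    then show ?thesis
      unfolding Lp_norm_eq[OF p] using le by (intro Lp_seminorm_le[OF p K]) (rule order_trans)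
  qed
  then show ?thesis unfolding Xp_norm_def by (intro sum_bounded_above) auto
qed

lemma Xp_energy_le_norm:
  fixes f :: "l0 ^ 'n"
  assumes p: "1 \<le> p" and f: "f \<in> Xp p"
  shows "Xp_energy p f \<le> ennreal (real CARD('n) * Xp_norm p f powr p)"
proof -
  have "energy p (zero_ext (f $ i)) \<le> ennreal (Xp_norm p f powr p)" for i
  proof -
    have "Lp_norm p (f $ i) \<le> Xp_norm p f"
      unfolding Xp_norm_def using p by (intro member_le_sum) (auto simp: Lp_norm_nonneg)
    then have "ennreal (Lp_norm p (f $ i) powr p) \<le> ennreal (Xp_norm p f powr p)"
      using p by (intro ennreal_leI powr_mono2) (auto simp: Lp_norm_nonneg)
    moreover have "ennreal (Lp_norm p (f $ i) powr p) = energy p (zero_ext (f $ i))"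
      using f p by (simp add: Lp_norm_eq Xp_def Lp_iff Lp_seminorm_powr)
    ultimately show ?thesis by (simp only:)
  qed
  then have "Xp_energy p f \<le> (\<Sum>i\<in>(UNIV::'n set). ennreal (Xp_norm p f powr p))"
    unfolding Xp_energy_def by (intro sum_mono)
  then show ?thesis by (simp add: ennreal_mult ennreal_of_nat_eq_real_of_nat)
qed

lemma Xp_norm_tendsto_0:
  fixes f :: "'a \<Rightarrow> l0 ^ 'n"
  assumes p: "1 \<le> p" and lim: "((\<lambda>h. Xp_energy p (f h)) \<longlongrightarrow> 0) F"
  shows "((\<lambda>h. Xp_norm p (f h)) \<longlongrightarrow> 0) F"
proof -
  have "((\<lambda>h. Lp_norm p (f h $ i)) \<longlongrightarrow> 0) F" for i
  proof -
    have "((\<lambda>h. energy p (zero_ext (f h $ i))) \<longlongrightarrow> 0) F"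
      by (rule tendsto_sandwich[OF _ _ tendsto_const lim])
        (auto simp: Xp_energy_def intro!: always_eventually member_le_sum)
    then have l: "((\<lambda>h. enn2real (energy p (zero_ext (f h $ i)))) \<longlongrightarrow> 0) F"
      using tendsto_enn2real[of _ 0 F] by simp
    show ?thesis
      unfolding Lp_norm_eq[OF p] Lp_seminorm_def
      by (rule tendsto_zero_powrI[OF l tendsto_const]) (use p in auto)
  qed
  then show ?thesis unfolding Xp_norm_def by (intro tendsto_null_sum) auto
qed

text \<open>Membership matters here: for a class of infinite energy \<open>enn2real\<close> makes
  the norm 0, so a small norm alone says nothing about the energy.\<close>

lemma Xp_energy_tendsto_0:
  fixes f :: "'a \<Rightarrow> l0 ^ 'n"
  assumes p: "1 \<le> p" and lim: "((\<lambda>h. Xp_norm p (f h)) \<longlongrightarrow> 0) F"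
    and ev: "eventually (\<lambda>h. f h \<in> Xp p) F"
  shows "((\<lambda>h. Xp_energy p (f h)) \<longlongrightarrow> 0) F"
proof (rule tendsto_sandwich[OF _ _ tendsto_const])
  have "((\<lambda>h. Xp_norm p (f h) powr p) \<longlongrightarrow> 0) F"
    by (rule tendsto_zero_powrI[OF lim tendsto_const])
      (use p in \<open>auto simp: Xp_norm_def intro!: always_eventually sum_nonneg Lp_norm_nonneg\<close>)
  then have "((\<lambda>h. real CARD('n) * Xp_norm p (f h) powr p) \<longlongrightarrow> 0) F"
    by (rule tendsto_mult_right_zero)
  then show "((\<lambda>h. ennreal (real CARD('n) * Xp_norm p (f h) powr p)) \<longlongrightarrow> 0) F"
    using tendsto_ennrealI by fastforce
  show "\<forall>\<^sub>F h in F. Xp_energy p (f h) \<le> ennreal (real CARD('n) * Xp_norm p (f h) powr p)"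
    using ev by eventually_elim (rule Xp_energy_le_norm[OF p])
qed auto

section \<open>Weak derivatives on the unit interval\<close>

lemma lebesgue_differentiation:
  fixes U :: "real \<Rightarrow> real"
  assumes "\<And>a b. U integrable_on {a..b}"
  shows "AE x in lborel. ((\<lambda>h. integral {x..x + h} U / h) \<longlongrightarrow> U x) (at_right 0)"
proof -
  obtain N where N: "negligible N" and d: "\<And>x e. \<lbrakk>x \<notin> N; 0 < e\<rbrakk> \<Longrightarrow>
      \<exists>d>0. \<forall>h. 0 < h \<and> h < d \<longrightarrow> norm (integral (cbox x (x + h *\<^sub>R One)) U /\<^sub>R h ^ DIM(real) - U x) < e"
    by (rule integrable_ccontinuous_explicit[of U]) (auto simp: assms)
  have "((\<lambda>h. integral {x..x + h} U / h) \<longlongrightarrow> U x) (at_right 0)" if "x \<notin> N" for x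
  proof (rule tendstoI)
    fix e :: real assume "0 < e"
    from d[OF that this] obtain d where "0 < d"
      and "\<forall>h. 0 < h \<and> h < d \<longrightarrow> norm (integral (cbox x (x + h *\<^sub>R One)) U /\<^sub>R h ^ DIM(real) - U x) < e"
      by auto
    then show "\<forall>\<^sub>F h in at_right 0. dist (integral {x..x + h} U / h) (U x) < e"
      unfolding eventually_at_right_field
      by (intro exI[of _ d]) (auto simp: dist_norm divide_inverse mult.commute)
  qed
  moreover have "AE x in lebesgue. x \<notin> N"
    using N by (auto simp: negligible_iff_null_sets intro: AE_not_in)
  ultimately have "AE x in lebesgue. ((\<lambda>h. integral {x..x + h} U / h) \<longlongrightarrow> U x) (at_right 0)"
    by (auto elim: eventually_mono)
  then show ?thesis by (simp add: AE_completion_iff)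
qed

text \<open>The set of agreement is closed and contains almost every point of the open interval,
  hence all of it and its closure. Clamping with \<open>c\<close> continues both functions to the
  line, so that closedness can be used there.\<close>

lemma continuous_AE_eq_imp_eq:
  fixes v w :: "real \<Rightarrow> real"
  assumes ab: "a < b" and v: "continuous_on {a..b} v" and w: "continuous_on {a..b} w"
    and ae: "AE x in lborel. a < x \<and> x < b \<longrightarrow> v x = w x" and x: "x \<in> {a..b}"
  shows "v x = w x"
proof -
  define c where "c x = max a (min b x)" for x
  define C where "C = {x. v (c x) - w (c x) = 0}"
  have "continuous_on UNIV c" unfolding c_def by (intro continuous_intros)
  then have "continuous_on UNIV (\<lambda>x. v (c x) - w (c x))"
    using ab by (intro continuous_intros continuous_on_compose2[OF v] continuous_on_compose2[OF w])
      (auto simp: c_def)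
  then have C: "closed C"
    unfolding C_def by (rule closed_Collect_eq[OF _ continuous_on_const])
  have "AE x\<in>{a<..<b} in lebesgue. x \<in> C"
    using AE_completion[OF ae] by eventually_elim (auto simp: C_def c_def)
  from mem_closed_if_AE_lebesgue_open[OF open_greaterThanLessThan C this] have "{a<..<b} \<subseteq> C"
    by (rule subsetI)
  then have "closure {a<..<b} \<subseteq> C"
    using C by (rule closure_minimal)
  with x ab show ?thesis by (auto simp: C_def c_def)
qed

lemma point_value_eq:
  assumes v: "continuous_on {0..1} v" and ae: "AE x in lborel. 0 < x \<and> x < 1 \<longrightarrow> zero_ext f x = v x"
    and a: "a \<in> {0..1}"
  shows "point_value f a = v a"
  unfolding point_value_def
proof (rule the_equality)
  show "\<exists>w. continuous_on {0..1} w \<and> (AE x in unit_interval. rep_l0 f x = w x) \<and> w a = v a"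
    using v ae by (intro exI[of _ v]) (auto simp: AE_unit_interval zero_ext_def elim!: eventually_mono)
next
  fix c assume "\<exists>w. continuous_on {0..1} w \<and> (AE x in unit_interval. rep_l0 f x = w x) \<and> w a = c"
  then obtain w where w: "continuous_on {0..1} w" "AE x in unit_interval. rep_l0 f x = w x" "w a = c"
    by auto
  have "AE x in lborel. 0 < x \<and> x < 1 \<longrightarrow> w x = v x"
    using w(2) ae unfolding AE_unit_interval by eventually_elim (auto simp: zero_ext_def)
  from continuous_AE_eq_imp_eq[OF _ w(1) v this a] w(3) show "c = v a" by simp
qed

section \<open>Test functions and integration by parts\<close>

lemma integral_unit_interval:
  "(LINT x|unit_interval. f x) = (LINT x|lborel. indicator {0<..<1} x * (f x :: real))"
  unfolding unit_interval_def by (subst integral_restrict_space) auto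

lemma loc_integrable_iff:
  "loc_integrable f \<longleftrightarrow> (\<forall>a b. 0 < a \<and> b < 1 \<longrightarrow> set_integrable lborel {a..b} f)"
proof -
  have "set_integrable unit_interval {a..b} f \<longleftrightarrow> set_integrable lborel {a..b} f" if "0 < a" "b < 1" for a b
  proof -
    have "(\<lambda>x. indicator {0<..<1} x *\<^sub>R (indicator {a..b} x *\<^sub>R f x)) = (\<lambda>x. indicator {a..b} x *\<^sub>R f x)"
      using that by (auto simp: indicator_def fun_eq_iff)
    then show ?thesis
      unfolding set_integrable_def unit_interval_def by (subst integrable_restrict_space) simp_all
  qed
  then show ?thesis unfolding loc_integrable_def by auto
qed

lemma set_integrable_zero_ext_iff:
  assumes "0 < a" "b < 1"
  shows "set_integrable lborel {a..b} (rep_l0 f) \<longleftrightarrow> set_integrable lborel {a..b} (zero_ext f)"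
  unfolding set_integrable_def using assms
  by (auto intro!: arg_cong[where f = "integrable lborel"] simp: indicator_def fun_eq_iff zero_ext_def)

lemma test_function_deriv:
  assumes "test_function \<phi>"
  obtains a b K where "0 < a" "b < 1" "\<And>x. x \<notin> {a..b} \<Longrightarrow> \<phi> x = 0" "\<And>x. (\<phi> has_real_derivative deriv \<phi> x) (at x)"
    "continuous_on UNIV (deriv \<phi>)" "continuous_on UNIV \<phi>" "\<And>x. x \<notin> {a..b} \<Longrightarrow> deriv \<phi> x = 0"
    "\<And>x. \<bar>deriv \<phi> x\<bar> \<le> K" "\<And>x. \<bar>\<phi> x\<bar> \<le> K" "0 \<le> K"
proof -
  obtain a b where ab: "0 < a" "b < 1" "\<And>x. x \<notin> {a..b} \<Longrightarrow> \<phi> x = 0"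
    using assms by (auto simp: test_function_def)
  obtain D where D: "\<And>x. (\<phi> has_real_derivative D x) (at x)" "continuous_on UNIV D"
    using assms by (auto simp: test_function_def C1_differentiable_on_def has_real_derivative_iff_has_vector_derivative)
  have deq: "deriv \<phi> = D" using D(1) by (auto simp: DERIV_imp_deriv)
  have z: "D x = 0" if "x \<notin> {a..b}" for x
  proof -
    have "open (- {a..b})" by auto
    have "((\<lambda>_. 0) has_real_derivative 0) (at x)" by simp
    then have "(\<phi> has_real_derivative 0) (at x)"
      by (rule has_field_derivative_transform_within_open[OF _ \<open>open (- {a..b})\<close>]) (use that ab in auto)
    with D(1) show ?thesis by (rule DERIV_unique)
  qed
  have c: "continuous_on UNIV \<phi>"
    using D(1) by (auto simp: continuous_on_eq_continuous_at intro: DERIV_isCont)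
  have bd: "\<exists>M\<ge>0. \<forall>x. \<bar>f x\<bar> \<le> M" if "continuous_on UNIV f" "\<And>x. x \<notin> {a..b} \<Longrightarrow> f x = 0" for f :: "real \<Rightarrow> real"
  proof -
    have "bounded (f ` {a..b})"
      using that(1) by (intro compact_imp_bounded compact_continuous_image) (auto intro: continuous_on_subset)
    then obtain M where "\<forall>x\<in>{a..b}. \<bar>f x\<bar> \<le> M" by (auto simp: bounded_iff)
    then have "\<bar>f x\<bar> \<le> \<bar>M\<bar>" for x
      using that(2)[of x] by (cases "x \<in> {a..b}") (auto intro: order_trans[OF _ abs_ge_self])
    then show ?thesis by (intro exI[of _ "\<bar>M\<bar>"]) auto
  qed
  obtain M1 M2 where M: "0 \<le> M1" "\<And>x. \<bar>\<phi> x\<bar> \<le> M1" "0 \<le> M2" "\<And>x. \<bar>D x\<bar> \<le> M2"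
    using bd[OF c ab(3)] bd[OF D(2) z] by auto
  have "\<bar>\<phi> x\<bar> \<le> M1 + M2" "\<bar>D x\<bar> \<le> M1 + M2" "0 \<le> M1 + M2" for x
    using M(1,3) M(2)[of x] M(4)[of x] by linarith+
  with ab c z D show thesis
    by (intro that[of a b "M1 + M2"]) (auto simp: deq)
qed

lemma integrable_mult_bounded_continuous:
  fixes U \<psi> :: "real \<Rightarrow> real"
  assumes U: "integrable lborel U" and \<psi>: "continuous_on UNIV \<psi>" and K: "\<And>x. \<bar>\<psi> x\<bar> \<le> K"
  shows "integrable lborel (\<lambda>x. U x * \<psi> x)"
proof (rule Bochner_Integration.integrable_bound[of _ "\<lambda>x. K * U x"])
  show "integrable lborel (\<lambda>x. K * U x)" using U by simp
  have [measurable]: "\<psi> \<in> borel_measurable borel" by (rule borel_measurable_continuous_onI[OF \<psi>])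
  show "(\<lambda>x. U x * \<psi> x) \<in> borel_measurable lborel" using U by measurable
  have "\<bar>\<psi> x\<bar> \<le> \<bar>K\<bar>" for x using K[of x] by linarith
  then show "AE x in lborel. norm (U x * \<psi> x) \<le> norm (K * U x)"
    by (auto simp: abs_mult mult.commute[of "\<bar>K\<bar>"] intro!: AE_I2 mult_left_mono)
qed

text \<open>Integration by parts for a primitive of a merely integrable G. The primitive is written
  as an integral over s and the order is exchanged by Fubini; the inner integral of
  \<open>deriv \<phi>\<close> over [s, 1] is -\<phi>(s).\<close>

lemma primitive_test_integral:
  fixes G \<phi> :: "real \<Rightarrow> real"
  assumes G: "integrable lborel G" and \<phi>: "test_function \<phi>"
  shows "(LINT x|lborel. indicator {0<..<1} x * (c + integral {0..x} G) * deriv \<phi> x)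
       = - (LINT x|lborel. indicator {0<..<1} x * G x * \<phi> x)"
proof -
  obtain a b K where ab: "0 < a" "b < 1" "\<And>x. x \<notin> {a..b} \<Longrightarrow> \<phi> x = 0"
    and D: "\<And>x. (\<phi> has_real_derivative deriv \<phi> x) (at x)"
    and cD: "continuous_on UNIV (deriv \<phi>)" and c\<phi>: "continuous_on UNIV \<phi>"
    and zD: "\<And>x. x \<notin> {a..b} \<Longrightarrow> deriv \<phi> x = 0"
    and KD: "\<And>x. \<bar>deriv \<phi> x\<bar> \<le> K" and K\<phi>: "\<And>x. \<bar>\<phi> x\<bar> \<le> K" and K: "0 \<le> K"
    using test_function_deriv[OF \<phi>] by metis
  have [measurable]: "deriv \<phi> \<in> borel_measurable borel" "\<phi> \<in> borel_measurable borel" "G \<in> borel_measurable borel"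
    using cD c\<phi> G by (auto intro: borel_measurable_continuous_onI)
  have zD': "a \<le> x \<and> x \<le> b" if "deriv \<phi> x \<noteq> 0" for x
    using zD[of x] that by auto
  have \<phi>1: "\<phi> 1 = 0" "\<phi> 0 = 0" using ab by auto
  define D' where "D' x = indicator {0<..<1} x * deriv \<phi> x" for x
  define G' where "G' x = indicator {0<..<1} x * G x" for x
  have [measurable]: "D' \<in> borel_measurable borel" "G' \<in> borel_measurable borel"
    unfolding D'_def G'_def by measurable
  have intG': "integrable lborel G'"
    unfolding G'_def using integrable_mult_indicator[OF _ G, of "{0<..<1}"] by simp
  have FTC: "(LINT x|lborel. indicator {s..1} x * deriv \<phi> x) = - \<phi> s" if "s \<le> 1" for s
    using integral_FTC_Icc_real[OF that, of \<phi> "deriv \<phi>"] D cD \<phi>1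
    by (simp add: continuous_on_eq_continuous_at mult.commute)
  have int1: "integrable lborel D'"
  proof -
    have "integrable lborel (\<lambda>x. indicator {0<..<1::real} x * deriv \<phi> x)"
      by (rule integrable_mult_bounded_continuous[OF _ cD KD]) (auto intro: integrable_real_indicator)
    then show ?thesis by (simp add: D'_def[abs_def])
  qed
  \<comment> \<open>The factor selects the triangle s \<le> x, so integrating over s yields the
    primitive at x, and integrating over x yields the value of the test function at s.\<close>
  let ?k = "\<lambda>x s. (if s \<le> x then 1 else 0) * (D' x * G' s)"
  have prod: "integrable (lborel \<Otimes>\<^sub>M lborel) (\<lambda>(x, s). ?k x s)"
  proof (rule Bochner_Integration.integrable_bound[of _ "\<lambda>(x, s). D' x * G' s"])
    show "integrable (lborel \<Otimes>\<^sub>M lborel) (\<lambda>(x, s). D' x * G' s)"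
    proof (rule lborel_pair.Fubini_integrable)
      show "integrable lborel (\<lambda>x. LINT y|lborel. norm (case (x, y) of (x, s) \<Rightarrow> D' x * G' s))"
        using int1 by (simp add: abs_mult)
      show "AE x in lborel. integrable lborel (\<lambda>y. case (x, y) of (x, s) \<Rightarrow> D' x * G' s)"
        using intG' by simp
    qed measurable
    show "AE x in lborel \<Otimes>\<^sub>M lborel. norm (case x of (x, s) \<Rightarrow> ?k x s)
        \<le> norm (case x of (x, s) \<Rightarrow> D' x * G' s)"
      by (auto intro!: AE_I2)
  qed measurable
  have "(LINT x|lborel. indicator {0<..<1} x * (c + integral {0..x} G) * deriv \<phi> x)
    = (LINT x|lborel. c * D' x + (LINT s|lborel. ?k x s))"
  proof (intro Bochner_Integration.integral_cong refl)
    fix x :: real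
    show "indicator {0<..<1} x * (c + integral {0..x} G) * deriv \<phi> x
      = c * D' x + (LINT s|lborel. ?k x s)"
    proof (cases "0 < x \<and> x < 1")
      case True
      have si: "set_integrable lborel {0..x} G"
        using integrable_mult_indicator[OF _ G, of "{0..x}"] by (simp add: set_integrable_def)
      have "(LINT s|lborel. ?k x s) = D' x * (LINT s:{0..x}|lborel. G s)"
        unfolding set_lebesgue_integral_def Bochner_Integration.integral_mult_right_zero[symmetric]
      proof (rule integral_cong_AE)
        show "AE s in lborel. ?k x s = D' x * (indicat_real {0..x} s *\<^sub>R G s)"
          using AE_lborel_singleton[of "0::real"]
          by eventually_elim (use True in \<open>auto simp: G'_def indicator_def\<close>)
      qed measurable
      also have "\<dots> = D' x * integral {0..x} G"
        using set_borel_integral_eq_integral(2)[OF si] by simp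
      finally show ?thesis using True by (simp add: D'_def algebra_simps)
    qed (auto simp: D'_def)
  qed
  also have "\<dots> = c * (LINT x|lborel. D' x) + (LINT x|lborel. LINT s|lborel. ?k x s)"
    using int1 lborel_pair.integrable_fst[OF prod] by (subst Bochner_Integration.integral_add) auto
  also have "(LINT x|lborel. D' x) = (LINT x|lborel. indicator {0..1} x * deriv \<phi> x)"
    using ab by (intro Bochner_Integration.integral_cong refl) (force simp: D'_def indicator_def dest: zD')
  also have "\<dots> = 0" using FTC[of 0] \<phi>1 by simp
  also have "(LINT x|lborel. LINT s|lborel. ?k x s)
     = (LINT s|lborel. LINT x|lborel. ?k x s)"
    using lborel_pair.Fubini_integral[OF prod] by simp
  also have "\<dots> = (LINT s|lborel. - (indicator {0<..<1} s * G s * \<phi> s))"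
  proof (intro Bochner_Integration.integral_cong refl)
    fix s :: real
    show "(LINT x|lborel. ?k x s) = - (indicator {0<..<1} s * G s * \<phi> s)"
    proof (cases "0 < s \<and> s < 1")
      case True
      have "(LINT x|lborel. ?k x s)
          = (LINT x|lborel. G' s * (indicator {s..1} x * deriv \<phi> x))"
        using True ab by (intro Bochner_Integration.integral_cong refl) (force simp: D'_def indicator_def dest: zD')
      then show ?thesis using True FTC[of s] by (simp add: G'_def)
    qed (auto simp: G'_def)
  qed
  finally show ?thesis by (simp add: mult.assoc)
qed

section \<open>Bump functions and the lemma of du Bois-Reymond\<close>

lemma bump_tendsto_indicator:
  fixes r :: real
  assumes "0 \<le> r"
  shows "(\<lambda>k. real k * r / (1 + real k * r)) \<longlonglongrightarrow> (if r = 0 then 0 else 1)"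
proof (cases "r = 0")
  case False
  then have r: "0 < r" using assms by simp
  have "(\<lambda>k. inverse (real (Suc k))) \<longlonglongrightarrow> 0" by (rule LIMSEQ_inverse_real_of_nat)
  then have "(\<lambda>k. r / (inverse (real (Suc k)) + r)) \<longlonglongrightarrow> r / (0 + r)"
    using r by (intro tendsto_intros) auto
  moreover have "r / (inverse (real (Suc k)) + r) = real (Suc k) * r / (1 + real (Suc k) * r)" for k
  proof -
    have "0 < 1 + real (Suc k) * r" "0 < inverse (real (Suc k)) + r" using r by (auto intro!: add_pos_pos)
    then show ?thesis by (simp add: field_simps)
  qed
  ultimately have "(\<lambda>k. real (Suc k) * r / (1 + real (Suc k) * r)) \<longlonglongrightarrow> 1"
    using r by simp
  then show ?thesis using False LIMSEQ_imp_Suc[of "\<lambda>k. real k * r / (1 + real k * r)" 1] by simp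
qed auto

lemma bump_bounds:
  fixes r :: real
  assumes "0 \<le> r"
  shows "0 \<le> real k * r / (1 + real k * r)" "real k * r / (1 + real k * r) \<le> 1" "0 < 1 + real k * r"
proof -
  show *: "0 < 1 + real k * r" using assms by (intro add_pos_nonneg) auto
  then show "0 \<le> real k * r / (1 + real k * r)" "real k * r / (1 + real k * r) \<le> 1"
    using assms by (auto simp: divide_le_eq_1)
qed

lemma integral_tendsto_bump:
  fixes U :: "real \<Rightarrow> real" and \<rho> :: "nat \<Rightarrow> real \<Rightarrow> real"
  assumes U: "integrable lborel U" and [measurable]: "\<And>k. \<rho> k \<in> borel_measurable borel"
    and bd: "\<And>k x. \<bar>\<rho> k x\<bar> \<le> 1" and lim: "\<And>x. (\<lambda>k. \<rho> k x) \<longlonglongrightarrow> indicator {a<..<b} x"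
  shows "(\<lambda>k. LINT x|lborel. U x * \<rho> k x) \<longlonglongrightarrow> integral {a..b} U"
proof -
  have [measurable]: "U \<in> borel_measurable borel" using U by auto
  have "(\<lambda>k. LINT x|lborel. U x * \<rho> k x) \<longlonglongrightarrow> (LINT x|lborel. U x * indicator {a<..<b} x)"
  proof (rule integral_dominated_convergence[where w = "\<lambda>x. \<bar>U x\<bar>"])
    show "AE x in lborel. norm (U x * \<rho> k x) \<le> \<bar>U x\<bar>" for k
      using mult_left_mono[OF bd abs_ge_zero] by (auto simp: abs_mult intro!: AE_I2)
    show "AE x in lborel. (\<lambda>k. U x * \<rho> k x) \<longlonglongrightarrow> U x * indicator {a<..<b} x"
      by (intro AE_I2 tendsto_mult tendsto_const lim)
  qed (use U in auto)
  moreover have si: "set_integrable lborel {a<..<b} U"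
    using integrable_mult_indicator[OF _ U, of "{a<..<b}"] by (simp add: set_integrable_def)
  moreover have "(LINT x|lborel. U x * indicator {a<..<b} x) = integral {a..b} U"
    using set_borel_integral_eq_integral(2)[OF si] integral_open_interval_real[of a b U]
    by (simp add: set_lebesgue_integral_def mult.commute)
  ultimately show ?thesis by simp
qed

text \<open>The test function should have the derivative 1 on one interval and -1 on the other. Both
  have length h, so the total mass is zero and its primitive has compact support; continuous bumps
  approximate the two indicators.\<close>

lemma du_Bois_Reymond_aux:
  fixes U :: "real \<Rightarrow> real"
  assumes U: "integrable lborel U"
    and test: "\<And>\<phi>. test_function \<phi> \<Longrightarrow> (LINT x|lborel. U x * deriv \<phi> x) = 0"
    and ab: "0 < a" "a < b" "b + h < 1" and h: "0 < h"
  shows "integral {a..a + h} U = integral {b..b + h} U"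
proof -
  define r where "r t = max 0 t * max 0 (h - t)" for t :: real
  have r0: "0 \<le> r t" for t by (simp add: r_def)
  have rz: "r t = 0 \<longleftrightarrow> t \<notin> {0<..<h}" for t by (auto simp: r_def max_def)
  \<comment> \<open>With r positive exactly on (0, h), the quotient k r / (1 + k r) tends to 1
    there, is 0 elsewhere and never exceeds 1. Continuity is enough, since it serves only as the
    derivative of a test function.\<close>
  define \<rho> where "\<rho> k t = real k * r t / (1 + real k * r t)" for k t
  have c\<rho>: "continuous_on UNIV (\<rho> k)" for k
    unfolding \<rho>_def r_def using bump_bounds(3)[OF r0, of k]
    by (intro continuous_intros) (auto simp: r_def less_imp_neq[symmetric])
  have [measurable]: "\<rho> k \<in> borel_measurable borel" for k
    by (rule borel_measurable_continuous_onI[OF c\<rho>])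
  have \<rho>z: "\<rho> k t = 0" if "t \<notin> {0<..<h}" for k t using rz[of t] that by (simp add: \<rho>_def)
  have \<rho>1: "\<bar>\<rho> k t\<bar> \<le> 1" for k t
    using bump_bounds(1,2)[OF r0[of t], of k] unfolding \<rho>_def by (simp only: abs_of_nonneg)
  have \<rho>lim: "(\<lambda>k. \<rho> k (x - c)) \<longlonglongrightarrow> indicator {c<..<c + h} x" for x c
    using bump_tendsto_indicator[OF r0[of "x - c"]] rz[of "x - c"]
    by (cases "r (x - c) = 0") (auto simp: \<rho>_def indicator_def)
  have eq: "(LINT x|lborel. U x * \<rho> k (x - a)) = (LINT x|lborel. U x * \<rho> k (x - b))" for k
  proof -
    have "\<exists>R. \<forall>x. - \<infinity> < ereal x \<longrightarrow> ereal x < \<infinity> \<longrightarrow> (R has_vector_derivative \<rho> k x) (at x)"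
      using c\<rho>[of k] by (intro einterval_antiderivative) (auto simp: continuous_on_eq_continuous_at)
    then obtain R where R: "\<And>x. (R has_real_derivative \<rho> k x) (at x)"
      by (auto simp: has_real_derivative_iff_has_vector_derivative)
    have R0: "R x = R 0" if "x \<le> 0" for x
    proof (cases "x = 0")
      case False
      then have "x < 0" using that by simp
      with MVT2[OF this, of R "\<rho> k"] R obtain z where "x < z" "z < 0" "R 0 - R x = (0 - x) * \<rho> k z" by blast
      then show ?thesis using \<rho>z[of z k] by simp
    qed simp
    have Rh: "R x = R h" if "h \<le> x" for x
    proof (cases "x = h")
      case False
      then have "h < x" using that by simp
      with MVT2[OF this, of R "\<rho> k"] R obtain z where "h < z" "z < x" "R x - R h = (x - h) * \<rho> k z" by blast
      then show ?thesis using \<rho>z[of z k] by simp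
    qed simp
    \<comment> \<open>R is constant on each side of (0, h), so the two shifted copies cancel to the
      left of a and to the right of b + h.\<close>
    define \<phi> where "\<phi> x = R (x - a) - R (x - b)" for x
    have d\<phi>: "(\<phi> has_real_derivative \<rho> k (x - a) - \<rho> k (x - b)) (at x)" for x
      unfolding \<phi>_def by (rule derivative_eq_intros DERIV_chain2[OF R] refl | simp)+
    have "test_function \<phi>"
      unfolding test_function_def
    proof (intro conjI exI allI impI)
      show "\<phi> C1_differentiable_on UNIV"
        unfolding C1_differentiable_on_def
        by (intro exI[of _ "\<lambda>x. \<rho> k (x - a) - \<rho> k (x - b)"] conjI ballI)
          (use d\<phi> in \<open>auto simp: has_real_derivative_iff_has_vector_derivative
            intro!: continuous_intros continuous_on_compose2[OF c\<rho>]\<close>)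
      show "0 < a" "b + h < 1" using ab by auto
      fix x assume "x \<notin> {a..b + h}"
      then have "x < a \<or> b + h < x" by auto
      then show "\<phi> x = 0"
        using R0[of "x - a"] R0[of "x - b"] Rh[of "x - a"] Rh[of "x - b"] ab by (auto simp: \<phi>_def)
    qed
    from test[OF this] have "(LINT x|lborel. U x * (\<rho> k (x - a) - \<rho> k (x - b))) = 0"
      using DERIV_imp_deriv[OF d\<phi>] by simp
    moreover have "integrable lborel (\<lambda>x. U x * \<rho> k (x - c))" for c
      by (rule integrable_mult_bounded_continuous[OF U _ \<rho>1])
        (auto intro!: continuous_intros continuous_on_compose2[OF c\<rho>])
    ultimately show ?thesis by (simp add: right_diff_distrib)
  qed
  have "(\<lambda>k. LINT x|lborel. U x * \<rho> k (x - c)) \<longlonglongrightarrow> integral {c..c + h} U" for c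
    by (rule integral_tendsto_bump[OF U _ \<rho>1 \<rho>lim]) measurable
  from LIMSEQ_unique[OF this[of a]] this[of b] show ?thesis unfolding eq by simp
qed

lemma AE_lborel_Ex:
  assumes ab: "a < (b::real)" and ae: "AE x in lborel. Q x"
  shows "\<exists>x. a < x \<and> x < b \<and> Q x"
proof (rule ccontr)
  assume "\<not> ?thesis"
  then have "AE x in lborel. x \<notin> {a<..<b}"
    using ae by (auto elim!: eventually_mono)
  then have "{a<..<b} \<in> null_sets lborel"
    by (subst AE_iff_null_sets) auto
  with ab show False by (auto simp: null_sets_def)
qed

lemma integrable_imp_integrable_on:
  fixes U :: "real \<Rightarrow> real"
  assumes "integrable lborel U"
  shows "U integrable_on {a..b}"
  using integrable_mult_indicator[OF _ assms, of "{a..b}"]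
  by (intro set_borel_integral_eq_integral(1)) (simp add: set_integrable_def)

text \<open>U has the same integral over any two intervals of length h inside (0, 1). Dividing by h
  and letting h tend to 0 at Lebesgue points, with one such point x0 fixed, shows U x = U
  x0.\<close>

lemma du_Bois_Reymond:
  fixes U :: "real \<Rightarrow> real"
  assumes U: "integrable lborel U"
    and test: "\<And>\<phi>. test_function \<phi> \<Longrightarrow> (LINT x|lborel. U x * deriv \<phi> x) = 0"
  shows "\<exists>c. AE x in lborel. 0 < x \<and> x < 1 \<longrightarrow> U x = c"
proof -
  have shift: "integral {a..a + h} U = integral {b..b + h} U"
    if "0 < a" "a + h < 1" "0 < b" "b + h < 1" "0 < h" for a b h
    using du_Bois_Reymond_aux[OF U test, of a b h] du_Bois_Reymond_aux[OF U test, of b a h] that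
    by (cases a b rule: linorder_cases) auto
  have ae: "AE x in lborel. ((\<lambda>h. integral {x..x + h} U / h) \<longlongrightarrow> U x) (at_right 0)"
    by (intro lebesgue_differentiation integrable_imp_integrable_on U)
  from AE_lborel_Ex[OF _ this, of 0 1] obtain x0 where x0: "0 < x0" "x0 < 1"
    "((\<lambda>h. integral {x0..x0 + h} U / h) \<longlongrightarrow> U x0) (at_right 0)" by auto
  have "AE x in lborel. 0 < x \<and> x < 1 \<longrightarrow> U x = U x0"
    using ae
  proof eventually_elim
    case (elim x)
    show ?case
    proof
      assume x: "0 < x \<and> x < 1"
      have "eventually (\<lambda>h. h < 1 - x) (at_right (0::real))" "eventually (\<lambda>h. h < 1 - x0) (at_right (0::real))"
        using x x0 by (auto intro!: order_tendstoD(2)[of _ 0])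
      then have "eventually (\<lambda>h. integral {x..x + h} U / h = integral {x0..x0 + h} U / h) (at_right 0)"
        using eventually_at_right_less[of 0]
        by eventually_elim (use x x0 in \<open>auto intro!: arg_cong2[where f = "(/)"] shift\<close>)
      from Lim_transform_eventually[OF elim this] x0(3) show "U x = U x0"
        by (intro tendsto_unique[OF trivial_limit_at_right_real])
    qed
  qed
  then show ?thesis by blast
qed

text \<open>The square of the positive part is of class C^1, unlike the positive part itself; it is
  the building block of the test functions below.\<close>

lemma DERIV_max_0_power2: "((\<lambda>t. (max 0 t)\<^sup>2) has_real_derivative 2 * max 0 t) (at t)" for t :: real
proof (cases t "0::real" rule: linorder_cases)
  case less
  have "((\<lambda>_. 0) has_real_derivative 0) (at t)" by simp
  then have "((\<lambda>t. (max 0 t)\<^sup>2) has_real_derivative 0) (at t)"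
    by (rule has_field_derivative_transform_within_open[where S = "{..<0}"]) (use less in auto)
  then show ?thesis using less by simp
next
  case equal
  have "((\<lambda>h. (max 0 h)\<^sup>2 / h) \<longlongrightarrow> 0) (at (0::real))"
  proof (rule Lim_null_comparison)
    show "\<forall>\<^sub>F h in at 0. norm ((max 0 h)\<^sup>2 / h) \<le> \<bar>h::real\<bar>"
      by (auto simp: eventually_at_filter max_def power2_eq_square)
  qed (auto intro!: tendsto_eq_intros)
  then show ?thesis using equal by (simp add: DERIV_def)
next
  case greater
  have "((\<lambda>t. t\<^sup>2) has_real_derivative 2 * t) (at t)" by (auto intro!: derivative_eq_intros)
  then have "((\<lambda>t. (max 0 t)\<^sup>2) has_real_derivative 2 * t) (at t)"
    by (rule has_field_derivative_transform_within_open[where S = "{0<..}"]) (use greater in auto)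
  then show ?thesis using greater by simp
qed

text \<open>Here the bumps are themselves the test functions, and they converge boundedly to the
  indicator of (a, b).\<close>

lemma integral_zero_of_test_functions:
  fixes G :: "real \<Rightarrow> real"
  assumes G: "set_integrable lborel {a..b} G" and ab: "0 < a" "b < 1"
    and test: "\<And>\<phi>. test_function \<phi> \<Longrightarrow> (LINT x|lborel. indicator {0<..<1} x * G x * \<phi> x) = 0"
  shows "integral {a..b} G = 0"
proof -
  \<comment> \<open>In contrast to the previous bumps these must be differentiable, hence the
    squared positive parts.\<close>
  define q :: "real \<Rightarrow> real" where "q t = (max 0 t)\<^sup>2" for t
  define r where "r x = q (x - a) * q (b - x)" for x
  have r0: "0 \<le> r t" for t by (simp add: r_def q_def)
  have rz: "r t = 0 \<longleftrightarrow> t \<notin> {a<..<b}" for t by (auto simp: r_def q_def max_def)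
  define \<phi> where "\<phi> k x = real k * r x / (1 + real k * r x)" for k x
  define r' where "r' x = 2 * max 0 (x - a) * q (b - x) + q (x - a) * (2 * max 0 (b - x) * (-1))" for x
  have q: "(q has_real_derivative 2 * max 0 t) (at t)" for t
    unfolding q_def[abs_def] by (rule DERIV_max_0_power2)
  have dr: "(r has_real_derivative r' x) (at x)" for x
    unfolding r_def[abs_def] r'_def
    by (rule derivative_eq_intros DERIV_chain2[OF q] refl | simp add: algebra_simps)+
  have cq: "continuous_on UNIV q" unfolding q_def by (intro continuous_intros)
  have cr: "continuous_on UNIV r" "continuous_on UNIV r'"
    unfolding r_def r'_def by (intro continuous_intros continuous_on_compose2[OF cq]; auto)+
  have pos: "1 + real k * r x \<noteq> 0" for k x using bump_bounds(3)[OF r0, of k x] by simp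
  have d\<phi>: "(\<phi> k has_real_derivative real k * r' x / (1 + real k * r x)\<^sup>2) (at x)" for k x
    unfolding \<phi>_def[abs_def]
    by (rule derivative_eq_intros dr refl pos | simp add: power2_eq_square algebra_simps)+
  have test\<phi>: "test_function (\<phi> k)" for k
    unfolding test_function_def
  proof (intro conjI exI allI impI)
    show "\<phi> k C1_differentiable_on UNIV"
      unfolding C1_differentiable_on_def
      by (intro exI[of _ "\<lambda>x. real k * r' x / (1 + real k * r x)\<^sup>2"] conjI ballI)
        (use d\<phi> pos in \<open>auto simp: has_real_derivative_iff_has_vector_derivative intro!: continuous_intros cr\<close>)
    fix x assume "x \<notin> {a..b}"
    then have "r x = 0" using rz[of x] by auto
    then show "\<phi> k x = 0" by (simp add: \<phi>_def)
  qed (use ab in auto)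
  have [measurable]: "\<phi> k \<in> borel_measurable borel" for k
    unfolding \<phi>_def using borel_measurable_continuous_onI[OF cr(1)] by measurable
  define U where "U x = indicator {a..b} x * G x" for x
  have U: "integrable lborel U" using G by (simp add: set_integrable_def U_def[abs_def])
  have "(LINT x|lborel. U x * \<phi> k x) = 0" for k
  proof -
    have "(LINT x|lborel. U x * \<phi> k x) = (LINT x|lborel. indicator {0<..<1} x * G x * \<phi> k x)"
    proof (intro Bochner_Integration.integral_cong refl)
      fix x show "U x * \<phi> k x = indicator {0<..<1} x * G x * \<phi> k x"
        using ab rz[of x] by (cases "x \<in> {a<..<b}") (auto simp: U_def \<phi>_def indicator_def)
    qed
    then show ?thesis using test[OF test\<phi>] by simp
  qed
  moreover have "(\<lambda>k. LINT x|lborel. U x * \<phi> k x) \<longlonglongrightarrow> integral {a..b} U"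
  proof (rule integral_tendsto_bump[OF U])
    show "\<bar>\<phi> k x\<bar> \<le> 1" for k x using bump_bounds(1,2)[OF r0[of x], of k] unfolding \<phi>_def by (simp only: abs_of_nonneg)
    show "(\<lambda>k. \<phi> k x) \<longlonglongrightarrow> indicator {a<..<b} x" for x
      using bump_tendsto_indicator[OF r0[of x]] rz[of x] by (cases "r x = 0") (auto simp: \<phi>_def indicator_def)
  qed measurable
  ultimately have "integral {a..b} U = 0" by (simp add: LIMSEQ_const_iff)
  moreover have "integral {a..b} U = integral {a..b} G"
    by (intro integral_cong) (auto simp: U_def)
  ultimately show ?thesis by simp
qed

text \<open>Lebesgue differentiation recovers G from its integrals. As G is only locally integrable,
  it is cut off to compact subintervals exhausting (0, 1), and countably many null sets are
  collected.\<close>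

lemma AE_zero_of_integrals:
  fixes G :: "real \<Rightarrow> real"
  assumes int: "\<And>a b. 0 < a \<Longrightarrow> b < 1 \<Longrightarrow> set_integrable lborel {a..b} G"
    and z: "\<And>a b. 0 < a \<Longrightarrow> b < 1 \<Longrightarrow> integral {a..b} G = 0"
  shows "AE x in lborel. 0 < x \<and> x < 1 \<longrightarrow> G x = 0"
proof -
  define d where "d n = inverse (real (Suc n))" for n
  have "AE x in lborel. d n < x \<and> x < 1 - d n \<longrightarrow> G x = 0" for n
  proof -
    define U where "U x = indicator {d n..1 - d n} x * G x" for x
    have "integrable lborel U"
      using int[of "d n" "1 - d n"] by (simp add: set_integrable_def U_def[abs_def] d_def)
    then have "AE x in lborel. ((\<lambda>h. integral {x..x + h} U / h) \<longlongrightarrow> U x) (at_right 0)"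
      by (intro lebesgue_differentiation integrable_imp_integrable_on)
    then show ?thesis
    proof eventually_elim
      case (elim x)
      show ?case
      proof
        assume x: "d n < x \<and> x < 1 - d n"
        have dn: "0 < d n" by (simp add: d_def)
        have "eventually (\<lambda>h. h < 1 - d n - x) (at_right (0::real))"
          using x by (auto intro!: order_tendstoD(2)[of _ 0])
        then have "eventually (\<lambda>h. integral {x..x + h} U / h = 0) (at_right 0)"
        proof eventually_elim
          case (elim h)
          have "integral {x..x + h} U = integral {x..x + h} G"
            using elim x by (intro integral_cong) (auto simp: U_def)
          then show ?case using z[of x "x + h"] elim x dn by simp
        qed
        from Lim_transform_eventually[OF elim this] have "U x = 0"
          by (intro tendsto_unique[OF trivial_limit_at_right_real _ tendsto_const])
        then show "G x = 0" using x by (simp add: U_def)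
      qed
    qed
  qed
  then have "AE x in lborel. \<forall>n. d n < x \<and> x < 1 - d n \<longrightarrow> G x = 0"
    unfolding AE_all_countable by blast
  then show ?thesis
  proof eventually_elim
    case (elim x)
    show ?case
    proof
      assume x: "0 < x \<and> x < 1"
      then have "0 < min x (1 - x)" by simp
      from reals_Archimedean[OF this] obtain n where "d n < min x (1 - x)" by (auto simp: d_def)
      with elim show "G x = 0" by auto
    qed
  qed
qed

section \<open>Weak derivatives and primitives\<close>

lemma test_integral_integrable:
  assumes G: "\<And>a b. 0 < a \<Longrightarrow> b < 1 \<Longrightarrow> set_integrable lborel {a..b} (zero_ext g)" and \<phi>: "test_function \<phi>"
  shows "integrable lborel (\<lambda>x. zero_ext g x * \<phi> x)"
proof -
  obtain a b K where ab: "0 < a" "b < 1" "\<And>x. x \<notin> {a..b} \<Longrightarrow> \<phi> x = 0"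
    and c: "continuous_on UNIV \<phi>" and K: "\<And>x. \<bar>\<phi> x\<bar> \<le> K"
    using test_function_deriv[OF \<phi>] by metis
  have "integrable lborel (\<lambda>x. indicator {a..b} x * zero_ext g x)"
    using G[OF ab(1,2)] by (simp add: set_integrable_def)
  from integrable_mult_bounded_continuous[OF this c K]
  have "integrable lborel (\<lambda>x. indicator {a..b} x * zero_ext g x * \<phi> x)" .
  moreover have "(\<lambda>x. indicator {a..b} x * zero_ext g x * \<phi> x) = (\<lambda>x. zero_ext g x * \<phi> x)"
    using ab(3) by (auto simp: indicator_def fun_eq_iff)
  ultimately show ?thesis by simp
qed

lemma has_weak_deriv_iff:
  "has_weak_deriv f g \<longleftrightarrow>
     (\<forall>a b. 0 < a \<and> b < 1 \<longrightarrow> set_integrable lborel {a..b} (zero_ext f)) \<and>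
     (\<forall>a b. 0 < a \<and> b < 1 \<longrightarrow> set_integrable lborel {a..b} (zero_ext g)) \<and>
     (\<forall>\<phi>. test_function \<phi> \<longrightarrow>
        (LINT x|lborel. zero_ext f x * deriv \<phi> x) = - (LINT x|lborel. zero_ext g x * \<phi> x))"
proof -
  have "(LINT x|unit_interval. rep_l0 f x * \<psi> x) = (LINT x|lborel. zero_ext f x * \<psi> x)" for f \<psi>
    unfolding integral_unit_interval
    by (intro Bochner_Integration.integral_cong refl) (auto simp: zero_ext_def indicator_def)
  then show ?thesis
    unfolding has_weak_deriv_def weak_derivative_fun_def loc_integrable_iff
    by (simp add: set_integrable_zero_ext_iff cong: imp_cong conj_cong)
qed

text \<open>The difference of two candidates annihilates all test functions, so its integral over
  each compact subinterval vanishes. This makes the definite description in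
  \<open>weak_deriv\<close> meaningful.\<close>

lemma weak_deriv_unique:
  assumes "has_weak_deriv f g" "has_weak_deriv f g'"
  shows "g = g'"
proof (rule l0_eqI)
  have int: "set_integrable lborel {a..b} (zero_ext g)" "set_integrable lborel {a..b} (zero_ext g')"
    if "0 < a" "b < 1" for a b
    using assms that by (auto simp: has_weak_deriv_iff)
  define G where "G x = zero_ext g x - zero_ext g' x" for x
  have intG: "set_integrable lborel {a..b} G" if "0 < a" "b < 1" for a b
    unfolding G_def by (intro set_integral_diff int that)
  have "(LINT x|lborel. indicator {0<..<1} x * G x * \<phi> x) = 0" if \<phi>: "test_function \<phi>" for \<phi>
  proof -
    have "(LINT x|lborel. indicator {0<..<1} x * G x * \<phi> x)
      = (LINT x|lborel. zero_ext g x * \<phi> x - zero_ext g' x * \<phi> x)"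
      by (intro Bochner_Integration.integral_cong refl)
        (auto simp: G_def zero_ext_def indicator_def algebra_simps)
    also have "\<dots> = (LINT x|lborel. zero_ext g x * \<phi> x) - (LINT x|lborel. zero_ext g' x * \<phi> x)"
      using int by (intro Bochner_Integration.integral_diff test_integral_integrable \<phi>)
    also have "\<dots> = 0"
      using assms \<phi> by (auto simp: has_weak_deriv_iff)
    finally show ?thesis .
  qed
  then have "integral {a..b} G = 0" if "0 < a" "b < 1" for a b
    using that by (intro integral_zero_of_test_functions intG)
  from AE_zero_of_integrals[OF intG this]
  show "AE x in lborel. 0 < x \<and> x < 1 \<longrightarrow> zero_ext g x = zero_ext g' x"
    by (simp add: G_def)
qed

lemma weak_deriv_eq: "has_weak_deriv f g \<Longrightarrow> weak_deriv f = g"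
  unfolding weak_deriv_def using weak_deriv_unique by blast

text \<open>A primitive has the right weak derivative by parts. Conversely, f minus the primitive V
  of g has zero weak derivative and so is constant by du Bois-Reymond.\<close>

lemma has_weak_deriv_iff_primitive:
  assumes f: "integrable lborel (zero_ext f)" and g: "integrable lborel (zero_ext g)"
  shows "has_weak_deriv f g \<longleftrightarrow>
    (\<exists>c. AE x in lborel. 0 < x \<and> x < 1 \<longrightarrow> zero_ext f x = c + integral {0..x} (zero_ext g))"
proof -
  let ?F = "zero_ext f" and ?G = "zero_ext g"
  have si: "set_integrable lborel {a..b} (zero_ext u)" if "integrable lborel (zero_ext u)" for u a b
    using integrable_mult_indicator[OF _ that, of "{a..b}"] by (simp add: set_integrable_def)
  have G1: "(LINT x|lborel. indicator {0<..<1} x * ?G x * \<phi> x) = (LINT x|lborel. ?G x * \<phi> x)" for \<phi> :: "real \<Rightarrow> real"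
    by (intro Bochner_Integration.integral_cong refl) (auto simp: zero_ext_def indicator_def)
  have cV: "continuous_on {0..1} (\<lambda>x. integral {0..x} ?G)"
    using g by (intro indefinite_integral_continuous_1 integrable_imp_integrable_on)
  \<comment> \<open>The primitive is cut off outside (0, 1) because it does not decay there, while
    integrability on the whole line is used below.\<close>
  define V where "V x = indicator {0<..<1} x * integral {0..x} ?G" for x
  have V: "integrable lborel V"
  proof -
    have "set_integrable lborel {0..1} (\<lambda>x. integral {0..x} ?G)"
      unfolding set_integrable_def using borel_integrable_compact[OF compact_Icc cV] by simp
    then have "set_integrable lborel {0<..<1} (\<lambda>x. integral {0..x} ?G)"
      by (rule set_integrable_subset) auto
    then show ?thesis by (simp add: set_integrable_def V_def[abs_def])
  qed
  have [measurable]: "V \<in> borel_measurable borel" using V by auto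
  show ?thesis
  proof
    assume "\<exists>c. AE x in lborel. 0 < x \<and> x < 1 \<longrightarrow> ?F x = c + integral {0..x} ?G"
    then obtain c where c: "AE x in lborel. 0 < x \<and> x < 1 \<longrightarrow> ?F x = c + integral {0..x} ?G" by auto
    have "(LINT x|lborel. ?F x * deriv \<phi> x) = - (LINT x|lborel. ?G x * \<phi> x)" if \<phi>: "test_function \<phi>" for \<phi>
    proof -
      have [measurable]: "deriv \<phi> \<in> borel_measurable borel"
        using test_function_deriv[OF \<phi>] borel_measurable_continuous_onI by metis
      have "(LINT x|lborel. ?F x * deriv \<phi> x)
          = (LINT x|lborel. (c * indicator {0<..<1} x + V x) * deriv \<phi> x)"
      proof (rule integral_cong_AE)
        show "AE x in lborel. ?F x * deriv \<phi> x = (c * indicator {0<..<1} x + V x) * deriv \<phi> x"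
          using c by eventually_elim (auto simp: V_def indicator_def zero_ext_outside)
      qed measurable
      also have "\<dots> = (LINT x|lborel. indicator {0<..<1} x * (c + integral {0..x} ?G) * deriv \<phi> x)"
        by (intro Bochner_Integration.integral_cong refl) (auto simp: V_def indicator_def)
      finally show ?thesis using primitive_test_integral[OF g \<phi>, of c] G1[of \<phi>] by simp
    qed
    then show "has_weak_deriv f g"
      unfolding has_weak_deriv_iff using si f g by auto
  next
    assume w: "has_weak_deriv f g"
    define U where "U x = ?F x - V x" for x
    have U: "integrable lborel U" unfolding U_def[abs_def] using f V by auto
    have "(LINT x|lborel. U x * deriv \<phi> x) = 0" if \<phi>: "test_function \<phi>" for \<phi>
    proof -
      obtain K where cd: "continuous_on UNIV (deriv \<phi>)" and K: "\<And>x. \<bar>deriv \<phi> x\<bar> \<le> K"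
        using test_function_deriv[OF \<phi>] by metis
      have "(LINT x|lborel. U x * deriv \<phi> x) = (LINT x|lborel. ?F x * deriv \<phi> x) - (LINT x|lborel. V x * deriv \<phi> x)"
        unfolding U_def left_diff_distrib
        by (intro Bochner_Integration.integral_diff integrable_mult_bounded_continuous[OF _ cd K] f V)
      also have "(LINT x|lborel. V x * deriv \<phi> x)
          = (LINT x|lborel. indicator {0<..<1} x * (0 + integral {0..x} ?G) * deriv \<phi> x)"
        by (simp add: V_def)
      also have "\<dots> = - (LINT x|lborel. ?G x * \<phi> x)"
        unfolding primitive_test_integral[OF g \<phi>, of 0] G1 ..
      finally show ?thesis using w \<phi> by (simp add: has_weak_deriv_iff)
    qed
    from du_Bois_Reymond[OF U this] obtain c where "AE x in lborel. 0 < x \<and> x < 1 \<longrightarrow> U x = c" by auto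
    then show "\<exists>c. AE x in lborel. 0 < x \<and> x < 1 \<longrightarrow> ?F x = c + integral {0..x} ?G"
      by (intro exI[of _ c]) (auto simp: U_def V_def elim!: eventually_mono)
  qed
qed

section \<open>The unfolded flow\<close>

lemma AE_lborel_affine:
  fixes Q :: "real \<Rightarrow> bool"
  assumes c: "c \<noteq> 0" and ae: "AE x in lborel. Q x"
  shows "AE x in lborel. Q (t + c * x)"
proof -
  from ae obtain N where N: "N \<in> sets lborel" "emeasure lborel N = 0" "{x. \<not> Q x} \<subseteq> N"
    by (auto elim: AE_E)
  have [measurable]: "N \<in> sets borel" using N by simp
  have "AE x in lborel. x \<notin> N" using N by (intro AE_not_in) auto
  then have "AE x in lborel. t + c * x \<notin> N"
    by (intro AE_borel_affine[OF c]) auto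
  then show ?thesis by eventually_elim (use N in auto)
qed

lemma AE_lborel_not_Ints: "AE x in lborel. x \<notin> (\<int> :: real set)"
  by (intro AE_not_in countable_imp_null_set_lborel countable_int)

definition normalized :: "'n set \<Rightarrow> l0 ^ 'n \<Rightarrow> real \<Rightarrow> real ^ 'n" where
  "normalized P f y = (\<chi> i. zero_ext (f $ i) (if i \<in> P then y else 1 - y))"

text \<open>For z < 1 the exponent counts how often the flow has crossed the boundary. For z at
  least 1 \<open>nat\<close> makes it 0; those values have no meaning for the flow and are excluded
  by z < 1 or by an indicator.\<close>

definition extension :: "real ^ 'n ^ 'n \<Rightarrow> (real \<Rightarrow> real ^ 'n) \<Rightarrow> real \<Rightarrow> real ^ 'n" where
  "extension B u z = matrix_power B (nat (- \<lfloor>z\<rfloor>)) *v u (frac z)"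

lemma extension_unit: "0 < z \<Longrightarrow> z < 1 \<Longrightarrow> extension B u z = u z"
proof -
  assume "0 < z" "z < 1"
  then have "\<lfloor>z\<rfloor> = 0" by linarith
  then show ?thesis by (simp add: extension_def frac_def)
qed

text \<open>The boundary condition in unfolded form: each unit to the left costs one factor
  B.\<close>

lemma extension_neg:
  assumes "z < 0"
  shows "extension B u z = B *v extension B u (z + 1)"
proof -
  have "\<lfloor>z\<rfloor> < 0" "\<lfloor>z + 1\<rfloor> = \<lfloor>z\<rfloor> + 1" using assms by linarith+
  then have "nat (- \<lfloor>z\<rfloor>) = Suc (nat (- \<lfloor>z + 1\<rfloor>))" by linarith
  then show ?thesis by (simp add: extension_def matrix_vector_mul_assoc frac_def)
qed

lemma extension_power:
  "w + real n < 1 \<Longrightarrow> extension B u w = matrix_power B n *v extension B u (w + real n)"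
proof (induction n arbitrary: w)
  case (Suc n)
  then have "extension B u w = B *v extension B u (w + 1)" by (intro extension_neg) auto
  also have "extension B u (w + 1) = matrix_power B n *v extension B u (w + 1 + real n)"
    using Suc.prems by (intro Suc.IH) auto
  finally show ?case by (simp add: matrix_vector_mul_assoc add.commute add.left_commute)
qed simp

text \<open>The fractional part of z is z + n and lies below 1, so moving z - t by n to the right
  stays in the admissible range and splits off exactly the n-th power that the outer extension
  applies.\<close>

lemma extension_extension:
  assumes z: "z < 1" and t: "0 \<le> t"
  shows "extension B (\<lambda>y. extension B u (y - t)) z = extension B u (z - t)"
proof -
  define n where "n = nat (- \<lfloor>z\<rfloor>)"
  have "\<lfloor>z\<rfloor> \<le> 0" using z by linarith
  then have f: "frac z = z + real n" by (simp add: frac_def n_def)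
  have "z - t + real n < 1" using frac_lt_1[of z] t f by linarith
  from extension_power[OF this, of B u] show ?thesis
    by (simp add: extension_def[of B _ z] n_def[symmetric] f algebra_simps)
qed

lemma extension_nth: "extension B u z $ i = (\<Sum>j\<in>UNIV. matrix_power B (nat (- \<lfloor>z\<rfloor>)) $ i $ j * u (frac z) $ j)"
  by (simp add: extension_def matrix_vector_mult_def)

lemma extension_measurable:
  assumes [measurable]: "\<And>j. (\<lambda>y. u y $ j) \<in> borel_measurable borel"
  shows "(\<lambda>z. extension B u z $ i) \<in> borel_measurable borel"
proof -
  have [measurable]: "(\<lambda>z. matrix_power B (nat (- \<lfloor>z :: real\<rfloor>)) $ i $ j) \<in> borel_measurable borel" for j
    by (rule measurable_compose[OF measurable_real_floor]) simp
  have [measurable]: "(frac :: real \<Rightarrow> real) \<in> borel_measurable borel"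
    unfolding frac_def[abs_def] by measurable
  show ?thesis unfolding extension_nth by measurable
qed

text \<open>The exceptional set consists of the integers and the integer translates of a null set,
  of which there are countably many.\<close>

lemma extension_cong_AE:
  assumes ae: "AE y in lborel. 0 < y \<and> y < 1 \<longrightarrow> u y = v y"
  shows "AE z in lborel. extension B u z = extension B v z"
proof -
  have "AE z in lborel. 0 < z - of_int k \<and> z - of_int k < 1 \<longrightarrow> u (z - of_int k) = v (z - of_int k)" for k :: int
    using AE_lborel_affine[OF _ ae, of 1 "- of_int k"] by simp
  then have "AE z in lborel. \<forall>k::int. 0 < z - of_int k \<and> z - of_int k < 1 \<longrightarrow> u (z - of_int k) = v (z - of_int k)"
    unfolding AE_all_countable by blast
  then show ?thesis
    using AE_lborel_not_Ints
  proof eventually_elim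
    case (elim z)
    have "0 < frac z" "frac z < 1" using elim(2) by (auto simp: frac_gt_0_iff frac_lt_1)
    then have "u (frac z) = v (frac z)" using elim(1) unfolding frac_def by blast
    then show ?case by (simp add: extension_def)
  qed
qed

lemma extension_add: "extension B (\<lambda>y. u y + v y) z = extension B u z + extension B v z"
  by (simp add: extension_def matrix_vector_right_distrib)

lemma extension_diff: "extension B (\<lambda>y. u y - v y) z = extension B u z - extension B v z"
  by (simp add: extension_def matrix_vector_mult_diff_distrib)

lemma extension_scaleR: "extension B (\<lambda>y. c *\<^sub>R u y) z = c *\<^sub>R extension B u z"
  by (simp add: extension_def matrix_vector_mult_scaleR)

section \<open>The state with all components transported to the right\<close>

lemma normalized_measurable[measurable]: "(\<lambda>y. normalized P f y $ j) \<in> borel_measurable borel"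
  by (cases "j \<in> P") (simp_all add: normalized_def)

lemma normalized_outside: "\<not> (0 < y \<and> y < 1) \<Longrightarrow> normalized P f y = 0"
  by (auto simp: normalized_def vec_eq_iff zero_ext_outside)

lemma AE_reflect:
  fixes Q :: "real \<Rightarrow> bool"
  assumes "AE x in lborel. Q x"
  shows "AE y in lborel. Q (if b then y else 1 - y)"
  using AE_lborel_affine[of "-1" Q 1] assms by (cases b) auto

lemma AE_vec_eqI:
  fixes u v :: "real \<Rightarrow> 'a ^ 'n::finite"
  assumes "\<And>i. AE y in M. R y \<longrightarrow> u y $ i = v y $ i"
  shows "AE y in M. R y \<longrightarrow> u y = v y"
proof -
  have "AE y in M. \<forall>i\<in>UNIV. R y \<longrightarrow> u y $ i = v y $ i"
    using assms by (intro AE_finite_allI) auto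
  then show ?thesis by eventually_elim (auto simp: vec_eq_iff)
qed

text \<open>The reflection of the lower components preserves null sets, so any pointwise operation
  \<Phi> passes through; sums, differences and multiples are instances.\<close>

lemma normalized_op_AE:
  fixes k :: "l0 ^ 'n::finite"
  assumes "\<And>i. AE x in lborel. zero_ext (k $ i) x = \<Phi> (zero_ext (f $ i) x) (zero_ext (g $ i) x)"
  shows "AE y in lborel. normalized P k y = (\<chi> i. \<Phi> (normalized P f y $ i) (normalized P g y $ i))"
proof -
  have "AE y in lborel. True \<longrightarrow> normalized P k y = (\<chi> i. \<Phi> (normalized P f y $ i) (normalized P g y $ i))"
  proof (rule AE_vec_eqI)
    fix i show "AE y in lborel. True \<longrightarrow> normalized P k y $ i = (\<chi> i. \<Phi> (normalized P f y $ i) (normalized P g y $ i)) $ i"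
      using AE_reflect[OF assms[of i], of "i \<in> P"] by (simp add: normalized_def)
  qed
  then show ?thesis by simp
qed

lemma normalized_add: "AE y in lborel. normalized P (f + g) y = normalized P f y + normalized P g y"
  using normalized_op_AE[of "f + g" "(+)" f g P] zero_ext_plus by (auto simp: vec_eq_iff)

lemma normalized_diff: "AE y in lborel. normalized P (f - g) y = normalized P f y - normalized P g y"
  using normalized_op_AE[of "f - g" "(-)" f g P] zero_ext_diff by (auto simp: vec_eq_iff)

lemma normalized_scaleR: "AE y in lborel. normalized P (c *\<^sub>R f) y = c *\<^sub>R normalized P f y"
  using normalized_op_AE[of "c *\<^sub>R f" "\<lambda>a _. c * a" f f P] zero_ext_scaleR by (auto simp: vec_eq_iff)

lemma normalized_eqI:
  assumes "AE y in lborel. 0 < y \<and> y < 1 \<longrightarrow> normalized P f y = normalized P g y"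
  shows "f = g"
  unfolding vec_eq_iff
proof
  fix i
  have "AE y in lborel. 0 < y \<and> y < 1 \<longrightarrow> zero_ext (f $ i) (if i \<in> P then y else 1 - y)
      = zero_ext (g $ i) (if i \<in> P then y else 1 - y)"
    using assms by eventually_elim (auto simp: normalized_def vec_eq_iff)
  from AE_reflect[OF this, of "i \<in> P"]
  have "AE y in lborel. 0 < y \<and> y < 1 \<longrightarrow> zero_ext (f $ i) y = zero_ext (g $ i) y"
    by eventually_elim (auto split: if_splits)
  then show "f $ i = g $ i" by (rule l0_eqI)
qed

lemma normalized_abs:
  assumes "\<And>i. h i \<in> borel_measurable unit_interval"
    and "\<And>i x. 0 < x \<Longrightarrow> x < 1 \<Longrightarrow> Q x \<Longrightarrow> h i x = v (if i \<in> P then x else 1 - x) $ i"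
    and Q: "AE x in lborel. Q x"
  shows "AE y in lborel. 0 < y \<and> y < 1 \<longrightarrow> normalized P (\<chi> i. abs_l0 (h i)) y = v y"
proof (rule AE_vec_eqI)
  fix i
  have "AE x in lborel. 0 < x \<and> x < 1 \<longrightarrow> zero_ext (abs_l0 (h i)) x = v (if i \<in> P then x else 1 - x) $ i"
    using zero_ext_abs[OF assms(1)[of i]] Q by eventually_elim (use assms(2) in auto)
  from AE_reflect[OF this, of "i \<in> P"]
  show "AE y in lborel. 0 < y \<and> y < 1 \<longrightarrow> normalized P (\<chi> i. abs_l0 (h i)) y $ i = v y $ i"
    by eventually_elim (auto simp: normalized_def)
qed

lemma energy_normalized: "energy p (\<lambda>y. normalized P f y $ i) = energy p (zero_ext (f $ i))"
  using energy_affine[of "zero_ext (f $ i)" "-1" p 1]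
  by (cases "i \<in> P") (simp_all add: normalized_def)

lemma Xp_energy_normalized: "Xp_energy p f = (\<Sum>i\<in>UNIV. energy p (\<lambda>y. normalized P f y $ i))"
  by (simp add: Xp_energy_def energy_normalized)

section \<open>The formula for T(t) in terms of the extension\<close>

lemma upper_index_eq:
  assumes y: "0 < y" "y < 1" and t: "0 \<le> t" and yt: "y - t \<notin> \<int>"
  shows "upper_index t y = nat (- \<lfloor>y - t\<rfloor>)"
  unfolding upper_index_def
proof (rule the_equality)
  have le: "\<lfloor>y - t\<rfloor> \<le> 0" using y t by linarith
  have "of_int \<lfloor>y - t\<rfloor> \<noteq> y - t" using yt by (metis Ints_of_int)
  then have "of_int \<lfloor>y - t\<rfloor> < y - t" "y - t < of_int \<lfloor>y - t\<rfloor> + 1"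
    using of_int_floor_le[of "y - t"] floor_correct[of "y - t"] by linarith+
  moreover have "real (nat (- \<lfloor>y - t\<rfloor>)) = - of_int \<lfloor>y - t\<rfloor>"
    using le by simp
  ultimately show "real (nat (- \<lfloor>y - t\<rfloor>)) - 1 + y < t \<and> t < real (nat (- \<lfloor>y - t\<rfloor>)) + y"
    by linarith
next
  fix n assume n: "real n - 1 + y < t \<and> t < real n + y"
  then have "\<lfloor>y - t\<rfloor> = - int n" by (intro floor_unique) auto
  then show "n = nat (- \<lfloor>y - t\<rfloor>)" by simp
qed

text \<open>Reflecting x turns n - x < t < n + 1 - x into the condition of the upper rows, so one
  computation of n serves both.\<close>

lemma lower_index_eq: "lower_index t x = upper_index t (1 - x)"
  unfolding lower_index_def upper_index_def
  by (rule arg_cong[where f = The]) (auto simp: fun_eq_iff)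

text \<open>For a row in R the two padded blocks together form the full row of M, the columns in P
  being fed from u and the others from w.\<close>

lemma block_mult_add:
  fixes M :: "real ^ 'n::finite ^ 'n"
  assumes "i \<in> R"
  shows "(block R P M *v u + block R (- P) M *v w) $ i = (\<Sum>j\<in>UNIV. M $ i $ j * (if j \<in> P then u $ j else w $ j))"
  using assms by (auto simp: block_def matrix_vector_mult_def sum.distrib[symmetric] intro!: sum.cong)

lemma block_mult_zero: "i \<notin> R \<Longrightarrow> (block R C M *v u) $ i = 0"
  by (simp add: block_def matrix_vector_mult_def)

text \<open>In all four blocks the argument is n - t + y for columns in P and its reflection for the
  others, where y is x or 1 - x according to the row. Since n = - floor (y - t), this is the
  fractional part of y - t. The two non-integrality assumptions make n well defined in the upper and
  in the lower row.\<close>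

lemma T_fun_eq:
  fixes P :: "'n::finite set"
  assumes x: "0 < x" "x < 1" and t: "0 \<le> t" and nz: "x - t \<notin> \<int>" "1 - x - t \<notin> \<int>"
  shows "T_fun B P t (\<lambda>y. \<chi> j. rep_l0 (f $ j) y) x $ i
    = extension B (normalized P f) ((if i \<in> P then x else 1 - x) - t) $ i"
proof -
  define y where "y = (if i \<in> P then x else 1 - x)"
  have y: "0 < y" "y < 1" "y - t \<notin> \<int>" using x nz by (auto simp: y_def)
  define n where "n = upper_index t y"
  have n: "n = nat (- \<lfloor>y - t\<rfloor>)" unfolding n_def by (rule upper_index_eq[OF y(1,2) t y(3)])
  have "\<lfloor>y - t\<rfloor> \<le> 0" using y t by linarith
  then have fr: "frac (y - t) = real n - t + y" by (simp add: n frac_def)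
  have fr01: "0 < real n - t + y" "real n - t + y < 1"
    using frac_gt_0_iff[of "y - t"] frac_lt_1[of "y - t"] y(3) by (auto simp: fr)
  let ?u = "\<lambda>y. \<chi> j. rep_l0 (f $ j) y"
  have split: "T_fun B P t ?u x $ i =
      (block P P (matrix_power B (upper_index t x)) *v ?u (real (upper_index t x) - t + x)
        + block P (- P) (matrix_power B (upper_index t x)) *v ?u (1 - real (upper_index t x) + t - x)) $ i
    + (block (- P) P (matrix_power B (lower_index t x)) *v ?u (1 - t + real (lower_index t x) - x)
        + block (- P) (- P) (matrix_power B (lower_index t x)) *v ?u (t - real (lower_index t x) + x)) $ i"
    unfolding T_fun_def Let_def by (simp only: vector_add_component)
  have "T_fun B P t ?u x $ i
    = (\<Sum>j\<in>UNIV. matrix_power B n $ i $ j * (if j \<in> P then rep_l0 (f $ j) (real n - t + y) else rep_l0 (f $ j) (1 - (real n - t + y))))"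
  proof (cases "i \<in> P")
    case True
    then have ny: "upper_index t x = n" "y = x" by (auto simp: n_def y_def)
    show ?thesis
      unfolding split ny block_mult_add[OF True]
      using True by (auto simp: block_mult_zero algebra_simps intro!: sum.cong)
  next
    case False
    then have ny: "lower_index t x = n" "y = 1 - x" by (auto simp: n_def y_def lower_index_eq)
    have i: "i \<in> - P" using False by simp
    show ?thesis
      unfolding split ny block_mult_add[OF i]
      using False by (auto simp: block_mult_zero algebra_simps intro!: sum.cong)
  qed
  also have "\<dots> = extension B (normalized P f) (y - t) $ i"
    using fr01 by (auto simp: extension_nth n[symmetric] fr normalized_def zero_ext_def intro!: sum.cong)
  finally show ?thesis by (simp add: y_def)
qed

lemma T_op_normalized:
  fixes P :: "'n::finite set"
  assumes t: "0 \<le> t"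
  shows "AE y in lborel. 0 < y \<and> y < 1 \<longrightarrow> normalized P (T_op B P t f) y = extension B (normalized P f) (y - t)"
  unfolding T_op_def
proof (rule normalized_abs[where Q = "\<lambda>x. x - t \<notin> \<int> \<and> 1 - x - t \<notin> \<int>"])
  let ?E = "\<lambda>i x. extension B (normalized P f) ((if i \<in> P then x else 1 - x) - t) $ i" and ?U = "\<lambda>i x. T_fun B P t (\<lambda>y. \<chi> j. rep_l0 (f $ j) y) x $ i"
  show "?U i x
      = ?E i x"
    if "0 < x" "x < 1" "x - t \<notin> \<int> \<and> 1 - x - t \<notin> \<int>" for i x
    using T_fun_eq[OF that(1,2) t] that(3) by blast
  have "AE x in lborel. x - t \<notin> \<int>" "AE x in lborel. 1 - x - t \<notin> \<int>"
    using AE_lborel_affine[OF _ AE_lborel_not_Ints, of 1 "- t"] AE_lborel_affine[OF _ AE_lborel_not_Ints, of "-1" "1 - t"]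
    by (simp_all add: algebra_simps)
  then show "AE x in lborel. x - t \<notin> \<int> \<and> 1 - x - t \<notin> \<int>" by eventually_elim auto
  fix i
  \<comment> \<open>At these points the definite description for n may be unspecified. They are
    countable, so the formula is still measurable; without measurability nothing would be known
    about its class under \<open>abs_l0\<close>.\<close>
  let ?X = "({x. x - t \<in> \<int>} \<union> {x. 1 - x - t \<in> \<int>}) \<inter> {0<..<1}"
  have sp: "space unit_interval = {0<..<1}" by (simp add: unit_interval_def)
  have "countable {x. x - t \<in> (\<int> :: real set)}"
  proof (rule countable_subset[OF _ countable_image[OF countable_int, of "\<lambda>k. k + t"]])
    show "{x. x - t \<in> \<int>} \<subseteq> (\<lambda>k. k + t) ` \<int>"
    proof
      fix x assume "x \<in> {x. x - t \<in> (\<int> :: real set)}"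
      then show "x \<in> (\<lambda>k. k + t) ` \<int>" by (intro image_eqI[of _ _ "x - t"]) auto
    qed
  qed
  moreover have "countable {x. 1 - x - t \<in> (\<int> :: real set)}"
  proof (rule countable_subset[OF _ countable_image[OF countable_int, of "\<lambda>k. 1 - t - k"]])
    show "{x. 1 - x - t \<in> \<int>} \<subseteq> (\<lambda>k. 1 - t - k) ` \<int>"
    proof
      fix x assume "x \<in> {x. 1 - x - t \<in> (\<int> :: real set)}"
      then show "x \<in> (\<lambda>k. 1 - t - k) ` \<int>" by (intro image_eqI[of _ _ "1 - x - t"]) auto
    qed
  qed
  ultimately have c: "countable ?X" by (intro countable_Int1 countable_Un)
  show "(\<lambda>x. ?U i x) \<in> borel_measurable unit_interval"
  proof (rule measurable_discrete_difference[OF _ c])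
    have [measurable]: "(\<lambda>z. extension B (normalized P f) z $ i) \<in> borel_measurable borel"
      by (rule extension_measurable) measurable
    have "(\<lambda>x. ?E i x) \<in> borel_measurable borel"
      by measurable
    then show "(\<lambda>x. ?E i x) \<in> borel_measurable unit_interval"
      by (rule borel_measurable_unit_intervalI)
    show "{x} \<in> sets unit_interval" if "x \<in> ?X" for x
      using that by (auto simp: unit_interval_def sets_restrict_space_iff)
    show "?E i x
        = ?U i x"
      if "x \<in> space unit_interval" "x \<notin> ?X" for x
      using T_fun_eq[OF _ _ t, of x B P f i] that by (auto simp: sp)
  qed simp
qed

section \<open>L^p bounds for the extension and the operators T(t)\<close>

lemma abs_sum_powr_le:
  fixes a :: "'n::finite \<Rightarrow> real"
  assumes p: "0 \<le> p"
  shows "\<bar>\<Sum>j\<in>UNIV. a j\<bar> powr p \<le> real CARD('n) powr p * (\<Sum>j\<in>UNIV. \<bar>a j\<bar> powr p)"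
proof -
  define m where "m = Max (range (\<lambda>j. \<bar>a j\<bar>))"
  have "m \<in> range (\<lambda>j. \<bar>a j\<bar>)" unfolding m_def by (intro Max_in) auto
  then obtain k where k: "m = \<bar>a k\<bar>" by auto
  have le: "\<bar>a j\<bar> \<le> m" for j unfolding m_def by (intro Max_ge) auto
  have "\<bar>\<Sum>j\<in>UNIV. a j\<bar> \<le> (\<Sum>j\<in>UNIV. \<bar>a j\<bar>)" by (rule sum_abs)
  also have "\<dots> \<le> real CARD('n) * m" using le by (intro sum_bounded_above) auto
  finally have "\<bar>\<Sum>j\<in>UNIV. a j\<bar> powr p \<le> (real CARD('n) * m) powr p"
    using p by (intro powr_mono2) auto
  also have "\<dots> = real CARD('n) powr p * \<bar>a k\<bar> powr p" by (simp add: powr_mult k)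
  also have "\<dots> \<le> real CARD('n) powr p * (\<Sum>j\<in>UNIV. \<bar>a j\<bar> powr p)"
    by (intro mult_left_mono member_le_sum[where f = "\<lambda>j. \<bar>a j\<bar> powr p"]) auto
  finally show ?thesis .
qed

text \<open>[-N, 1) splits into N + 1 unit cells, on each of which \<open>frac\<close> is a
  translation. For each z exactly one term of the sum over the cells survives.\<close>

lemma nn_integral_frac:
  fixes g :: "real \<Rightarrow> ennreal"
  assumes [measurable]: "g \<in> borel_measurable borel"
  shows "(\<integral>\<^sup>+z\<in>{- real N..<1}. g (frac z) \<partial>lborel) = of_nat (Suc N) * (\<integral>\<^sup>+y\<in>{0..<1}. g y \<partial>lborel)"
proof -
  let ?g = "\<lambda>k z. g (z + real k) * indicator {0..<1} (z + real k)"
  have "g (frac z) * indicator {- real N..<1} z = (\<Sum>k\<le>N. ?g k z)" for z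
  proof (cases "z \<in> {- real N..<1}")
    case True
    define k where "k = nat (- \<lfloor>z\<rfloor>)"
    have "- int N \<le> \<lfloor>z\<rfloor>" using True by (simp add: le_floor_iff)
    moreover have "\<lfloor>z\<rfloor> \<le> 0" using True by simp
    ultimately have k: "frac z = z + real k" "k \<le> N" by (auto simp: k_def frac_def)
    have "(\<Sum>k\<le>N. ?g k z)
        = (\<Sum>j\<le>N. if j = k then g (frac z) else 0)"
    proof (intro sum.cong refl)
      fix j
      have "j = k" if "0 \<le> z + real j" "z + real j < 1"
        using frac_unique_iff[of "z + real j" "z + real j"] that k frac_ge_0[of z] frac_lt_1[of z] by linarith
      then show "g (z + real j) * indicator {0..<1} (z + real j) = (if j = k then g (frac z) else 0)"
        using k frac_ge_0[of z] frac_lt_1[of z] by (auto simp: indicator_def)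
    qed
    then show ?thesis using True k(2) by simp
  next
    case False
    have "?g k z = 0" if "k \<le> N" for k
      using False that by (auto simp: indicator_def)
    then have "(\<Sum>k\<le>N. ?g k z) = 0"
      by (intro sum.neutral) auto
    moreover have "indicator {- real N..<1} z = (0 :: ennreal)" using False by (auto simp: indicator_def)
    ultimately show ?thesis by (simp only: mult_zero_right)
  qed
  then have "(\<integral>\<^sup>+z\<in>{- real N..<1}. g (frac z) \<partial>lborel)
      = (\<integral>\<^sup>+z. (\<Sum>k\<le>N. ?g k z) \<partial>lborel)"
    by (simp only:)
  also have "\<dots> = (\<Sum>k\<le>N. \<integral>\<^sup>+z. ?g k z \<partial>lborel)"
    by (rule nn_integral_sum) measurable
  also have "\<dots> = (\<Sum>k\<le>N. \<integral>\<^sup>+y\<in>{0..<1}. g y \<partial>lborel)"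
  proof (intro sum.cong refl)
    fix k
    show "(\<integral>\<^sup>+z. ?g k z \<partial>lborel) = (\<integral>\<^sup>+y\<in>{0..<1}. g y \<partial>lborel)"
      using nn_integral_real_affine[of "\<lambda>y. g y * indicator {0..<1} y" 1 "real k"] by (simp add: add.commute)
  qed
  finally show ?thesis by simp
qed

text \<open>On [-N, 1) only the powers of B up to the N-th occur, so the constant depends on N, p, B
  and the number of components, but not on the state u.\<close>

lemma extension_energy_bound:
  fixes B :: "real ^ 'n::finite ^ 'n"
  assumes p: "0 < p"
  shows "\<exists>K\<ge>0. \<forall>u i. (\<forall>j. (\<lambda>y. u y $ j) \<in> borel_measurable borel) \<longrightarrow>
    energy p (\<lambda>z. indicator {- real N..<1} z * extension B u z $ i)
      \<le> ennreal K * (\<Sum>j\<in>UNIV. energy p (\<lambda>y. u y $ j))"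
proof -
  let ?M = "matrix_power B"
  \<comment> \<open>The sum of all entries in absolute value dominates each of them, which saves a
    choice of matrix norm.\<close>
  define M where "M = (\<Sum>n\<le>N. \<Sum>i\<in>UNIV. \<Sum>j\<in>UNIV. \<bar>?M n $ i $ j\<bar>)"
  have M0: "0 \<le> M" unfolding M_def by (intro sum_nonneg) auto
  have M: "\<bar>?M n $ i $ j\<bar> \<le> M" if "n \<le> N" for n i j
  proof -
    have "\<bar>?M n $ i $ j\<bar> \<le> (\<Sum>j\<in>UNIV. \<bar>?M n $ i $ j\<bar>)"
      by (rule member_le_sum[where f = "\<lambda>j. \<bar>?M n $ i $ j\<bar>"]) auto
    also have "\<dots> \<le> (\<Sum>i\<in>UNIV. \<Sum>j\<in>UNIV. \<bar>?M n $ i $ j\<bar>)"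
      by (rule member_le_sum[where f = "\<lambda>i. \<Sum>j\<in>UNIV. \<bar>?M n $ i $ j\<bar>"]) (auto intro: sum_nonneg)
    also have "\<dots> \<le> M"
      unfolding M_def using that
      by (intro member_le_sum[where f = "\<lambda>n. \<Sum>i\<in>UNIV. \<Sum>j\<in>UNIV. \<bar>?M n $ i $ j\<bar>"])
        (auto intro!: sum_nonneg)
    finally show ?thesis .
  qed
  define C where "C = real CARD('n) powr p * M powr p"
  have "energy p (\<lambda>z. indicator {- real N..<1} z * extension B u z $ i)
      \<le> ennreal (C * real (Suc N)) * (\<Sum>j\<in>UNIV. energy p (\<lambda>y. u y $ j))"
    if meas: "\<forall>j. (\<lambda>y. u y $ j) \<in> borel_measurable borel" for u i
  proof -
    have [measurable]: "(\<lambda>y. u y $ j) \<in> borel_measurable borel" for j using meas by simp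
    have [measurable]: "(frac :: real \<Rightarrow> real) \<in> borel_measurable borel"
      unfolding frac_def[abs_def] by measurable
    have "energy p (\<lambda>z. indicator {- real N..<1} z * extension B u z $ i)
        \<le> (\<integral>\<^sup>+z. (\<Sum>j\<in>UNIV. ennreal C * (ennreal (\<bar>u (frac z) $ j\<bar> powr p) * indicator {- real N..<1} z)) \<partial>lborel)"
      unfolding energy_def
    proof (intro nn_integral_mono)
      fix z
      show "ennreal (\<bar>indicator {- real N..<1} z * extension B u z $ i\<bar> powr p)
          \<le> (\<Sum>j\<in>UNIV. ennreal C * (ennreal (\<bar>u (frac z) $ j\<bar> powr p) * indicator {- real N..<1} z))"
      proof (cases "z \<in> {- real N..<1}")
        case True
        have "- int N \<le> \<lfloor>z\<rfloor>" using True by (simp add: le_floor_iff)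
        then have nN: "nat (- \<lfloor>z\<rfloor>) \<le> N" by simp
        have "\<bar>extension B u z $ i\<bar> powr p
            \<le> real CARD('n) powr p * (\<Sum>j\<in>UNIV. \<bar>?M (nat (- \<lfloor>z\<rfloor>)) $ i $ j * u (frac z) $ j\<bar> powr p)"
          unfolding extension_nth using p by (intro abs_sum_powr_le) auto
        also have "\<dots> \<le> real CARD('n) powr p * (\<Sum>j\<in>UNIV. M powr p * \<bar>u (frac z) $ j\<bar> powr p)"
          using M[OF nN] p M0
          by (intro mult_left_mono sum_mono) (auto simp: abs_mult powr_mult intro!: mult_right_mono powr_mono2)
        also have "\<dots> = (\<Sum>j\<in>UNIV. C * \<bar>u (frac z) $ j\<bar> powr p)"
          by (simp add: C_def sum_distrib_left mult.assoc)
        finally have "ennreal (\<bar>extension B u z $ i\<bar> powr p) \<le> ennreal (\<Sum>j\<in>UNIV. C * \<bar>u (frac z) $ j\<bar> powr p)"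
          by (rule ennreal_leI)
        also have "\<dots> = (\<Sum>j\<in>UNIV. ennreal (C * \<bar>u (frac z) $ j\<bar> powr p))"
          by (rule sum_ennreal[symmetric]) (simp add: C_def)
        also have "\<dots> = (\<Sum>j\<in>UNIV. ennreal C * ennreal (\<bar>u (frac z) $ j\<bar> powr p))"
          by (simp add: ennreal_mult C_def)
        finally show ?thesis using True by simp
      qed (use p in auto)
    qed
    also have "\<dots> = (\<Sum>j\<in>UNIV. ennreal C * (\<integral>\<^sup>+z\<in>{- real N..<1}. ennreal (\<bar>u (frac z) $ j\<bar> powr p) \<partial>lborel))"
      by (simp add: nn_integral_sum nn_integral_cmult)
    also have "\<dots> = (\<Sum>j\<in>UNIV. ennreal C * (of_nat (Suc N) * (\<integral>\<^sup>+y\<in>{0..<1}. ennreal (\<bar>u y $ j\<bar> powr p) \<partial>lborel)))"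
      by (subst nn_integral_frac[where g = "\<lambda>y. ennreal (\<bar>u y $ _\<bar> powr p)"]) auto
    also have "\<dots> \<le> (\<Sum>j\<in>UNIV. ennreal C * (of_nat (Suc N) * energy p (\<lambda>y. u y $ j)))"
      unfolding energy_def
      by (intro sum_mono mult_left_mono nn_integral_mono) (auto simp: indicator_def)
    also have "\<dots> = ennreal (C * real (Suc N)) * (\<Sum>j\<in>UNIV. energy p (\<lambda>y. u y $ j))"
      unfolding sum_distrib_left
      by (simp add: ennreal_mult C_def mult.assoc ennreal_of_nat_eq_real_of_nat[symmetric] del: of_nat_Suc)
    finally show ?thesis .
  qed
  moreover have "0 \<le> C * real (Suc N)" by (simp add: C_def)
  ultimately show ?thesis by (intro exI[of _ "C * real (Suc N)"]) blast
qed

text \<open>For y in (0, 1) and t at most N the point y - t stays in the window [-N, 1), so the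
  bound is translation invariance of the integral.\<close>

lemma normalized_shift_energy_le:
  fixes B :: "real ^ 'n::finite ^ 'n"
  assumes p: "0 < p" and t: "0 \<le> t" "t \<le> real N"
  shows "energy p (\<lambda>y. normalized P (T_op B P t f) y $ i)
    \<le> energy p (\<lambda>z. indicator {- real N..<1} z * extension B (normalized P f) z $ i)"
proof -
  let ?E = "\<lambda>z. extension B (normalized P f) z $ i"
  have [measurable]: "?E \<in> borel_measurable borel" by (rule extension_measurable) measurable
  have "energy p (\<lambda>y. normalized P (T_op B P t f) y $ i)
      \<le> energy p (\<lambda>y. indicator {- real N..<1} (- t + 1 * y) * ?E (- t + 1 * y))"
  proof (rule energy_mono_AE)
    show "AE y in lborel. \<bar>normalized P (T_op B P t f) y $ i\<bar> \<le> \<bar>indicator {- real N..<1} (- t + 1 * y) * ?E (- t + 1 * y)\<bar>"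
      using T_op_normalized[OF t(1), of P B f]
    proof eventually_elim
      case (elim y)
      then show ?case using t normalized_outside[of y P "T_op B P t f"]
        by (cases "0 < y \<and> y < 1") (auto simp: indicator_def)
    qed
  qed (use p in auto)
  also have "\<dots> = energy p (\<lambda>z. indicator {- real N..<1} z * ?E z)"
    by (rule energy_affine) auto
  finally show ?thesis .
qed

text \<open>The constant is uniform in s on [0, N]; this yields the local boundedness of the
  semigroup that the uniqueness argument asks for.\<close>

lemma T_op_energy_bound:
  fixes B :: "real ^ 'n::finite ^ 'n"
  assumes p: "0 < p"
  shows "\<exists>K\<ge>0. \<forall>s f. 0 \<le> s \<and> s \<le> real N \<longrightarrow> Xp_energy p (T_op B P s f) \<le> ennreal K * Xp_energy p f"
proof -
  obtain K where K: "0 \<le> K" "\<And>u i. (\<forall>j. (\<lambda>y. u y $ j) \<in> borel_measurable borel) \<Longrightarrow>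
    energy p (\<lambda>z. indicator {- real N..<1} z * extension B u z $ i)
      \<le> ennreal K * (\<Sum>j\<in>UNIV. energy p (\<lambda>y. u y $ j))"
    using extension_energy_bound[OF p, of N B] by blast
  have "Xp_energy p (T_op B P s f) \<le> ennreal (real CARD('n) * K) * Xp_energy p f"
    if "0 \<le> s" "s \<le> real N" for s f
  proof -
    have "energy p (\<lambda>y. normalized P (T_op B P s f) y $ i) \<le> ennreal K * Xp_energy p f" for i
      using normalized_shift_energy_le[OF p that, of P B f i] K(2)[of "normalized P f" i]
      by (auto simp: Xp_energy_normalized[of p f P])
    then have "Xp_energy p (T_op B P s f) \<le> (\<Sum>i\<in>(UNIV::'n set). ennreal K * Xp_energy p f)"
      unfolding Xp_energy_normalized[of p "T_op B P s f" P] by (intro sum_mono)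
    then show ?thesis
      using K(1) by (simp add: ennreal_mult mult.assoc ennreal_of_nat_eq_real_of_nat)
  qed
  then show ?thesis using K(1) by (intro exI[of _ "real CARD('n) * K"]) auto
qed

lemma T_op_norm_bound:
  fixes B :: "real ^ 'n::finite ^ 'n"
  assumes p: "1 \<le> p"
  shows "\<exists>C. \<forall>s\<in>{0..real N}. \<forall>f\<in>Xp p. Xp_norm p (T_op B P s f) \<le> C * Xp_norm p f"
proof -
  obtain K where K: "0 \<le> K" "\<And>s f. 0 \<le> s \<Longrightarrow> s \<le> real N \<Longrightarrow> Xp_energy p (T_op B P s f) \<le> ennreal K * Xp_energy p f"
    using T_op_energy_bound[of p N B P] p by auto
  define d where "d = real CARD('n)"
  \<comment> \<open>The energy is at most K d times the p-th power of the norm of f. Taking p-th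
    roots and summing over the d components gives this constant.\<close>
  have "Xp_norm p (T_op B P s f) \<le> (d * (K * d) powr (1 / p)) * Xp_norm p f"
    if s: "s \<in> {0..real N}" and f: "f \<in> Xp p" for s f
  proof -
    have n0: "0 \<le> Xp_norm p f" unfolding Xp_norm_def using p by (intro sum_nonneg Lp_norm_nonneg)
    have "Xp_energy p (T_op B P s f) \<le> ennreal K * Xp_energy p f"
      using K(2) s by auto
    also have "\<dots> \<le> ennreal K * ennreal (d * Xp_norm p f powr p)"
      unfolding d_def by (intro mult_left_mono Xp_energy_le_norm p f) simp
    also have "\<dots> = ennreal (((K * d) powr (1 / p) * Xp_norm p f) powr p)"
      using K(1) p n0 by (simp add: powr_mult powr_powr ennreal_mult[symmetric] d_def mult.assoc)
    finally have "Xp_norm p (T_op B P s f) \<le> real CARD('n) * ((K * d) powr (1 / p) * Xp_norm p f)"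
      using n0 by (intro Xp_norm_le_energy[OF p]) auto
    then show ?thesis by (simp add: d_def mult.assoc)
  qed
  then show ?thesis by blast
qed

section \<open>The semigroup laws and strong continuity\<close>

lemma T_op_in_Xp:
  assumes "1 \<le> p" "0 \<le> t" "f \<in> Xp p"
  shows "T_op B P t f \<in> Xp p"
proof -
  obtain N :: nat where "t \<le> real N" using real_arch_simple by blast
  moreover obtain K where "0 \<le> K" "\<And>s f. 0 \<le> s \<Longrightarrow> s \<le> real N \<Longrightarrow> Xp_energy p (T_op B P s f) \<le> ennreal K * Xp_energy p f"
    using T_op_energy_bound[of p N B P] assms(1) by auto
  ultimately have "Xp_energy p (T_op B P t f) \<le> ennreal K * Xp_energy p f" using assms by auto
  also have "\<dots> < \<infinity>" using assms by (simp add: Xp_iff ennreal_mult_less_top)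
  finally show ?thesis using assms by (simp add: Xp_iff)
qed

lemma normalized_T_op_extension:
  assumes t: "0 \<le> t"
  shows "AE z in lborel. z < 1 \<longrightarrow> extension B (normalized P (T_op B P t f)) z = extension B (normalized P f) (z - t)"
  using extension_cong_AE[OF T_op_normalized[OF t, of P B f], of B]
  by eventually_elim (simp add: extension_extension t)

lemma extension_normalized_lin_AE:
  shows "AE z in lborel. extension B (normalized P (f + g)) z = extension B (normalized P f) z + extension B (normalized P g) z" (is ?A)
    and "AE z in lborel. extension B (normalized P (f - g)) z = extension B (normalized P f) z - extension B (normalized P g) z" (is ?D)
    and "AE z in lborel. extension B (normalized P (c *\<^sub>R f)) z = c *\<^sub>R extension B (normalized P f) z" (is ?S)
proof -
  have "AE y in lborel. 0 < y \<and> y < 1 \<longrightarrow> normalized P (f + g) y = normalized P f y + normalized P g y"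
    using normalized_add[of P f g] by (rule eventually_mono) simp
  from extension_cong_AE[OF this, of B]
  show ?A
    by (simp add: extension_add)
  have "AE y in lborel. 0 < y \<and> y < 1 \<longrightarrow> normalized P (f - g) y = normalized P f y - normalized P g y"
    using normalized_diff[of P f g] by (rule eventually_mono) simp
  from extension_cong_AE[OF this, of B]
  show ?D
    by (simp add: extension_diff)
  have "AE y in lborel. 0 < y \<and> y < 1 \<longrightarrow> normalized P (c *\<^sub>R f) y = c *\<^sub>R normalized P f y"
    using normalized_scaleR[of P c f] by (rule eventually_mono) simp
  from extension_cong_AE[OF this, of B]
  show ?S
    by (simp add: extension_scaleR)
qed

lemma AE_translate: "AE x in lborel. Q x \<Longrightarrow> AE x in lborel. Q (x - t)" for Q :: "real \<Rightarrow> bool"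
  using AE_lborel_affine[of 1 Q "- t"] by simp

lemma C0_semigroup_T_op:
  fixes B :: "real ^ 'n::finite ^ 'n"
  assumes p: "1 \<le> p"
  shows "C0_semigroup (Xp p) (Xp_norm p) (T_op B P)"
  unfolding C0_semigroup_def
proof (intro conjI allI impI ballI)
  fix t :: real assume t: "0 \<le> t"
  show "bounded_operator_on (Xp p) (Xp_norm p) (T_op B P t)"
    unfolding bounded_operator_on_def
  proof (intro conjI allI ballI)
    show "T_op B P t f \<in> Xp p" if "f \<in> Xp p" for f by (rule T_op_in_Xp[OF p t that])
    obtain N :: nat where "t \<le> real N" using real_arch_simple by blast
    moreover obtain C where "\<forall>s\<in>{0..real N}. \<forall>f\<in>Xp p. Xp_norm p (T_op B P s f) \<le> C * Xp_norm p f"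
      using T_op_norm_bound[OF p, of N B P] by blast
    ultimately have "\<forall>f\<in>Xp p. Xp_norm p (T_op B P t f) \<le> C * Xp_norm p f" using t by simp
    then show "\<exists>C. \<forall>f\<in>Xp p. Xp_norm p (T_op B P t f) \<le> C * Xp_norm p f" by (rule exI)
    show "T_op B P t (f + g) = T_op B P t f + T_op B P t g" for f g
    proof (rule normalized_eqI)
      show "AE y in lborel. 0 < y \<and> y < 1 \<longrightarrow> normalized P (T_op B P t (f + g)) y = normalized P (T_op B P t f + T_op B P t g) y"
        using T_op_normalized[OF t, of P B "f + g"] T_op_normalized[OF t, of P B f] T_op_normalized[OF t, of P B g]
          AE_translate[OF extension_normalized_lin_AE(1)[of B P f g], of t] normalized_add[of P "T_op B P t f" "T_op B P t g"]
        by eventually_elim simp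
    qed
    show "T_op B P t (c *\<^sub>R f) = c *\<^sub>R T_op B P t f" for c f
    proof (rule normalized_eqI)
      show "AE y in lborel. 0 < y \<and> y < 1 \<longrightarrow> normalized P (T_op B P t (c *\<^sub>R f)) y = normalized P (c *\<^sub>R T_op B P t f) y"
        using T_op_normalized[OF t, of P B "c *\<^sub>R f"] T_op_normalized[OF t, of P B f]
          AE_translate[OF extension_normalized_lin_AE(3)[of B P c f], of t] normalized_scaleR[of P c "T_op B P t f"]
        by eventually_elim simp
    qed
  qed
next
  fix f :: "l0 ^ 'n"
  show "T_op B P 0 f = f"
  proof (rule normalized_eqI)
    show "AE y in lborel. 0 < y \<and> y < 1 \<longrightarrow> normalized P (T_op B P 0 f) y = normalized P f y"
      using T_op_normalized[of 0 P B f] by (auto simp: extension_unit elim: eventually_mono)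
  qed
next
  fix s t :: real and f :: "l0 ^ 'n" assume s: "0 \<le> s" and t: "0 \<le> t"
  show "T_op B P (s + t) f = T_op B P s (T_op B P t f)"
  proof (rule normalized_eqI)
    have "AE y in lborel. 0 < y \<and> y < 1 \<longrightarrow> normalized P (T_op B P (s + t) f) y = extension B (normalized P f) (y - (s + t))"
      by (rule T_op_normalized) (use s t in auto)
    then show "AE y in lborel. 0 < y \<and> y < 1 \<longrightarrow> normalized P (T_op B P (s + t) f) y = normalized P (T_op B P s (T_op B P t f)) y"
      using T_op_normalized[OF s, of P B "T_op B P t f"] AE_translate[OF normalized_T_op_extension[OF t, of B P f], of s]
      by eventually_elim (use s in \<open>auto simp: algebra_simps\<close>)
  qed
next
  fix f :: "l0 ^ 'n" and s :: real assume f: "f \<in> Xp p" and s: "0 \<le> s"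
  \<comment> \<open>With s + 1 \<le> N the window contains y - t for every y in (0, 1) and every t
    within distance 1 of s.\<close>
  obtain N :: nat where N: "s + 1 \<le> real N" using real_arch_simple by blast
  define F where "F i z = indicator {- real N..<1} z * extension B (normalized P f) z $ i" for i z
  have [measurable]: "(\<lambda>z. extension B (normalized P f) z $ i) \<in> borel_measurable borel" for i
    by (rule extension_measurable) measurable
  have [measurable]: "F i \<in> borel_measurable borel" for i unfolding F_def by measurable
  have fin: "energy p (F i) < \<infinity>" for i
  proof -
    have p0: "0 < p" using p by simp
    obtain K where K: "\<And>u i. (\<forall>j. (\<lambda>y. u y $ j) \<in> borel_measurable borel) \<Longrightarrow>
      energy p (\<lambda>z. indicator {- real N..<1} z * extension B u z $ i)
        \<le> ennreal K * (\<Sum>j\<in>UNIV. energy p (\<lambda>y. u y $ j))"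
      using extension_energy_bound[OF p0, of N B] by blast
    have "energy p (F i) \<le> ennreal K * (\<Sum>j\<in>UNIV. energy p (\<lambda>y. normalized P f y $ j))"
      unfolding F_def[abs_def] by (rule K) simp
    also have "\<dots> < \<infinity>"
      using f p by (simp add: Xp_energy_normalized[symmetric] Xp_iff ennreal_mult_less_top)
    finally show ?thesis .
  qed
  \<comment> \<open>With z = y - s, the values of T(t)f and T(s)f at y are F(z + (s - t)) and F(z),
    so their difference is a translation difference of one fixed function.\<close>
  let ?e = "\<lambda>i t. energy p (\<lambda>z. F i (z + (s - t)) - F i z)" and ?d = "\<lambda>t. T_op B P t f - T_op B P s f"
  have "((\<lambda>t. Xp_energy p (?d t)) \<longlongrightarrow> 0) (at s within {0..})"
  proof (rule tendsto_sandwich[OF _ _ tendsto_const])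
    have "((\<lambda>t. ?e i t) \<longlongrightarrow> 0) (at s within {0..})" for i
    proof (rule filterlim_compose[OF energy_translation_tendsto_0[OF _ _ fin]])
      show "filterlim (\<lambda>t. s - t) (at 0) (at s within {0..})"
        unfolding filterlim_at by (auto simp: eventually_at_filter intro!: tendsto_eq_intros)
    qed (use p in auto)
    then show "((\<lambda>t. \<Sum>i\<in>UNIV. ?e i t) \<longlongrightarrow> 0) (at s within {0..})"
      by (intro tendsto_null_sum)
    show "\<forall>\<^sub>F t in at s within {0..}. Xp_energy p (?d t)
        \<le> (\<Sum>i\<in>UNIV. ?e i t)"
      unfolding eventually_at
    proof (intro exI[of _ 1] conjI ballI impI)
      fix t assume "t \<in> {0..}" "t \<noteq> s \<and> dist t s < 1"
      then have t: "0 \<le> t" "t \<le> real N" using N by (auto simp: dist_real_def)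
      have "energy p (\<lambda>y. normalized P (?d t) y $ i)
          \<le> ?e i t" for i
      proof -
        have "energy p (\<lambda>y. normalized P (?d t) y $ i)
            \<le> energy p (\<lambda>y. F i ((- s + 1 * y) + (s - t)) - F i (- s + 1 * y))"
        proof (rule energy_mono_AE)
          show "AE y in lborel. \<bar>normalized P (?d t) y $ i\<bar>
              \<le> \<bar>F i ((- s + 1 * y) + (s - t)) - F i (- s + 1 * y)\<bar>"
            using T_op_normalized[OF s, of P B f] T_op_normalized[OF t(1), of P B f]
              normalized_diff[of P "T_op B P t f" "T_op B P s f"]
          proof eventually_elim
            case (elim y)
            then show ?case
              using s t N normalized_outside[of y P "?d t"]
              by (cases "0 < y \<and> y < 1") (auto simp: F_def indicator_def)
          qed
        qed (use p in auto)
        also have "\<dots> = ?e i t"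
          by (rule energy_affine[of "\<lambda>z. F i (z + (s - t)) - F i z" 1 p "- s"]) auto
        finally show ?thesis .
      qed
      then show "Xp_energy p (?d t)
          \<le> (\<Sum>i\<in>UNIV. ?e i t)"
        unfolding Xp_energy_normalized[of p _ P] by (intro sum_mono)
    qed simp
  qed auto
  then show "((\<lambda>t. Xp_norm p (?d t)) \<longlongrightarrow> 0) (at s within {0..})"
    by (rule Xp_norm_tendsto_0[OF p])
qed

section \<open>The generator\<close>

text \<open>Primitives are compared on (-1, 1), and difference quotients with step at most 1 look
  back to -2; this explains the window. The cutoff places the function in L^p of the line.\<close>

definition orbit :: "real ^ 'n ^ 'n \<Rightarrow> 'n set \<Rightarrow> l0 ^ 'n \<Rightarrow> 'n \<Rightarrow> real \<Rightarrow> real" where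
  "orbit B P f i z = indicator {- 2..<1} z * extension B (normalized P f) z $ i"

lemma orbit_measurable[measurable]: "orbit B P f i \<in> borel_measurable borel"
proof -
  have [measurable]: "(\<lambda>z. extension B (normalized P f) z $ i) \<in> borel_measurable borel"
    by (rule extension_measurable) measurable
  show ?thesis unfolding orbit_def[abs_def] by measurable
qed

lemma orbit_energy_bound:
  fixes B :: "real ^ 'n::finite ^ 'n"
  assumes p: "0 < p"
  shows "\<exists>K\<ge>0. \<forall>f i. energy p (orbit B P f i) \<le> ennreal K * Xp_energy p f"
proof -
  obtain K where K: "0 \<le> K" "\<And>u i. (\<forall>j. (\<lambda>y. u y $ j) \<in> borel_measurable borel) \<Longrightarrow>
    energy p (\<lambda>z. indicator {- real 2..<1} z * extension B u z $ i)
      \<le> ennreal K * (\<Sum>j\<in>UNIV. energy p (\<lambda>y. u y $ j))"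
    using extension_energy_bound[OF p, of 2 B] by blast
  have "energy p (orbit B P f i) \<le> ennreal K * Xp_energy p f" for f i
    using K(2)[of "normalized P f" i] by (simp add: orbit_def[abs_def] Xp_energy_normalized[of p f P])
  with K(1) show ?thesis by blast
qed

lemma orbit_energy_finite:
  assumes "1 \<le> p" "f \<in> Xp p"
  shows "energy p (orbit B P f i) < \<infinity>"
proof -
  obtain K where "0 \<le> K" "\<forall>f i. energy p (orbit B P f i) \<le> ennreal K * Xp_energy p f"
    using orbit_energy_bound[of p B P] assms by auto
  then have "energy p (orbit B P f i) \<le> ennreal K * Xp_energy p f" by blast
  also have "\<dots> < \<infinity>" using assms by (simp add: Xp_iff ennreal_mult_less_top)
  finally show ?thesis .
qed

lemma orbit_set_integrable:
  "\<lbrakk>1 \<le> p; f \<in> Xp p\<rbrakk> \<Longrightarrow> set_integrable lborel {a..b} (orbit B P f i)"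
  by (intro energy_imp_set_integrable[of p] orbit_energy_finite) auto

lemma orbit_integrable_on:
  "\<lbrakk>1 \<le> p; f \<in> Xp p\<rbrakk> \<Longrightarrow> orbit B P f i integrable_on {a..b}"
  by (rule set_borel_integral_eq_integral(1)[OF orbit_set_integrable])

lemma orbit_unit: "0 \<le> z \<Longrightarrow> z \<le> 1 \<Longrightarrow> orbit B P f i z = normalized P f z $ i"
  by (cases "z = 1"; cases "z = 0")
    (auto simp: orbit_def extension_unit normalized_outside extension_def)

lemma orbit_neg:
  assumes "- 2 \<le> z" "z < 0"
  shows "orbit B P f i z = (\<Sum>j\<in>UNIV. B $ i $ j * orbit B P f j (z + 1))"
  using assms extension_neg[of z B "normalized P f"]
  by (simp add: orbit_def matrix_vector_mult_def)

text \<open>After unfolding, the semigroup acts as a translation also at negative z, so its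
  difference quotient becomes that of a translation on both sides of 0.\<close>

lemma orbit_difference:
  fixes f g :: "l0 ^ 'n::finite"
  assumes h: "0 < h" "h \<le> 1"
  shows "AE z in lborel. - 1 \<le> z \<and> z < 1 \<longrightarrow> orbit B P ((1 / h) *\<^sub>R (T_op B P h f - f) - g) i z
    = (orbit B P f i (z - h) - orbit B P f i z) / h - orbit B P g i z"
proof -
  have h0: "0 \<le> h" using h by simp
  show ?thesis
    using extension_normalized_lin_AE(2)[of B P "(1 / h) *\<^sub>R (T_op B P h f - f)" g]
      extension_normalized_lin_AE(3)[of B P "1 / h" "T_op B P h f - f"]
      extension_normalized_lin_AE(2)[of B P "T_op B P h f" f]
      normalized_T_op_extension[OF h0, of B P f]
  proof eventually_elim
    case (elim z)
    show ?case using elim h by (auto simp: orbit_def indicator_def)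
  qed
qed

section \<open>Transformations of integrals\<close>

lemmas hk_integral_combine = Henstock_Kurzweil_Integration.integral_combine

lemma integral_cong_AE_real:
  fixes F G :: "real \<Rightarrow> real"
  assumes "AE x in lborel. F x = G x"
  shows "integral S F = integral S G"
proof -
  have "AE x in lebesgue. F x = G x" using assms by (rule AE_completion)
  then obtain N where N: "N \<in> null_sets lebesgue" "{x. F x \<noteq> G x} \<subseteq> N"
    by (auto simp: eventually_ae_filter)
  have "negligible N" using N by (simp add: negligible_iff_null_sets)
  moreover have "G x = F x" if "x \<notin> N" for x
  proof -
    have "F x = G x" using N(2) that by blast
    then show ?thesis by simp
  qed
  ultimately show ?thesis by (intro integral_spike[of N]) auto
qed

lemma integral_reflect_affine:
  fixes F :: "real \<Rightarrow> real"
  shows "integral {a..b} (\<lambda>s. F (c - s)) = integral {c - b..c - a} F"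
proof -
  have "integral {c - b..c - a} F = integral {c - b - c..c - a - c} (\<lambda>x. F (x + c))"
    by (rule integral_shift_real_ivl[symmetric])
  also have "\<dots> = integral {- b..- a} (\<lambda>x. F (x + c))" by simp
  also have "\<dots> = integral {a..b} (\<lambda>s. F (- s + c))"
    using Henstock_Kurzweil_Integration.integral_reflect_real[where f = "\<lambda>x. F (- x + c)" and a = a and b = b] by simp
  finally show ?thesis by (simp add: add.commute)
qed

text \<open>The right-sided version under x to -x. The flow moves to the right, so the averages that
  occur look back over [x - h, x].\<close>

lemma lebesgue_differentiation_left:
  fixes U :: "real \<Rightarrow> real"
  assumes U: "\<And>a b. U integrable_on {a..b}"
  shows "AE x in lborel. ((\<lambda>h. integral {x - h..x} U / h) \<longlongrightarrow> U x) (at_right 0)"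
proof -
  have "(\<lambda>s. U (0 - s)) integrable_on {a..b}" for a b
    using Henstock_Kurzweil_Integration.integrable_reflect_real[where f = U and a = "- b" and b = "- a"] U by simp
  then have "AE x in lborel. ((\<lambda>h. integral {x..x + h} (\<lambda>s. U (0 - s)) / h) \<longlongrightarrow> U (0 - x)) (at_right 0)"
    by (rule lebesgue_differentiation)
  from AE_lborel_affine[OF _ this, of "-1" 0] show ?thesis
    unfolding integral_reflect_affine by simp
qed

lemma normalized_integral_eq_orbit:
  assumes "0 \<le> a" "b \<le> 1"
  shows "integral {a..b} (\<lambda>s. normalized P g s $ i) = integral {a..b} (orbit B P g i)"
  using assms by (intro integral_cong) (auto simp: orbit_unit)

section \<open>The operator A expressed by primitives\<close>

lemma zero_ext_integrable: "\<lbrakk>1 \<le> p; f \<in> Lp p\<rbrakk> \<Longrightarrow> integrable lborel (zero_ext f)"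
proof -
  assume p: "1 \<le> p" "f \<in> Lp p"
  then have "set_integrable lborel {0..1} (zero_ext f)"
    by (intro energy_imp_set_integrable[of p]) (auto simp: Lp_iff)
  moreover have "(\<lambda>x. indicator {0..1} x *\<^sub>R zero_ext f x) = zero_ext f"
    by (auto simp: fun_eq_iff indicator_def zero_ext_def)
  ultimately show ?thesis by (simp add: set_integrable_def)
qed

text \<open>In normalized coordinates A is minus the derivative in every component, because
  reflecting a lower component changes the sign of its derivative. The constant c is the value at
  the inflow end.\<close>

definition inflow_primitive :: "'n set \<Rightarrow> l0 ^ 'n \<Rightarrow> l0 ^ 'n \<Rightarrow> 'n \<Rightarrow> real \<Rightarrow> bool" where
  "inflow_primitive P f g i c \<longleftrightarrow> (AE y in lborel. 0 < y \<and> y < 1 \<longrightarrow>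
     normalized P f y $ i = c - integral {0..y} (\<lambda>s. normalized P g s $ i))"

lemma inflow_primitive_iff_weak_deriv:
  fixes f g :: "l0 ^ 'n"
  assumes p: "1 \<le> p" and f: "f \<in> Xp p" and g: "g \<in> Xp p"
  shows "(\<exists>c. inflow_primitive P f g i c) \<longleftrightarrow> has_weak_deriv (f $ i) (if i \<in> P then - (g $ i) else g $ i)"
proof -
  have Lp: "f $ i \<in> Lp p" "g $ i \<in> Lp p" "- (g $ i) \<in> Lp p"
    using f g subspace_neg[OF subspace_Lp[OF p]] by (auto simp: Xp_def)
  note int = Lp[THEN zero_ext_integrable[OF p]]
  note int_on = int[THEN integrable_imp_integrable_on]
  show ?thesis
  proof (cases "i \<in> P")
    case True
    have "integral {0..y} (zero_ext (- (g $ i))) = - integral {0..y} (zero_ext (g $ i))" for y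
      using integral_cong_AE_real[OF zero_ext_uminus, of "{0..y}" "g $ i"] by (simp add: integral_neg)
    then show ?thesis
      using True by (simp add: inflow_primitive_def has_weak_deriv_iff_primitive[OF int(1,3)] normalized_def)
  next
    case False
    have eq: "integral {0..y} (\<lambda>s. zero_ext (g $ i) (1 - s))
        = integral {0..1} (zero_ext (g $ i)) - integral {0..1 - y} (zero_ext (g $ i))" if "0 \<le> y" "y \<le> 1" for y
    proof -
      have "integral {0..y} (\<lambda>s. zero_ext (g $ i) (1 - s)) = integral {1 - y..1} (zero_ext (g $ i))"
        by (simp add: integral_reflect_affine)
      then show ?thesis
        using hk_integral_combine[of 0 "1 - y" 1 "zero_ext (g $ i)"] int_on(2) that by auto
    qed
    \<comment> \<open>Reflection turns the integral from 0 to y into one from 1 - y to 1; re-basing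
      it at 0 moves the constant by the full integral.\<close>
    let ?J = "integral {0..1} (zero_ext (g $ i))"
    have *: "inflow_primitive P f g i c \<longleftrightarrow>
        (AE x in lborel. 0 < x \<and> x < 1 \<longrightarrow> zero_ext (f $ i) x = (c - ?J) + integral {0..x} (zero_ext (g $ i)))"
      (is "?A \<longleftrightarrow> (AE x in lborel. ?Q x)") for c
    proof
      assume ?A
      from AE_reflect[OF this[unfolded inflow_primitive_def], of False]
      show "AE x in lborel. ?Q x"
        by (rule eventually_mono) (use False in \<open>auto simp: normalized_def eq\<close>)
    next
      assume "AE x in lborel. ?Q x"
      from AE_reflect[OF this, of False]
      show ?A unfolding inflow_primitive_def
        by (rule eventually_mono) (use False in \<open>auto simp: normalized_def eq\<close>)
    qed
    have "(\<exists>c. inflow_primitive P f g i c) \<longleftrightarrow> (\<exists>c. AE x in lborel. 0 < x \<and> x < 1 \<longrightarrow>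
        zero_ext (f $ i) x = c + integral {0..x} (zero_ext (g $ i)))"
    proof
      assume "\<exists>c. AE x in lborel. 0 < x \<and> x < 1 \<longrightarrow> zero_ext (f $ i) x = c + integral {0..x} (zero_ext (g $ i))"
      then obtain c where c: "AE x in lborel. 0 < x \<and> x < 1 \<longrightarrow> zero_ext (f $ i) x = c + integral {0..x} (zero_ext (g $ i))"
        by blast
      then have "inflow_primitive P f g i (c + ?J)" unfolding * by simp
      then show "\<exists>c. inflow_primitive P f g i c" by blast
    qed (use * in blast)
    then show ?thesis using False by (simp add: has_weak_deriv_iff_primitive[OF int(1,2)])
  qed
qed

lemma inflow_primitive_values:
  fixes f g :: "l0 ^ 'n"
  assumes p: "1 \<le> p" and g: "g \<in> Xp p" and c: "inflow_primitive P f g i c"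
  shows "inflow_values P f $ i = c"
    and "outflow_values P f $ i = c - integral {0..1} (\<lambda>s. normalized P g s $ i)"
proof -
  let ?\<sigma> = "\<lambda>x. if i \<in> P then x else 1 - x :: real"
  define I where "I y = integral {0..y} (\<lambda>s. normalized P g s $ i)" for y
  \<comment> \<open>On [0, 1] the orbit does not depend on the matrix. The identity is an arbitrary
    choice that makes the integrability of orbits applicable.\<close>
  have "continuous_on {0..1} (\<lambda>y. integral {0..y} (orbit (mat 1) P g i))"
    by (intro indefinite_integral_continuous_1 orbit_integrable_on[OF p g])
  then have cI: "continuous_on {0..1} I"
    by (rule continuous_on_eq) (simp add: I_def normalized_integral_eq_orbit[where B = "mat 1"])
  have cv: "continuous_on {0..1} (\<lambda>x. c - I (?\<sigma> x))"
    by (cases "i \<in> P") (auto intro!: continuous_intros continuous_on_compose2[OF cI])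
  have ae: "AE x in lborel. 0 < x \<and> x < 1 \<longrightarrow> zero_ext (f $ i) x = c - I (?\<sigma> x)"
    using AE_reflect[OF c[unfolded inflow_primitive_def], of "i \<in> P"]
    by (rule eventually_mono) (auto simp: normalized_def I_def split: if_splits)
  have I0: "I 0 = 0" by (simp add: I_def)
  show "inflow_values P f $ i = c"
    using point_value_eq[OF cv ae, of 0] point_value_eq[OF cv ae, of 1] by (simp add: inflow_values_def I0)
  show "outflow_values P f $ i = c - integral {0..1} (\<lambda>s. normalized P g s $ i)"
    using point_value_eq[OF cv ae, of 0] point_value_eq[OF cv ae, of 1]
    by (simp add: outflow_values_def I_def[symmetric])
qed

text \<open>The inflow values are the constants c and the outflow values are c minus the integrals
  over (0, 1), so the boundary condition becomes a linear equation for c.\<close>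

lemma op_graph_iff_primitive:
  fixes f g :: "l0 ^ 'n::finite"
  assumes p: "1 \<le> p" and f: "f \<in> Xp p" and g: "g \<in> Xp p"
  shows "(f, g) \<in> op_graph (dom_A p B P) (op_A P) \<longleftrightarrow>
    (\<exists>c. (\<forall>i. inflow_primitive P f g i (c i)) \<and>
      (\<forall>i. c i = (\<Sum>j\<in>UNIV. B $ i $ j * (c j - integral {0..1} (\<lambda>s. normalized P g s $ j)))))"
    (is "?L \<longleftrightarrow> ?R")
proof
  assume ?L
  then have d: "f \<in> dom_A p B P" and ga: "g = op_A P f" by (auto simp: op_graph_def)
  have "\<exists>c. inflow_primitive P f g i c" for i
  proof -
    obtain w where "has_weak_deriv (f $ i) w" using d by (auto simp: dom_A_def W1p_def)
    then show ?thesis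
      unfolding inflow_primitive_iff_weak_deriv[OF p f g] by (simp add: ga op_A_def weak_deriv_eq)
  qed
  then obtain c where c: "\<And>i. inflow_primitive P f g i (c i)" by metis
  have "c i = (\<Sum>j\<in>UNIV. B $ i $ j * (c j - integral {0..1} (\<lambda>s. normalized P g s $ j)))" for i
  proof -
    have "inflow_values P f $ i = (B *v outflow_values P f) $ i" using d by (simp add: dom_A_def)
    then show ?thesis
      using inflow_primitive_values[OF p g c] by (simp add: matrix_vector_mult_def)
  qed
  with c show ?R by blast
next
  assume ?R
  then obtain c where c: "\<And>i. inflow_primitive P f g i (c i)"
    and b: "\<And>i. c i = (\<Sum>j\<in>UNIV. B $ i $ j * (c j - integral {0..1} (\<lambda>s. normalized P g s $ j)))" by blast
  have w: "has_weak_deriv (f $ i) (if i \<in> P then - (g $ i) else g $ i)" for i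
    using c inflow_primitive_iff_weak_deriv[OF p f g] by blast
  have Lp: "f $ i \<in> Lp p" "(if i \<in> P then - (g $ i) else g $ i) \<in> Lp p" for i
    using f g subspace_neg[OF subspace_Lp[OF p]] by (auto simp: Xp_def)
  have "inflow_values P f = B *v outflow_values P f"
    unfolding vec_eq_iff
  proof
    fix i
    show "inflow_values P f $ i = (B *v outflow_values P f) $ i"
      using b[of i] inflow_primitive_values[OF p g c] by (simp add: matrix_vector_mult_def)
  qed
  then have "f \<in> dom_A p B P" using w Lp by (auto simp: dom_A_def W1p_def)
  moreover have "g = op_A P f"
    unfolding vec_eq_iff op_A_def using weak_deriv_eq[OF w] by simp
  ultimately show ?L by (auto simp: op_graph_def)
qed

text \<open>The relation E(z) = B E(z + 1), integrated. It transports primitives across 0 and, at z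
  = -h, supplies the boundary condition of the averaged states in the density proof.\<close>

lemma integral_orbit_neg:
  fixes B :: "real ^ 'n::finite ^ 'n"
  assumes p: "1 \<le> p" and g: "g \<in> Xp p" and z: "- 1 \<le> z" "z \<le> 0"
  shows "integral {z..0} (orbit B P g i) = (\<Sum>j\<in>UNIV. B $ i $ j * integral {z + 1..1} (orbit B P g j))"
proof -
  have shift: "integral {z..0} (\<lambda>s. orbit B P g j (s + 1)) = integral {z + 1..1} (orbit B P g j)" for j
    using integral_shift_real_ivl[of "z + 1" 1 1 "orbit B P g j"] by simp
  have "integral {z..0} (orbit B P g i) = integral {z..0} (\<lambda>s. \<Sum>j\<in>UNIV. B $ i $ j * orbit B P g j (s + 1))"
    by (rule integral_spike[of "{0}"]) (use z in \<open>auto simp: orbit_neg\<close>)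
  also have "\<dots> = (\<Sum>j\<in>UNIV. B $ i $ j * integral {z..0} (\<lambda>s. orbit B P g j (s + 1)))"
    using integrable_shift_real_ivl[OF orbit_integrable_on[OF p g, where B = B and P = P and a = "z + 1" and b = 1], where c = 1]
    by (subst integral_sum) (auto intro!: integrable_on_mult_right)
  finally show ?thesis by (simp only: shift)
qed

text \<open>One constant per component has to serve on both sides of 0; two independent constants
  would lose the boundary condition.\<close>

definition orbit_primitive :: "real ^ 'n ^ 'n \<Rightarrow> 'n set \<Rightarrow> l0 ^ 'n \<Rightarrow> l0 ^ 'n \<Rightarrow> bool" where
  "orbit_primitive B P f g \<longleftrightarrow> (\<forall>i. \<exists>c. AE z in lborel. - 1 < z \<and> z < 1 \<longrightarrow>
     orbit B P f i z = c - integral {- 1..z} (orbit B P g i))"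

lemma op_graph_iff_orbit_primitive:
  fixes f g :: "l0 ^ 'n::finite"
  assumes p: "1 \<le> p" and f: "f \<in> Xp p" and g: "g \<in> Xp p"
  shows "(f, g) \<in> op_graph (dom_A p B P) (op_A P) \<longleftrightarrow> orbit_primitive B P f g"
proof -
  let ?F = "orbit B P f" and ?G = "orbit B P g"
  have comb: "integral {a..m} (?G i) + integral {m..b} (?G i) = integral {a..b} (?G i)"
    if "a \<le> m" "m \<le> b" for a m b i
    using that by (intro hk_integral_combine orbit_integrable_on[OF p g])
  note nrm = normalized_integral_eq_orbit[where B = B and P = P and g = g]
  show ?thesis
    unfolding op_graph_iff_primitive[OF assms]
  proof
    assume "\<exists>c. (\<forall>i. inflow_primitive P f g i (c i)) \<and>
      (\<forall>i. c i = (\<Sum>j\<in>UNIV. B $ i $ j * (c j - integral {0..1} (\<lambda>s. normalized P g s $ j))))"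
    then obtain c where c: "\<And>i. inflow_primitive P f g i (c i)"
      and b: "\<And>i. c i = (\<Sum>j\<in>UNIV. B $ i $ j * (c j - integral {0..1} (\<lambda>s. normalized P g s $ j)))" by blast
    have c_all: "AE y in lborel. \<forall>j. 0 < y \<and> y < 1 \<longrightarrow> ?F j y = c j - integral {0..y} (?G j)"
    proof -
      have "AE y in lborel. \<forall>j\<in>UNIV. 0 < y \<and> y < 1 \<longrightarrow> ?F j y = c j - integral {0..y} (?G j)"
      proof (rule AE_finite_allI)
        fix j show "AE y in lborel. 0 < y \<and> y < 1 \<longrightarrow> ?F j y = c j - integral {0..y} (?G j)"
          using c[of j] unfolding inflow_primitive_def
          by (rule eventually_mono) (auto simp: orbit_unit nrm)
      qed simp
      then show ?thesis by simp
    qed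
    show "orbit_primitive B P f g"
      unfolding orbit_primitive_def
    proof (intro allI exI)
      fix i
      \<comment> \<open>The primitive is now based at -1 instead of 0, which adds the integral over
        [-1, 0] to the inflow value.\<close>
      show "AE z in lborel. - 1 < z \<and> z < 1 \<longrightarrow>
          ?F i z = (c i + integral {- 1..0} (?G i)) - integral {- 1..z} (?G i)"
        using c_all AE_translate[OF c_all, of "-1"] AE_lborel_singleton[of "0::real"]
      proof eventually_elim
        case (elim z)
        show ?case
        proof
          assume z: "- 1 < z \<and> z < 1"
          show "?F i z = (c i + integral {- 1..0} (?G i)) - integral {- 1..z} (?G i)"
          proof (cases "0 < z")
            case True
            then show ?thesis using elim(1) z comb[of "-1" 0 z i] by auto
          next
            case False
            then have neg: "z < 0" using elim(3) by auto
            have "?F i z = (\<Sum>j\<in>UNIV. B $ i $ j * ?F j (z + 1))"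
              using neg z by (intro orbit_neg) auto
            also have "\<dots> = (\<Sum>j\<in>UNIV. B $ i $ j * (c j - integral {0..z + 1} (?G j)))"
              using elim(2) neg z by (auto simp: add.commute intro!: sum.cong)
            also have "\<dots> = (\<Sum>j\<in>UNIV. B $ i $ j * (c j - integral {0..1} (?G j))
                + B $ i $ j * integral {z + 1..1} (?G j))"
            proof (intro sum.cong refl)
              fix j
              have e: "integral {0..1} (?G j) = integral {0..z + 1} (?G j) + integral {z + 1..1} (?G j)"
                using comb[of 0 "z + 1" 1 j] neg z by simp
              show "B $ i $ j * (c j - integral {0..z + 1} (?G j))
                  = B $ i $ j * (c j - integral {0..1} (?G j)) + B $ i $ j * integral {z + 1..1} (?G j)"
                unfolding e by (simp only: distrib_left[symmetric] diff_diff_add[symmetric] diff_add_cancel)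
            qed
            also have "\<dots> = c i + integral {z..0} (?G i)"
            proof -
              have zz: "- 1 \<le> z" "z \<le> 0" using neg z by auto
              have "c i = (\<Sum>j\<in>UNIV. B $ i $ j * (c j - integral {0..1} (?G j)))"
                by (subst b) (simp add: nrm)
              then show ?thesis
                by (simp only: sum.distrib integral_orbit_neg[OF p g zz])
            qed
            finally have "?F i z = c i + integral {z..0} (?G i)" .
            moreover have "integral {- 1..z} (?G i) + integral {z..0} (?G i)
                = integral {- 1..0} (?G i)"
              by (rule comb) (use neg z in auto)
            ultimately show ?thesis by linarith
          qed
        qed
      qed
    qed
  next
    assume "orbit_primitive B P f g"
    from choice[OF this[unfolded orbit_primitive_def]]
    obtain c0 where c0_all: "\<forall>i. AE z in lborel. - 1 < z \<and> z < 1 \<longrightarrow>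
        ?F i z = c0 i - integral {- 1..z} (?G i)" by (rule exE)
    note c0 = c0_all[THEN spec]
    define c where "c i = c0 i - integral {- 1..0} (?G i)" for i
    have c: "inflow_primitive P f g i (c i)" for i
      unfolding inflow_primitive_def using c0[of i]
    proof (rule eventually_mono)
      fix z assume *: "- 1 < z \<and> z < 1 \<longrightarrow> ?F i z = c0 i - integral {- 1..z} (?G i)"
      show "0 < z \<and> z < 1 \<longrightarrow> normalized P f z $ i = c i - integral {0..z} (\<lambda>s. normalized P g s $ i)"
      proof
        assume z: "0 < z \<and> z < 1"
        then show "normalized P f z $ i = c i - integral {0..z} (\<lambda>s. normalized P g s $ i)"
          using * comb[of "-1" 0 z i] by (simp add: c_def nrm orbit_unit[symmetric, where B = B])
      qed
    qed
    have "AE y in lborel. \<forall>j\<in>UNIV. - 1 < y \<and> y < 1 \<longrightarrow>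
        ?F j y = c0 j - integral {- 1..y} (?G j)"
      using c0 by (intro AE_finite_allI) auto
    then have c_all: "AE y in lborel. \<forall>j. - 1 < y \<and> y < 1 \<longrightarrow>
        ?F j y = c0 j - integral {- 1..y} (?G j)" by simp
    have "c i = (\<Sum>j\<in>UNIV. B $ i $ j * (c j - integral {0..1} (\<lambda>s. normalized P g s $ j)))" for i
    proof -
      \<comment> \<open>The boundary equation involves only constants, so a single z in (-1, 0) at
        which the identities hold both at z and at z + 1 is enough.\<close>
      have "AE z in lborel. (\<forall>j. - 1 < z \<and> z < 1 \<longrightarrow> ?F j z = c0 j - integral {- 1..z} (?G j))
        \<and> (\<forall>j. - 1 < z + 1 \<and> z + 1 < 1 \<longrightarrow> ?F j (z + 1) = c0 j - integral {- 1..z + 1} (?G j))"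
        using c_all AE_translate[OF c_all, of "-1"] by eventually_elim (auto simp: add.commute)
      from AE_lborel_Ex[OF _ this, of "-1" 0] obtain z where z: "- 1 < z" "z < 0"
        and z1: "\<And>j. ?F j z = c0 j - integral {- 1..z} (?G j)"
        and z2: "\<And>j. ?F j (z + 1) = c0 j - integral {- 1..z + 1} (?G j)"
        by auto
      have "c i + integral {z..0} (?G i) = ?F i z"
        using z1[of i] comb[of "-1" z 0 i] z by (simp add: c_def)
      also have "\<dots> = (\<Sum>j\<in>UNIV. B $ i $ j * ?F j (z + 1))"
        using z by (intro orbit_neg) auto
      also have "\<dots> = (\<Sum>j\<in>UNIV. B $ i $ j * (c j - integral {0..1} (?G j))
          + B $ i $ j * integral {z + 1..1} (?G j))"
      proof (intro sum.cong refl)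
        fix j
        have eq: "?F j (z + 1) = c j - integral {0..1} (?G j) + integral {z + 1..1} (?G j)"
          using z2[of j] comb[of "-1" 0 "z + 1" j] comb[of 0 "z + 1" 1 j] z by (simp add: c_def)
        show "B $ i $ j * ?F j (z + 1) = B $ i $ j * (c j - integral {0..1} (?G j))
          + B $ i $ j * integral {z + 1..1} (?G j)" unfolding eq by (rule distrib_left)
      qed
      also have "\<dots> = (\<Sum>j\<in>UNIV. B $ i $ j * (c j - integral {0..1} (?G j))) + integral {z..0} (?G i)"
        using integral_orbit_neg[OF p g, of z B P i] z by (simp add: sum.distrib)
      finally show ?thesis by (simp add: nrm)
    qed
    with c show "\<exists>c. (\<forall>i. inflow_primitive P f g i (c i)) \<and>
      (\<forall>i. c i = (\<Sum>j\<in>UNIV. B $ i $ j * (c j - integral {0..1} (\<lambda>s. normalized P g s $ j))))" by blast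
  qed
qed

section \<open>Equality of the generator with A\<close>

lemma Xp_quotient:
  fixes f g :: "l0 ^ 'n::finite"
  assumes p: "1 \<le> p" and f: "f \<in> Xp p" and h: "0 \<le> h"
  shows "c *\<^sub>R (T_op B P h f - f) \<in> Xp p"
  using subspace_Xp[OF p] T_op_in_Xp[OF p h f] f by (intro subspace_scale subspace_diff) auto

lemma Xp_energy_le_orbit:
  fixes f :: "l0 ^ 'n::finite"
  assumes p: "0 < p" and ae: "\<And>i. AE y in lborel. 0 < y \<and> y < 1 \<longrightarrow> normalized P f y $ i = F i y"
  shows "Xp_energy p f \<le> (\<Sum>i\<in>UNIV. energy p (F i))"
  unfolding Xp_energy_normalized[of p f P]
proof (intro sum_mono energy_mono_AE)
  fix i
  show "AE y in lborel. \<bar>normalized P f y $ i\<bar> \<le> \<bar>F i y\<bar>"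
    using ae[of i]
  proof eventually_elim
    case (elim y)
    then show ?case using normalized_outside[of y P f] by (cases "0 < y \<and> y < 1") auto
  qed
qed (use p in auto)

text \<open>Along a primitive the difference quotient is the average of the orbit of g over
  [z - h, z], and averages converge in L^p.\<close>

lemma orbit_primitive_imp_generator:
  fixes f g :: "l0 ^ 'n::finite"
  assumes p: "1 \<le> p" and f: "f \<in> Xp p" and g: "g \<in> Xp p" and prim: "orbit_primitive B P f g"
  shows "(f, g) \<in> generator (Xp p) (Xp_norm p) (T_op B P)"
proof -
  let ?F = "orbit B P f" and ?G = "orbit B P g"
  have "((\<lambda>h. Xp_energy p ((1 / h) *\<^sub>R (T_op B P h f - f) - g)) \<longlongrightarrow> 0) (at_right 0)"
  proof (rule tendsto_sandwich[OF _ _ tendsto_const])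
    show "((\<lambda>h. \<Sum>i\<in>UNIV. energy p (\<lambda>z. integral {z - h..z} (?G i) / h - ?G i z)) \<longlongrightarrow> 0) (at_right 0)"
      by (intro tendsto_null_sum energy_average_tendsto_0[OF p _ orbit_energy_finite[OF p g]]) simp
    show "\<forall>\<^sub>F h in at_right 0. Xp_energy p ((1 / h) *\<^sub>R (T_op B P h f - f) - g)
        \<le> (\<Sum>i\<in>UNIV. energy p (\<lambda>z. integral {z - h..z} (?G i) / h - ?G i z))"
      using eventually_at_right_0_less[OF zero_less_one]
    proof eventually_elim
      case (elim h)
      show ?case
      proof (rule Xp_energy_le_orbit)
        fix i
        obtain c where c: "AE z in lborel. - 1 < z \<and> z < 1 \<longrightarrow>
            ?F i z = c - integral {- 1..z} (?G i)"
          using prim unfolding orbit_primitive_def by blast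
        have "AE z in lborel. - 1 \<le> z \<and> z < 1 \<longrightarrow> orbit B P ((1 / h) *\<^sub>R (T_op B P h f - f) - g) i z
          = (?F i (z - h) - ?F i z) / h - ?G i z"
          by (rule orbit_difference) (use elim in auto)
        then show "AE y in lborel. 0 < y \<and> y < 1 \<longrightarrow> normalized P ((1 / h) *\<^sub>R (T_op B P h f - f) - g) y $ i
            = integral {y - h..y} (?G i) / h - ?G i y"
          using c AE_translate[OF c, of h]
        proof eventually_elim
          case inner: (elim y)
          \<comment> \<open>For y in (0, 1) and h < 1 also y - h exceeds -1, so both points lie
            where the primitive identity is known.\<close>
          have "integral {y - h..y} (?G i) = integral {- 1..y} (?G i) - integral {- 1..y - h} (?G i)"
            if "0 < y"
            using that elim hk_integral_combine[OF _ _ orbit_integrable_on[OF p g], of "-1" "y - h" y B P i]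
            by simp
          then show ?case
            using inner elim orbit_unit[of y B P "(1 / h) *\<^sub>R (T_op B P h f - f) - g" i] by auto
        qed
      qed (use p in auto)
    qed
  qed auto
  from Xp_norm_tendsto_0[OF p this] show ?thesis using f g by (simp add: generator_def)
qed

text \<open>The L^p limit is integrated over [a, b]. There the difference quotient telescopes to
  averages of the orbit next to a and b, and at Lebesgue points these converge to the values of the
  orbit.\<close>

lemma generator_imp_orbit_primitive:
  fixes f g :: "l0 ^ 'n::finite"
  assumes p: "1 \<le> p" and gen: "(f, g) \<in> generator (Xp p) (Xp_norm p) (T_op B P)"
  shows "orbit_primitive B P f g"
  unfolding orbit_primitive_def
proof
  fix i
  have f: "f \<in> Xp p" and g: "g \<in> Xp p"
    and lim: "((\<lambda>h. Xp_norm p ((1 / h) *\<^sub>R (T_op B P h f - f) - g)) \<longlongrightarrow> 0) (at_right 0)"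
    using gen by (auto simp: generator_def)
  let ?F = "orbit B P f i" and ?G = "orbit B P g i"
  define d where "d h = (1 / h) *\<^sub>R (T_op B P h f - f) - g" for h
  define D where "D h z = (?F (z - h) - ?F z) / h - ?G z" for h z
  have dX: "d h \<in> Xp p" if "0 \<le> h" for h
    unfolding d_def using Xp_quotient[OF p f that] g subspace_Xp[OF p] by (intro subspace_diff) auto
  have "((\<lambda>h. Xp_energy p (d h)) \<longlongrightarrow> 0) (at_right 0)"
  proof (rule Xp_energy_tendsto_0[OF p])
    show "((\<lambda>h. Xp_norm p (d h)) \<longlongrightarrow> 0) (at_right 0)" using lim by (simp add: d_def)
    show "\<forall>\<^sub>F h in at_right 0. d h \<in> Xp p"
      using eventually_at_right_less[of 0] by eventually_elim (simp add: dX)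
  qed
  moreover obtain K where K: "0 \<le> K" "\<forall>f i. energy p (orbit B P f i) \<le> ennreal K * Xp_energy p f"
    using orbit_energy_bound[of p B P] p by auto
  ultimately have l0: "((\<lambda>h. ennreal K * Xp_energy p (d h)) \<longlongrightarrow> 0) (at_right 0)"
    using ennreal_tendsto_cmult[of "ennreal K" "\<lambda>h. Xp_energy p (d h)" 0] by simp
  have int: "?F integrable_on {a..b}" "?G integrable_on {a..b}" for a b
    by (intro orbit_integrable_on[OF p] f g)+
  note small = eventually_at_right_0_less[OF zero_less_one]
  have [measurable]: "D h \<in> borel_measurable borel" for h unfolding D_def by measurable
  \<comment> \<open>Shifting by h cancels the common part of the two integrals of ?F and leaves one
    short integral at each end.\<close>
  have key: "((\<lambda>h. (integral {a - h..a} ?F / h - integral {b - h..b} ?F / h) - integral {a..b} ?G) \<longlongrightarrow> 0) (at_right 0)"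
    if ab: "- 1 \<le> a" "a \<le> b" "b \<le> 1" for a b
  proof -
    have "((\<lambda>h. integral {a..b} (D h)) \<longlongrightarrow> 0) (at_right 0)"
    proof (rule integral_tendsto_0_of_energy[OF p])
      show "\<forall>\<^sub>F h in at_right 0. set_integrable lborel {a..b} (D h)"
        using small
      proof eventually_elim
        case (elim h)
        have "set_integrable lborel {a..b} (\<lambda>z. ?F (z - h))"
          using energy_affine[of ?F 1 p "- h"] orbit_energy_finite[OF p f, of B P i]
          by (intro energy_imp_set_integrable[OF p]) (auto simp: algebra_simps)
        then show ?case
          unfolding D_def using orbit_set_integrable[OF p f, of a b B P i] orbit_set_integrable[OF p g, of a b B P i]
          by (intro set_integral_diff set_integrable_divide) auto
      qed
      show "((\<lambda>h. energy p (\<lambda>x. indicator {a..b} x * D h x)) \<longlongrightarrow> 0) (at_right 0)"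
      proof (rule tendsto_sandwich[OF _ _ tendsto_const l0])
        show "\<forall>\<^sub>F h in at_right 0. energy p (\<lambda>x. indicator {a..b} x * D h x) \<le> ennreal K * Xp_energy p (d h)"
          using small
        proof eventually_elim
          case (elim h)
          have "energy p (\<lambda>x. indicator {a..b} x * D h x) \<le> energy p (orbit B P (d h) i)"
          proof (rule energy_mono_AE)
            have "AE z in lborel. - 1 \<le> z \<and> z < 1 \<longrightarrow> orbit B P (d h) i z = D h z"
              unfolding d_def D_def by (rule orbit_difference) (use elim in auto)
            then show "AE x in lborel. \<bar>indicator {a..b} x * D h x\<bar> \<le> \<bar>orbit B P (d h) i x\<bar>"
              \<comment> \<open>The case b = 1 is allowed, but the window of the orbit is
                half-open.\<close>
              using AE_lborel_singleton[of "1::real"]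
              by eventually_elim (use ab in \<open>auto simp: indicator_def\<close>)
          qed (use p in auto)
          then show ?case using K(2) by (meson order_trans)
        qed
      qed auto
    qed measurable
    moreover have "\<forall>\<^sub>F h in at_right 0. integral {a..b} (D h)
        = (integral {a - h..a} ?F / h - integral {b - h..b} ?F / h) - integral {a..b} ?G"
      using small
    proof eventually_elim
      case (elim h)
      have sh: "(\<lambda>z. ?F (z - h)) integrable_on {a..b}"
        using integrable_shift_real_ivl[where f = ?F and a = "a - h" and b = "b - h" and c = "- h"] int(1) by simp
      have "integral {a..b} (\<lambda>z. ?F (z - h)) = integral {a - h..b - h} ?F"
        using integral_shift_real_ivl[of "a - h" "- h" "b - h" ?F] by simp
      moreover have "integral {a - h..a} ?F + integral {a..b} ?F = integral {a - h..b} ?F"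
        "integral {a - h..b - h} ?F + integral {b - h..b} ?F = integral {a - h..b} ?F"
        using elim ab by (auto intro!: hk_integral_combine int)
      moreover have "integral {a..b} (D h)
          = (integral {a..b} (\<lambda>z. ?F (z - h)) - integral {a..b} ?F) / h - integral {a..b} ?G"
        unfolding D_def using sh int by (simp add: integral_diff integrable_diff integrable_on_divide)
      ultimately show ?case using elim by (simp add: field_simps)
    qed
    ultimately show ?thesis by (rule Lim_transform_eventually)
  qed
  have ae: "AE x in lborel. ((\<lambda>h. integral {x - h..x} ?F / h) \<longlongrightarrow> ?F x) (at_right 0)"
    by (rule lebesgue_differentiation_left[OF int(1)])
  have eq: "?F a - ?F b = integral {a..b} ?G"
    if ab: "- 1 \<le> a" "a \<le> b" "b \<le> 1"
      and la: "((\<lambda>h. integral {a - h..a} ?F / h) \<longlongrightarrow> ?F a) (at_right 0)"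
      and lb: "((\<lambda>h. integral {b - h..b} ?F / h) \<longlongrightarrow> ?F b) (at_right 0)" for a b
    using tendsto_unique[OF trivial_limit_at_right_real key[OF ab] tendsto_diff[OF tendsto_diff[OF la lb] tendsto_const[of "integral {a..b} ?G"]]]
    by simp
  \<comment> \<open>One Lebesgue point serves as the base point that fixes the constant; every other
    Lebesgue point is compared with it.\<close>
  from AE_lborel_Ex[OF _ ae, of "-1" 1] obtain a where a: "- 1 < a" "a < 1"
    and la: "((\<lambda>h. integral {a - h..a} ?F / h) \<longlongrightarrow> ?F a) (at_right 0)" by auto
  have "AE z in lborel. - 1 < z \<and> z < 1 \<longrightarrow> ?F z = (?F a + integral {- 1..a} ?G) - integral {- 1..z} ?G"
    using ae
  proof eventually_elim
    case (elim z)
    show ?case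
    proof
      assume z: "- 1 < z \<and> z < 1"
      have comb: "integral {- 1..u} ?G + integral {u..v} ?G = integral {- 1..v} ?G" if "- 1 \<le> u" "u \<le> v" for u v
        using that by (intro hk_integral_combine int)
      show "?F z = (?F a + integral {- 1..a} ?G) - integral {- 1..z} ?G"
      proof (cases "a \<le> z")
        case True
        then show ?thesis using eq[OF _ _ _ la elim] comb[of a z] a z by auto
      next
        case False
        then show ?thesis using eq[OF _ _ _ elim la] comb[of z a] a z by auto
      qed
    qed
  qed
  then show "\<exists>c. AE z in lborel. - 1 < z \<and> z < 1 \<longrightarrow> ?F z = c - integral {- 1..z} ?G" by blast
qed

lemma generator_T_op:
  fixes B :: "real ^ 'n::finite ^ 'n"
  assumes p: "1 \<le> p"
  shows "generator (Xp p) (Xp_norm p) (T_op B P) = op_graph (dom_A p B P) (op_A P)"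
proof (intro set_eqI iffI)
  fix x assume x: "x \<in> generator (Xp p) (Xp_norm p) (T_op B P)"
  obtain f g where fg: "x = (f, g)" by (cases x)
  have f: "f \<in> Xp p" and g: "g \<in> Xp p" using x fg by (auto simp: generator_def)
  then show "x \<in> op_graph (dom_A p B P) (op_A P)"
    using generator_imp_orbit_primitive[OF p, of f g B P] x unfolding fg op_graph_iff_orbit_primitive[OF p f g] by auto
next
  fix x assume x: "x \<in> op_graph (dom_A p B P) (op_A P)"
  obtain f g where fg: "x = (f, g)" by (cases x)
  then have d: "f \<in> dom_A p B P" and ga: "g = op_A P f" using x by (auto simp: op_graph_def)
  have f: "f \<in> Xp p" using d by (auto simp: dom_A_def W1p_def Xp_def)
  have "weak_deriv (f $ i) \<in> Lp p" for i
    using d weak_deriv_eq by (fastforce simp: dom_A_def W1p_def)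
  then have g: "g \<in> Xp p"
    using subspace_neg[OF subspace_Lp[OF p]] by (auto simp: ga op_A_def Xp_def)
  show "x \<in> generator (Xp p) (Xp_norm p) (T_op B P)"
    using x unfolding fg op_graph_iff_orbit_primitive[OF p f g] by (intro orbit_primitive_imp_generator[OF p f g])
qed

text \<open>The approximants are the time averages of T(s)f over s in [0, h]; in unfolded form they
  are averages of the orbit over [y - h, y]. Such an average lies in the domain, with A mapping it
  to (T(h)f - f) / h, and it tends to f as h tends to 0.\<close>

lemma generator_T_op_dense:
  fixes B :: "real ^ 'n::finite ^ 'n"
  assumes p: "1 \<le> p" and f: "f \<in> Xp p" and e: "0 < e"
  shows "\<exists>k\<in>Domain (generator (Xp p) (Xp_norm p) (T_op B P)). Xp_norm p (f - k) < e"
proof -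
  let ?F = "orbit B P f"
  define u where "u h i y = integral {y - h..y} (?F i) / h" for h i y
  define k where "k h = (\<chi> i. abs_l0 (\<lambda>x. u h i (if i \<in> P then x else 1 - x)))" for h
  have int: "?F i integrable_on {a..b}" for a b i by (rule orbit_integrable_on[OF p f])
  have comb: "integral {a..m} (?F i) + integral {m..b} (?F i) = integral {a..b} (?F i)"
    if "a \<le> m" "m \<le> b" for a m b i
    using that by (intro hk_integral_combine int)
  note small = eventually_at_right_0_less[OF zero_less_one]
  have nk: "AE y in lborel. 0 < y \<and> y < 1 \<longrightarrow> normalized P (k h) y = (\<chi> i. u h i y)" if h: "0 < h" "h < 1" for h
    unfolding k_def
  proof (rule normalized_abs[where Q = "\<lambda>_. True"])
    fix i
    have c: "continuous_on {- 2..2} (\<lambda>z. integral {- 2..z} (?F i))"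
      by (intro indefinite_integral_continuous_1 int)
    have "continuous_on {0<..<1} (\<lambda>y. (integral {- 2..y} (?F i) - integral {- 2..y - h} (?F i)) / h)"
      using h by (auto intro!: continuous_intros continuous_on_compose2[OF c])
    moreover have "(integral {- 2..y} (?F i) - integral {- 2..y - h} (?F i)) / h = u h i y"
      if "y \<in> {0<..<1}" for y
      using comb[of "-2" "y - h" y i] that h by (simp add: u_def)
    ultimately have cu: "continuous_on {0<..<1} (u h i)" by (rule continuous_on_eq)
    have "continuous_on {0<..<1} (\<lambda>x. u h i (if i \<in> P then x else 1 - x))"
      by (cases "i \<in> P") (auto intro!: continuous_intros continuous_on_compose2[OF cu])
    then have "(\<lambda>x. u h i (if i \<in> P then x else 1 - x)) \<in> borel_measurable (restrict_space borel {0<..<1})"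
      by (rule borel_measurable_continuous_on_restrict)
    then show "(\<lambda>x. u h i (if i \<in> P then x else 1 - x)) \<in> borel_measurable unit_interval"
      unfolding unit_interval_def by (subst measurable_cong_sets[OF sets_restrict_space_cong[OF sets_lborel] refl])
  qed simp_all
  have "((\<lambda>h. Xp_energy p (k h - f)) \<longlongrightarrow> 0) (at_right 0)"
  proof (rule tendsto_sandwich[OF _ _ tendsto_const])
    show "((\<lambda>h. \<Sum>i\<in>UNIV. energy p (\<lambda>z. integral {z - h..z} (?F i) / h - ?F i z)) \<longlongrightarrow> 0) (at_right 0)"
      by (intro tendsto_null_sum energy_average_tendsto_0[OF p _ orbit_energy_finite[OF p f]]) simp
    show "\<forall>\<^sub>F h in at_right 0. Xp_energy p (k h - f)
        \<le> (\<Sum>i\<in>UNIV. energy p (\<lambda>z. integral {z - h..z} (?F i) / h - ?F i z))"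
      using small
    proof eventually_elim
      case (elim h)
      show ?case
      proof (rule Xp_energy_le_orbit)
        fix i
        have "AE y in lborel. 0 < y \<and> y < 1 \<longrightarrow> normalized P (k h) y = (\<chi> i. u h i y)" using nk elim by simp
        then show "AE y in lborel. 0 < y \<and> y < 1 \<longrightarrow> normalized P (k h - f) y $ i
            = integral {y - h..y} (?F i) / h - ?F i y"
          using normalized_diff[of P "k h" f]
          by eventually_elim (auto simp: u_def orbit_unit)
      qed (use p in auto)
    qed
  qed auto
  note lim = this
  have "eventually (\<lambda>h. Xp_energy p (k h - f) < 1) (at_right 0)"
    using lim by (rule order_tendstoD) simp
  moreover have "eventually (\<lambda>h. Xp_norm p (k h - f) < e) (at_right 0)"
    using Xp_norm_tendsto_0[OF p lim] e by (rule order_tendstoD)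
  ultimately have "eventually (\<lambda>h. Xp_energy p (k h - f) < 1 \<and> Xp_norm p (k h - f) < e \<and> 0 < h \<and> h < 1) (at_right 0)"
    using small by eventually_elim auto
  then obtain h where h: "Xp_energy p (k h - f) < 1" "Xp_norm p (k h - f) < e" "0 < h" "h < 1"
    using eventually_happens'[OF trivial_limit_at_right_real] by blast
  have "k h - f \<in> Xp p" using h(1) p by (auto simp: Xp_iff intro: less_trans)
  from subspace_add[OF subspace_Xp[OF p] this f] have kX: "k h \<in> Xp p" by simp
  define g where "g = (1 / h) *\<^sub>R (T_op B P h f - f)"
  have gX: "g \<in> Xp p" unfolding g_def using h by (intro Xp_quotient[OF p f]) auto
  have ng: "AE z in lborel. 0 < z \<and> z < 1 \<longrightarrow> normalized P g z $ i = (?F i (z - h) - ?F i z) / h" for i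
  proof -
    \<comment> \<open>Subtracting the zero state brings g into the form of the general difference
      formula.\<close>
    have "AE z in lborel. - 1 \<le> z \<and> z < 1 \<longrightarrow> orbit B P (g - 0) i z
      = (?F i (z - h) - ?F i z) / h - orbit B P 0 i z"
      unfolding g_def by (rule orbit_difference) (use h in auto)
    then show ?thesis
      using normalized_scaleR[of P 0 0]
      by eventually_elim (auto simp: orbit_unit)
  qed
  have intg: "integral {0..y} (\<lambda>s. normalized P g s $ i) = u h i 0 - u h i y" if y: "0 \<le> y" "y \<le> 1" for y i
  proof -
    have "integral {0..y} (\<lambda>s. normalized P g s $ i)
        = integral {0..y} (\<lambda>s. indicator {0<..<1} s * ((?F i (s - h) - ?F i s) / h))"
    proof (rule integral_cong_AE_real)
      show "AE s in lborel. normalized P g s $ i = indicator {0<..<1} s * ((?F i (s - h) - ?F i s) / h)"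
        using ng[of i] by eventually_elim (auto simp: indicator_def normalized_outside)
    qed
    also have "\<dots> = integral {0..y} (\<lambda>s. (?F i (s - h) - ?F i s) / h)"
      by (rule integral_spike[of "{0, 1}"]) (use y in \<open>auto simp: indicator_def\<close>)
    also have "\<dots> = (integral {0..y} (\<lambda>s. ?F i (s - h)) - integral {0..y} (?F i)) / h"
      using integrable_shift_real_ivl[OF int[of i "- h" "y - h"], of "- h"] int[of i 0 y]
      by (simp add: integral_diff)
    also have "integral {0..y} (\<lambda>s. ?F i (s - h)) = integral {- h..y - h} (?F i)"
      using integral_shift_real_ivl[of "- h" "- h" "y - h" "?F i"] by simp
    also have "(integral {- h..y - h} (?F i) - integral {0..y} (?F i)) / h = u h i 0 - u h i y"
      using comb[of "- h" "y - h" y i] comb[of "- h" 0 y i] h(3) y by (simp add: u_def field_simps)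
    finally show ?thesis .
  qed
  have prim: "inflow_primitive P (k h) g i (u h i 0)" for i
  proof -
    have "AE y in lborel. 0 < y \<and> y < 1 \<longrightarrow> normalized P (k h) y = (\<chi> i. u h i y)" using nk h by simp
    then show ?thesis
      unfolding inflow_primitive_def by eventually_elim (auto simp: intg)
  qed
  \<comment> \<open>By \<open>intg\<close> the bracket equals u h j 1, so the claim is that the
    average over [-h, 0] is B applied to the average over [1 - h, 1].\<close>
  have boundary: "u h i 0 = (\<Sum>j\<in>UNIV. B $ i $ j * (u h j 0 - integral {0..1} (\<lambda>s. normalized P g s $ j)))" for i
    using integral_orbit_neg[OF p f, of "- h" B P i] h
    by (simp add: intg) (simp add: u_def sum_divide_distrib)
  have "(k h, g) \<in> op_graph (dom_A p B P) (op_A P)"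
    unfolding op_graph_iff_primitive[OF p kX gX]
    by (rule exI[of _ "\<lambda>i. u h i 0"], intro conjI allI prim boundary)
  then have "k h \<in> Domain (generator (Xp p) (Xp_norm p) (T_op B P))"
    unfolding generator_T_op[OF p] by blast
  moreover have "Xp_norm p (f - k h) < e"
    using h(2) Xp_norm_scaleR[OF p, of "-1" "k h - f"] by simp
  ultimately show ?thesis by blast
qed

theorem theorem3p6:
  fixes p :: real
    and m m_plus m_minus :: nat
    and B :: "real ^ 'n ^ 'n"
    and P :: "'n::finite set"
  assumes "1 \<le> p"
    and "m_plus + m_minus = 2 * m" and "1 \<le> 2 * m"
    and "card P = m_plus" and "card (- P) = m_minus"
  shows "C0_semigroup (Xp p) (Xp_norm p) (T_op B P)
    \<and> generator (Xp p) (Xp_norm p) (T_op B P) = op_graph (dom_A p B P) (op_A P)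
    \<and> (\<forall>G. C0_semigroup (Xp p) (Xp_norm p) G
          \<and> generator (Xp p) (Xp_norm p) G = op_graph (dom_A p B P) (op_A P)
        \<longrightarrow> (\<forall>t\<ge>0. \<forall>f\<in>Xp p. T_op B P t f = G t f))"
proof (intro conjI allI impI ballI)
  note p = \<open>1 \<le> p\<close>
  show sg: "C0_semigroup (Xp p) (Xp_norm p) (T_op B P)" by (rule C0_semigroup_T_op[OF p])
  show gen: "generator (Xp p) (Xp_norm p) (T_op B P) = op_graph (dom_A p B P) (op_A P)"
    by (rule generator_T_op[OF p])
  fix G :: "real \<Rightarrow> l0 ^ 'n \<Rightarrow> l0 ^ 'n" and t and f :: "l0 ^ 'n"
  assume G: "C0_semigroup (Xp p) (Xp_norm p) G
      \<and> generator (Xp p) (Xp_norm p) G = op_graph (dom_A p B P) (op_A P)"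
    and t: "(0::real) \<le> t" and f: "f \<in> Xp p"
  show "T_op B P t f = G t f"
  proof (rule C0_semigroup_unique[OF subspace_Xp[OF p] Xp_norm_add[OF p] Xp_norm_scaleR[OF p]
        Xp_norm_zero_imp[OF p] sg _ _ _ generator_T_op_dense[OF p] t f])
    fix s :: real assume "0 \<le> s"
    obtain N :: nat where "s \<le> real N" using real_arch_simple by blast
    moreover obtain C where "\<forall>s\<in>{0..real N}. \<forall>f\<in>Xp p. Xp_norm p (T_op B P s f) \<le> C * Xp_norm p f"
      using T_op_norm_bound[OF p, of N B P] by blast
    ultimately have "\<forall>r\<in>{0..s}. \<forall>f\<in>Xp p. Xp_norm p (T_op B P r f) \<le> C * Xp_norm p f" by auto
    then show "\<exists>C. \<forall>r\<in>{0..s}. \<forall>f\<in>Xp p. Xp_norm p (T_op B P r f) \<le> C * Xp_norm p f" by (rule exI)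
  qed (use G gen in auto)
qed

end
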